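(* Let $T\in\mathcal{K}(V)$ be bisectorial of angle $\omega\in(0,\frac{\pi}{2})$ and let $p,q$ be two intrinsic polynomials such that i) $\deg(q)\geq\deg(p)$, ii) $q$ does not have any zeros in $\overline{D_\omega}$. Then $q[T]$ is bijective (from $\operatorname{dom}(q[T])$ onto $V$), there exists some $\theta\in(\omega,\frac{\pi}{2})$ such that $\frac{p}{q}\in\mathcal{N}^{\mathrm{bnd}}(D_\theta)$, and $$\Big(\frac{p}{q}\Big)(T)=p[T]q[T]^{-1},$$ where the left hand side is given by the extended $\omega$-functional calculus.
   Context: Clifford setting. Fix an integer $n\geq 1$. $\mathbb{R}_n$ is the real Clifford algebra generated by $e_1,\dots,e_n$ with $e_i^2=-1$, $e_ie_j=-e_je_i$ ($i\neq j$), with basis $e_A=e_{i_1}\cdots e_{i_r}$ for $A=(i_1<\dots<i_r)$, $e_\emptyset=1$, and $|s|^2=\sum_As_A^2$ for $s=\sum_As_Ae_A$. Paravectors: $\mathbb{R}^{n+1}=\{s_0+s_1e_1+\dots+s_ne_n\}\subseteq\mathbb{R}_n$ with $\overline{s}=s_0-s_1e_1-\dots-s_ne_n$. $\mathbb{S}=\{s\in\mathbb{R}^{n+1}: s_0=0,|s|=1\}$ and $\mathbb{C}_J=\{x+Jy: x,y\in\mathbb{R}\}$ for $J\in\mathbb{S}$. $U\subseteq\mathbb{R}^{n+1}$ is axially symmetric if $x+Jy\in U$ ($x,y\in\mathbb{R}$, $J\in\mathbb{S}$) implies $x+Iy\in U$ for all $I\in\mathbb{S}$. Slice hyperholomorphic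 functions. For $U$ open and axially symmetric, $f:U\to\mathbb{R}_n$ is left slice hyperholomorphic ($f\in\mathcal{SH}_L(U)$) if there are continuously differentiable $f_0,f_1:\{(x,y)\in\mathbb{R}^2: x+\mathbb{S}y\subseteq U\}\to\mathbb{R}_n$ with $f(x+Jy)=f_0(x,y)+Jf_1(x,y)$ for all $J\in\mathbb{S}$, $f_0(x,-y)=f_0(x,y)$, $f_1(x,-y)=-f_1(x,y)$, $\partial_xf_0=\partial_yf_1$, $\partial_yf_0=-\partial_xf_1$. If $f_0,f_1$ are real valued, $f$ is called intrinsic ($f\in\mathcal{N}(U)$). Operators. $V_\mathbb{R}$ is a real Banach space, $V=\{\sum_Av_A\otimes e_A: v_A\in V_\mathbb{R}\}$ the corresponding Clifford module with norm $\|v\|^2=\sum_A\|v_A\|^2$ and the natural left and right multiplications by $\mathbb{R}_n$. $\mathcal{B}(V)$: bounded everywhere defined right-linear operators; $\mathcal{K}(V)$: closed right-linear operators $T:\operatorname{dom}(T)\to V$ with right-linear domain $\operatorname{dom}(T)\subseteq V$. A Clifford number $a$ is identified with the operator $v\mapsto av$, so $(aT)v=a(Tv)$, $(Ta)v=T(av)$. For $s\in\mathbb{R}^{n+1}$, $Q_s[T]=T^2-2s_0T+|s|^2$ on $\operatorname{dom}(T^2)$; $\rho_S(T)=\{s\in\mathbb{R}^{n+1}: Q_s[T]^{-1}\in\mathcal{B}(V)\}$, $\sigma_S(T)=\mathbb{R}^{n+1}\setminus\rho_S(T)$, and $S_L^{-1}(s,T)=Q_s[T]^{-1}\overline{s}-TQ_s[T]^{-1}$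 for $s\in\rho_S(T)$. Bisectorial operators. For $\omega\in(0,\frac{\pi}{2})$, $I_\omega=(-\omega,\omega)\cup(\pi-\omega,\pi+\omega)$ and $D_\omega=\{re^{J\phi}: r>0,\,J\in\mathbb{S},\,\phi\in I_\omega\}\subseteq\mathbb{R}^{n+1}$ (so $0\in\overline{D_\omega}$). $T\in\mathcal{K}(V)$ is bisectorial of angle $\omega$ if $\sigma_S(T)\subseteq\overline{D_\omega}$ and for every $\varphi\in(\omega,\frac{\pi}{2})$ there is $C_\varphi\geq 0$ with $\|S_L^{-1}(s,T)\|\leq\frac{C_\varphi}{|s|}$ for all $s\in\mathbb{R}^{n+1}\setminus(D_\varphi\cup\{0\})$. $\omega$-functional calculus. $\mathcal{SH}_L^0(D_\theta)$ is the set of bounded $f\in\mathcal{SH}_L(D_\theta)$ with $\int_0^\infty|f(te^{J\phi})|\frac{dt}{t}<\infty$ for all $J\in\mathbb{S}$, $\phi\in I_\theta$; $\mathcal{N}^0(D_\theta)$ is the set of intrinsic such functions. For $T$ bisectorial of angle $\omega$, $\theta\in(\omega,\frac{\pi}{2})$ and $f\in\mathcal{SH}_L^0(D_\theta)$, $$f(T)=\frac{1}{2\pi}\int_{\partial D_\varphi\cap\mathbb{C}_J}S_L^{-1}(s,T)ds_Jf(s):=\frac{1}{2\pi}\sum_\pm\int_\mathbb{R}S_L^{-1}(\gamma_\pm(t),T)\frac{\gamma_\pm'(t)}{J}f(\gamma_\pm(t))dt\in\mathcal{B}(V),$$ with $\gamma_\pm(t)=\pm|t|e^{-\operatorname{sgn}(t)J\varphi}$;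 it does not depend on the choice of $\varphi\in(\omega,\theta)$ and $J\in\mathbb{S}$. Extended $\omega$-functional calculus. $\mathcal{N}^{\mathrm{bnd}}(D_\theta)$ is the set of functions $g(s)=g_\infty+\frac{1}{1+s^2}(g_0-g_\infty)+\widetilde{g}(s)$ on $D_\theta$ with $g_0,g_\infty\in\mathbb{R}$, $\widetilde{g}\in\mathcal{N}^0(D_\theta)$ (unique components). For such $g$, $g(T):=g_\infty+(1+T^2)^{-1}(g_0-g_\infty)+\widetilde{g}(T)\in\mathcal{B}(V)$, with $\widetilde{g}(T)$ from the $\omega$-functional calculus; here $1+T^2$ is boundedly invertible since $\mathbb{S}\subseteq\rho_S(T)$. Polynomials. An intrinsic polynomial of degree $m$ is $p(s)=p_0+p_1s+\dots+p_ms^m$ with real coefficients, $p_m\neq 0$, as a function of $s\in\mathbb{R}^{n+1}$; $p[T]=p_0+p_1T+\dots+p_mT^m$ with $\operatorname{dom}(p[T])=\operatorname{dom}(T^m)$. *)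

theory Defs
  imports
    "HOL-Analysis.Analysis"
    "HOL-Computational_Algebra.Polynomial"
begin

section \<open>The Clifford algebra and the Clifford module\<close>

text \<open>
  The generators are indexed by a finite linearly ordered type \<open>'n\<close>, and \<open>n = CARD('n) \<ge> 1\<close>.
  An element is the family of its coefficients with respect to the basis \<open>ebasis A\<close>, \<open>A\<close> ranging over
  the sets of generators, so the norm of the library type \<open>vec\<close> is the Clifford norm.
  The library product \<open>*\<close> on \<open>vec\<close> is componentwise and is not used; the Clifford product is
  \<open>cmul\<close>. In the same way, \<open>'v ^ 'n set\<close> with the library norm is the Clifford module over the
  real Banach space \<open>'v\<close>.
\<close>

type_synonym 'n clifford = "real ^ 'n set"
type_synonym ('v, 'n) cmodule = "'v ^ 'n set"

definition ebasis :: "'n::{finite,linorder} set \<Rightarrow> 'n clifford" where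
  "ebasis A = axis A 1"

text \<open>
  \<open>ebasis A\<close> times \<open>ebasis B\<close> is \<open>csign A B\<close> times \<open>ebasis (sym_diff A B)\<close>: every pair of \<open>a \<in> A\<close> and \<open>b \<in> B\<close>
  with \<open>b < a\<close> costs one transposition, every common element one relation \<open>e\<^sub>i\<^sup>2 = -1\<close>.
\<close>

definition csign :: "'n::{finite,linorder} set \<Rightarrow> 'n set \<Rightarrow> real" where
  "csign A B = (\<Prod>a\<in>A. \<Prod>b\<in>B. if b \<le> a then - 1 else 1)"

definition cmul :: "'n::{finite,linorder} clifford \<Rightarrow> 'n clifford \<Rightarrow> 'n clifford" where
  "cmul a b = (\<Sum>A\<in>UNIV. \<Sum>B\<in>UNIV. axis (sym_diff A B) (csign A B * (a $ A) * (b $ B)))"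

definition lmul :: "'n::{finite,linorder} clifford \<Rightarrow> ('v::real_vector, 'n) cmodule \<Rightarrow> ('v, 'n) cmodule" where
  "lmul a v = (\<Sum>A\<in>UNIV. \<Sum>B\<in>UNIV. axis (sym_diff A B) ((csign A B * (a $ A)) *\<^sub>R (v $ B)))"

definition rmul :: "('v::real_vector, 'n::{finite,linorder}) cmodule \<Rightarrow> 'n clifford \<Rightarrow> ('v, 'n) cmodule" where
  "rmul v a = (\<Sum>B\<in>UNIV. \<Sum>A\<in>UNIV. axis (sym_diff B A) ((csign B A * (a $ A)) *\<^sub>R (v $ B)))"

definition creal :: "real \<Rightarrow> 'n::{finite,linorder} clifford" where
  "creal r = r *\<^sub>R ebasis {}"

primrec cpow :: "'n::{finite,linorder} clifford \<Rightarrow> nat \<Rightarrow> 'n clifford" where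
  "cpow s 0 = ebasis {}"
| "cpow s (Suc k) = cmul s (cpow s k)"

definition cinv :: "'n::{finite,linorder} clifford \<Rightarrow> 'n clifford" where
  "cinv a = (THE b. cmul a b = ebasis {} \<and> cmul b a = ebasis {})"

text \<open>The following facts identify the construction as the Clifford algebra.\<close>

lemma csign_sym_diff_left: "csign (sym_diff A B) C = csign A C * csign B C"
proof -
  define f :: "'a \<Rightarrow> real" where "f a = (\<Prod>c\<in>C. if c \<le> a then - 1 else 1)" for a
  have sq: "f a * f a = 1" for a
    unfolding f_def prod.distrib[symmetric] by (intro prod.neutral) auto
  have A: "prod f A = prod f (A - B) * prod f (A \<inter> B)"
    by (subst prod.union_disjoint[symmetric]) (auto intro!: prod.cong)
  have B: "prod f B = prod f (B - A) * prod f (A \<inter> B)"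
    by (subst prod.union_disjoint[symmetric]) (auto intro!: prod.cong)
  have I: "prod f (A \<inter> B) * prod f (A \<inter> B) = 1"
    unfolding prod.distrib[symmetric] by (intro prod.neutral) (auto simp: sq)
  have "prod f (sym_diff A B) = prod f (A - B) * prod f (B - A)"
    by (rule prod.union_disjoint) auto
  with A B I have "prod f (sym_diff A B) = prod f A * prod f B"
    by (simp add: mult.assoc mult.left_commute)
  then show ?thesis by (simp add: csign_def f_def)
qed

lemma csign_sym_diff_right: "csign C (sym_diff A B) = csign C A * csign C B"
proof -
  define f :: "'a \<Rightarrow> real" where "f b = (\<Prod>c\<in>C. if b \<le> c then - 1 else 1)" for b
  have sq: "f a * f a = 1" for a
    unfolding f_def prod.distrib[symmetric] by (intro prod.neutral) auto
  have A: "prod f A = prod f (A - B) * prod f (A \<inter> B)"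
    by (subst prod.union_disjoint[symmetric]) (auto intro!: prod.cong)
  have B: "prod f B = prod f (B - A) * prod f (A \<inter> B)"
    by (subst prod.union_disjoint[symmetric]) (auto intro!: prod.cong)
  have I: "prod f (A \<inter> B) * prod f (A \<inter> B) = 1"
    unfolding prod.distrib[symmetric] by (intro prod.neutral) (auto simp: sq)
  have "prod f (sym_diff A B) = prod f (A - B) * prod f (B - A)"
    by (rule prod.union_disjoint) auto
  with A B I have *: "prod f (sym_diff A B) = prod f A * prod f B"
    by (simp add: mult.assoc mult.left_commute)
  have "csign C D = prod f D" for D
    unfolding csign_def f_def by (rule prod.swap)
  with * show ?thesis by simp
qed

lemma cmul_e: "cmul (ebasis A) (ebasis B) = csign A B *\<^sub>R ebasis (sym_diff A B)"
proof -
  have "cmul (ebasis A) (ebasis B) = (\<Sum>A'\<in>UNIV. \<Sum>B'\<in>UNIV. if B' = B then if A' = A then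
      axis (sym_diff A B) (csign A B) else 0 else 0)"
    unfolding cmul_def ebasis_def by (intro sum.cong refl) (auto simp: axis_def vec_eq_iff)
  also have "\<dots> = axis (sym_diff A B) (csign A B)"
    by simp
  finally show ?thesis by (simp add: ebasis_def axis_def vec_eq_iff)
qed

lemma clifford_square: "cmul (ebasis {i}) (ebasis {i}) = - ebasis {}"
  by (simp add: cmul_e csign_def)

lemma clifford_anticommute: "i \<noteq> j \<Longrightarrow> cmul (ebasis {i}) (ebasis {j}) = - cmul (ebasis {j}) (ebasis {i})"
  by (auto simp: cmul_e csign_def Un_commute insert_commute Diff_insert0)

lemma clifford_basis: "(\<And>j. j \<in> A \<Longrightarrow> i < j) \<Longrightarrow> ebasis (insert i A) = cmul (ebasis {i}) (ebasis A)"
proof -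
  assume less: "\<And>j. j \<in> A \<Longrightarrow> i < j"
  then have "i \<notin> A" by blast
  moreover from less have "csign {i} A = 1"
    by (auto simp: csign_def intro!: prod.neutral) (use not_le in blast)
  ultimately show ?thesis by (simp add: cmul_e)
qed

lemma axis_apply: "axis A r $ B = (if B = A then r else 0)"
  by (simp add: axis_def)

lemma axis_zero: "axis A (0 :: 'b::zero) = 0"
  by (simp add: axis_def vec_eq_iff)

lemma clifford_one [simp]:
  fixes v :: "('v::real_vector, 'n::{finite,linorder}) cmodule"
  shows "lmul (ebasis {}) v = v" "rmul v (ebasis {}) = v"
proof -
  have *: "(\<Sum>B\<in>UNIV. axis B (v $ B)) = v"
    by (simp add: vec_eq_iff axis_def)
  have "lmul (ebasis {}) v = (\<Sum>A\<in>UNIV. if A = ({} :: 'n set) then \<Sum>B\<in>UNIV. axis B (v $ B) else 0)"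
    unfolding lmul_def ebasis_def
    by (rule sum.cong[OF refl]) (simp add: csign_def axis_apply axis_zero)
  then show "lmul (ebasis {}) v = v" by (simp add: *)
  have "rmul v (ebasis {}) = (\<Sum>B\<in>UNIV. \<Sum>A\<in>UNIV. if A = ({} :: 'n set) then axis B (v $ B) else 0)"
    unfolding rmul_def ebasis_def
    by (intro sum.cong refl) (simp add: csign_def axis_apply axis_zero)
  then show "rmul v (ebasis {}) = v" by (simp add: *)
qed

lemma cmul_eq_lmul: "cmul a b = lmul a b" and cmul_eq_rmul: "cmul a b = rmul a b"
  by (simp_all add: cmul_def lmul_def rmul_def ac_simps)

lemma axis_sum: "axis A (\<Sum>i\<in>I. f i) = (\<Sum>i\<in>I. axis A (f i))"
  by (simp add: vec_eq_iff axis_def)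

lemma lmul_sum_right: "lmul a (\<Sum>i\<in>I. f i) = (\<Sum>i\<in>I. lmul a (f i))"
proof -
  have "lmul a (\<Sum>i\<in>I. f i)
      = (\<Sum>A\<in>UNIV. \<Sum>B\<in>UNIV. \<Sum>i\<in>I. axis (sym_diff A B) ((csign A B * (a $ A)) *\<^sub>R (f i $ B)))"
    by (simp add: lmul_def scaleR_sum_right axis_sum)
  also have "\<dots> = (\<Sum>A\<in>UNIV. \<Sum>i\<in>I. \<Sum>B\<in>UNIV. axis (sym_diff A B) ((csign A B * (a $ A)) *\<^sub>R (f i $ B)))"
    by (rule sum.cong[OF refl], rule sum.swap)
  also have "\<dots> = (\<Sum>i\<in>I. lmul a (f i))"
    unfolding lmul_def by (rule sum.swap)
  finally show ?thesis .
qed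

lemma lmul_sum_left: "lmul (\<Sum>i\<in>I. f i) v = (\<Sum>i\<in>I. lmul (f i) v)"
proof -
  have "lmul (\<Sum>i\<in>I. f i) v
      = (\<Sum>A\<in>UNIV. \<Sum>B\<in>UNIV. \<Sum>i\<in>I. axis (sym_diff A B) ((csign A B * (f i $ A)) *\<^sub>R (v $ B)))"
    by (simp add: lmul_def scaleR_sum_left axis_sum sum_distrib_left)
  also have "\<dots> = (\<Sum>A\<in>UNIV. \<Sum>i\<in>I. \<Sum>B\<in>UNIV. axis (sym_diff A B) ((csign A B * (f i $ A)) *\<^sub>R (v $ B)))"
    by (rule sum.cong[OF refl], rule sum.swap)
  also have "\<dots> = (\<Sum>i\<in>I. lmul (f i) v)"
    unfolding lmul_def by (rule sum.swap)
  finally show ?thesis .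
qed

lemma lmul_axis_right:
  "lmul a (axis B v) = (\<Sum>A\<in>UNIV. axis (sym_diff A B) ((csign A B * (a $ A)) *\<^sub>R v))"
proof -
  have "lmul a (axis B v) = (\<Sum>A\<in>UNIV. \<Sum>B'\<in>UNIV. if B' = B then
      axis (sym_diff A B) ((csign A B * (a $ A)) *\<^sub>R v) else 0)"
    unfolding lmul_def by (intro sum.cong refl) (auto simp: axis_def vec_eq_iff)
  then show ?thesis by simp
qed

lemma lmul_axis_left:
  "lmul (axis A r) v = (\<Sum>B\<in>UNIV. axis (sym_diff A B) ((csign A B * r) *\<^sub>R (v $ B)))"
proof -
  have "lmul (axis A r) v = (\<Sum>A'\<in>UNIV. if A' = A then
      \<Sum>B\<in>UNIV. axis (sym_diff A B) ((csign A B * r) *\<^sub>R (v $ B)) else 0)"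
    unfolding lmul_def by (rule sum.cong[OF refl]) (simp add: axis_apply axis_zero)
  then show ?thesis by simp
qed

lemma sym_diff_assoc: "sym_diff (sym_diff A B) C = sym_diff A (sym_diff B C)"
  by blast

lemma lmul_assoc: "lmul (cmul a b) v = lmul a (lmul b v)"
proof -
  have "lmul (cmul a b) v = (\<Sum>A\<in>UNIV. \<Sum>B\<in>UNIV. \<Sum>C\<in>UNIV. axis (sym_diff (sym_diff A B) C)
      ((csign (sym_diff A B) C * (csign A B * (a $ A) * (b $ B))) *\<^sub>R (v $ C)))"
    unfolding cmul_def by (simp only: lmul_sum_left lmul_axis_left)
  also have "\<dots> = (\<Sum>A\<in>UNIV. \<Sum>B\<in>UNIV. \<Sum>C\<in>UNIV. axis (sym_diff A (sym_diff B C))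
      ((csign A (sym_diff B C) * (a $ A)) *\<^sub>R ((csign B C * (b $ B)) *\<^sub>R (v $ C))))"
    unfolding csign_sym_diff_left csign_sym_diff_right sym_diff_assoc
    by (simp add: mult.assoc mult.left_commute)
  also have "\<dots> = (\<Sum>B\<in>UNIV. \<Sum>A\<in>UNIV. \<Sum>C\<in>UNIV. axis (sym_diff A (sym_diff B C))
      ((csign A (sym_diff B C) * (a $ A)) *\<^sub>R ((csign B C * (b $ B)) *\<^sub>R (v $ C))))"
    by (rule sum.swap)
  also have "\<dots> = (\<Sum>B\<in>UNIV. \<Sum>C\<in>UNIV. \<Sum>A\<in>UNIV. axis (sym_diff A (sym_diff B C))
      ((csign A (sym_diff B C) * (a $ A)) *\<^sub>R ((csign B C * (b $ B)) *\<^sub>R (v $ C))))"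
    by (rule sum.cong[OF refl], rule sum.swap)
  also have "\<dots> = (\<Sum>B\<in>UNIV. \<Sum>C\<in>UNIV. lmul a (axis (sym_diff B C) ((csign B C * (b $ B)) *\<^sub>R (v $ C))))"
    by (simp only: lmul_axis_right)
  also have "\<dots> = lmul a (lmul b v)"
    by (simp only: lmul_sum_right lmul_def[of b v])
  finally show ?thesis .
qed

corollary cmul_assoc: "cmul (cmul a b) c = cmul a (cmul b c)"
  by (metis lmul_assoc cmul_eq_lmul)


section \<open>Paravectors and double sectors\<close>

definition paravectors :: "'n::{finite,linorder} clifford set" where
  "paravectors = {s. \<forall>A. 2 \<le> card A \<longrightarrow> s $ A = 0}"

definition cconj :: "'n::{finite,linorder} clifford \<Rightarrow> 'n clifford" where
  "cconj s = (\<chi> A. if A = {} then s $ A else - (s $ A))"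

definition imag_units :: "'n::{finite,linorder} clifford set" where
  "imag_units = {s \<in> paravectors. s $ {} = 0 \<and> norm s = 1}"

text \<open>Since \<open>J\<^sup>2 = -1\<close> for \<open>J \<in> imag_units\<close>, this is the exponential of \<open>J \<phi>\<close>.\<close>

definition cexp :: "'n::{finite,linorder} clifford \<Rightarrow> real \<Rightarrow> 'n clifford" where
  "cexp J \<phi> = creal (cos \<phi>) + sin \<phi> *\<^sub>R J"

definition angles :: "real \<Rightarrow> real set" where
  "angles \<omega> = {- \<omega><..<\<omega>} \<union> {pi - \<omega><..<pi + \<omega>}"

definition dsector :: "real \<Rightarrow> 'n::{finite,linorder} clifford set" where
  "dsector \<omega> = {r *\<^sub>R cexp J \<phi> | r J \<phi>. 0 < r \<and> J \<in> imag_units \<and> \<phi> \<in> angles \<omega>}"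


section \<open>Slice hyperholomorphic functions\<close>

text \<open>Functions on \<open>U\<close> are represented by total functions whose values outside \<open>U\<close> play no role.\<close>

definition slice_dom :: "'n::{finite,linorder} clifford set \<Rightarrow> (real \<times> real) set" where
  "slice_dom U = {(x, y). \<forall>J\<in>imag_units. creal x + y *\<^sub>R J \<in> U}"

definition C1_on :: "(real \<times> real) set \<Rightarrow> (real \<times> real \<Rightarrow> 'b::real_normed_vector)
    \<Rightarrow> (real \<times> real \<Rightarrow> (real \<times> real) \<Rightarrow>\<^sub>L 'b) \<Rightarrow> bool" where
  "C1_on W f f' \<longleftrightarrow> (\<forall>z\<in>W. (f has_derivative blinfun_apply (f' z)) (at z)) \<and> continuous_on W f'"

text \<open>\<open>blinfun_apply (f' z)\<close> maps \<open>(1, 0)\<close> and \<open>(0, 1)\<close> to the partial derivatives of \<open>f\<close> at \<open>z\<close>.\<close>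

definition slice_components :: "'n::{finite,linorder} clifford set \<Rightarrow> ('n clifford \<Rightarrow> 'n clifford)
    \<Rightarrow> (real \<times> real \<Rightarrow> 'n clifford) \<Rightarrow> (real \<times> real \<Rightarrow> 'n clifford) \<Rightarrow> bool" where
  "slice_components U f f0 f1 \<longleftrightarrow>
     (\<forall>(x, y)\<in>slice_dom U.
        (\<forall>J\<in>imag_units. f (creal x + y *\<^sub>R J) = f0 (x, y) + cmul J (f1 (x, y))) \<and>
        f0 (x, - y) = f0 (x, y) \<and> f1 (x, - y) = - f1 (x, y)) \<and>
     (\<exists>f0' f1'. C1_on (slice_dom U) f0 f0' \<and> C1_on (slice_dom U) f1 f1' \<and>
        (\<forall>z\<in>slice_dom U.
           blinfun_apply (f0' z) (1, 0) = blinfun_apply (f1' z) (0, 1) \<and>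
           blinfun_apply (f0' z) (0, 1) = - blinfun_apply (f1' z) (1, 0)))"

definition SHL :: "'n::{finite,linorder} clifford set \<Rightarrow> ('n clifford \<Rightarrow> 'n clifford) set" where
  "SHL U = {f. \<exists>f0 f1. slice_components U f f0 f1}"

definition intrinsic :: "'n::{finite,linorder} clifford set \<Rightarrow> ('n clifford \<Rightarrow> 'n clifford) set" where
  "intrinsic U = {f. \<exists>f0 f1. slice_components U f f0 f1 \<and>
     (\<forall>z\<in>slice_dom U. f0 z \<in> range creal \<and> f1 z \<in> range creal)}"

definition SHL0 :: "real \<Rightarrow> ('n::{finite,linorder} clifford \<Rightarrow> 'n clifford) set" where
  "SHL0 \<theta> = {f \<in> SHL (dsector \<theta>). bounded (f ` dsector \<theta>) \<and>
     (\<forall>J\<in>imag_units. \<forall>\<phi>\<in>angles \<theta>. (\<lambda>t. norm (f (t *\<^sub>R cexp J \<phi>)) / t) integrable_on {0<..})}"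

definition N0 :: "real \<Rightarrow> ('n::{finite,linorder} clifford \<Rightarrow> 'n clifford) set" where
  "N0 \<theta> = SHL0 \<theta> \<inter> intrinsic (dsector \<theta>)"

definition bnd_components :: "real \<Rightarrow> ('n::{finite,linorder} clifford \<Rightarrow> 'n clifford)
    \<Rightarrow> real \<Rightarrow> real \<Rightarrow> ('n clifford \<Rightarrow> 'n clifford) \<Rightarrow> bool" where
  "bnd_components \<theta> g g0 ginf gt \<longleftrightarrow> gt \<in> N0 \<theta> \<and>
     (\<forall>s\<in>dsector \<theta>. g s = creal ginf + (g0 - ginf) *\<^sub>R cinv (creal 1 + cpow s 2) + gt s)"

definition Nbnd :: "real \<Rightarrow> ('n::{finite,linorder} clifford \<Rightarrow> 'n clifford) set" where
  "Nbnd \<theta> = {g. \<exists>g0 ginf gt. bnd_components \<theta> g g0 ginf gt}"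

definition cpoly :: "real poly \<Rightarrow> 'n::{finite,linorder} clifford \<Rightarrow> 'n clifford" where
  "cpoly p s = (\<Sum>k\<le>degree p. coeff p k *\<^sub>R cpow s k)"

definition cratio :: "real poly \<Rightarrow> real poly \<Rightarrow> 'n::{finite,linorder} clifford \<Rightarrow> 'n clifford" where
  "cratio p q s = cmul (cpoly p s) (cinv (cpoly q s))"


section \<open>Operators\<close>

text \<open>
  An operator is a partial function; \<open>dom T\<close> is its domain and \<open>\<circ>\<^sub>m\<close> the composition on the
  natural domain.
\<close>

definition right_linear :: "(('v::real_vector, 'n::{finite,linorder}) cmodule \<rightharpoonup> ('v, 'n) cmodule) \<Rightarrow> bool" where
  "right_linear T \<longleftrightarrow> 0 \<in> dom T \<and>
     (\<forall>v\<in>dom T. \<forall>w\<in>dom T. T (v + w) = Some (the (T v) + the (T w))) \<and>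
     (\<forall>v\<in>dom T. \<forall>a. T (rmul v a) = Some (rmul (the (T v)) a))"

definition closed_op :: "(('v::banach, 'n::{finite,linorder}) cmodule \<rightharpoonup> ('v, 'n) cmodule) \<Rightarrow> bool" where
  "closed_op T \<longleftrightarrow> right_linear T \<and> closed {(v, w). T v = Some w}"

definition bounded_op :: "(('v::banach, 'n::{finite,linorder}) cmodule \<rightharpoonup> ('v, 'n) cmodule) \<Rightarrow> bool" where
  "bounded_op T \<longleftrightarrow> right_linear T \<and> dom T = UNIV \<and> (\<exists>C. \<forall>v. norm (the (T v)) \<le> C * norm v)"

text \<open>To be used only for operators satisfying \<open>bounded_op\<close>.\<close>

definition to_blinfun :: "('a::real_normed_vector \<rightharpoonup> 'a) \<Rightarrow> 'a \<Rightarrow>\<^sub>L 'a" where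
  "to_blinfun T = Blinfun (\<lambda>v. the (T v))"

definition lmul_op :: "'n::{finite,linorder} clifford
    \<Rightarrow> ('v::banach, 'n) cmodule \<Rightarrow>\<^sub>L ('v, 'n) cmodule" where
  "lmul_op a = Blinfun (lmul a)"

definition op_minus :: "('a::ab_group_add \<rightharpoonup> 'a) \<Rightarrow> ('a \<rightharpoonup> 'a) \<Rightarrow> ('a \<rightharpoonup> 'a)" where
  "op_minus S T v = (if v \<in> dom S \<inter> dom T then Some (the (S v) - the (T v)) else None)"

definition op_rmul :: "(('v::real_vector, 'n::{finite,linorder}) cmodule \<rightharpoonup> ('v, 'n) cmodule)
    \<Rightarrow> 'n clifford \<Rightarrow> (('v, 'n) cmodule \<rightharpoonup> ('v, 'n) cmodule)" where
  "op_rmul T a v = T (lmul a v)"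

text \<open>
  Defined exactly at the vectors with a unique preimage; for an injective \<open>T\<close> this is the inverse
  on the range of \<open>T\<close>, and \<open>dom (op_inv T) = UNIV\<close> iff \<open>T\<close> is bijective from \<open>dom T\<close> onto the space.
\<close>

definition op_inv :: "('a \<rightharpoonup> 'a) \<Rightarrow> ('a \<rightharpoonup> 'a)" where
  "op_inv T w = (if \<exists>!v. T v = Some w then Some (THE v. T v = Some w) else None)"

primrec op_pow :: "('a \<rightharpoonup> 'a) \<Rightarrow> nat \<Rightarrow> ('a \<rightharpoonup> 'a)" where
  "op_pow T 0 = Some"
| "op_pow T (Suc k) = T \<circ>\<^sub>m op_pow T k"

definition poly_op :: "real poly \<Rightarrow> ('a::real_vector \<rightharpoonup> 'a) \<Rightarrow> ('a \<rightharpoonup> 'a)" where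
  "poly_op p T v = (if v \<in> dom (op_pow T (degree p))
     then Some (\<Sum>k\<le>degree p. coeff p k *\<^sub>R the (op_pow T k v)) else None)"

definition Q_op :: "'n::{finite,linorder} clifford \<Rightarrow> (('v::banach, 'n) cmodule \<rightharpoonup> ('v, 'n) cmodule)
    \<Rightarrow> (('v, 'n) cmodule \<rightharpoonup> ('v, 'n) cmodule)" where
  "Q_op s T = poly_op [:(norm s)\<^sup>2, - 2 * (s $ {}), 1:] T"

definition S_resolvent_set :: "(('v::banach, 'n::{finite,linorder}) cmodule \<rightharpoonup> ('v, 'n) cmodule)
    \<Rightarrow> 'n clifford set" where
  "S_resolvent_set T = {s \<in> paravectors. bounded_op (op_inv (Q_op s T))}"

definition S_spectrum :: "(('v::banach, 'n::{finite,linorder}) cmodule \<rightharpoonup> ('v, 'n) cmodule)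
    \<Rightarrow> 'n clifford set" where
  "S_spectrum T = paravectors - S_resolvent_set T"

definition SL_res :: "'n::{finite,linorder} clifford \<Rightarrow> (('v::banach, 'n) cmodule \<rightharpoonup> ('v, 'n) cmodule)
    \<Rightarrow> (('v, 'n) cmodule \<rightharpoonup> ('v, 'n) cmodule)" where
  "SL_res s T = op_minus (op_rmul (op_inv (Q_op s T)) (cconj s)) (T \<circ>\<^sub>m op_inv (Q_op s T))"

text \<open>
  For closed \<open>T\<close> and \<open>s\<close> in the S-resolvent set, \<open>SL_res s T\<close> is bounded by the closed graph
  theorem; \<open>bounded_op\<close> is stated because the norm of \<open>to_blinfun\<close> is meaningful only then.
\<close>

definition bisectorial :: "real \<Rightarrow> (('v::banach, 'n::{finite,linorder}) cmodule \<rightharpoonup> ('v, 'n) cmodule) \<Rightarrow> bool" where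
  "bisectorial \<omega> T \<longleftrightarrow> S_spectrum T \<subseteq> closure (dsector \<omega>) \<and>
     (\<forall>\<phi>\<in>{\<omega><..<pi/2}. \<exists>C\<ge>0. \<forall>s\<in>paravectors - (dsector \<phi> \<union> {0}).
        bounded_op (SL_res s T) \<and> norm (to_blinfun (SL_res s T)) \<le> C / norm s)"


section \<open>Functional calculi\<close>

definition gamma_path :: "real \<Rightarrow> real \<Rightarrow> 'n::{finite,linorder} clifford \<Rightarrow> real \<Rightarrow> 'n clifford" where
  "gamma_path \<epsilon> \<phi> J t = (\<epsilon> * \<bar>t\<bar>) *\<^sub>R cexp J (- sgn t * \<phi>)"

text \<open>
  The integral is the gauge integral with values in the Banach space of bounded operators; the
  integrand is norm continuous on each open half-line and its norm has finite integral.
  The path is determined by \<open>\<phi>\<close> and \<open>J\<close>; the calculus does not depend on them.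
\<close>

definition omega_calc :: "real \<Rightarrow> 'n::{finite,linorder} clifford \<Rightarrow> ('n clifford \<Rightarrow> 'n clifford)
    \<Rightarrow> (('v::banach, 'n) cmodule \<rightharpoonup> ('v, 'n) cmodule) \<Rightarrow> ('v, 'n) cmodule \<Rightarrow>\<^sub>L ('v, 'n) cmodule" where
  "omega_calc \<phi> J f T = (1 / (2 * pi)) *\<^sub>R (\<Sum>\<epsilon>\<in>{1, - 1}. integral UNIV (\<lambda>t.
     to_blinfun (SL_res (gamma_path \<epsilon> \<phi> J t) T)
     o\<^sub>L lmul_op (cmul (vector_derivative (gamma_path \<epsilon> \<phi> J) (at t)) (cinv J))
     o\<^sub>L lmul_op (f (gamma_path \<epsilon> \<phi> J t))))"

text \<open>
  The components of \<open>g \<in> Nbnd \<theta>\<close> are unique (the third one as a function on \<open>dsector \<theta>\<close>), so the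
  choice below is immaterial.
\<close>

definition ext_calc :: "real \<Rightarrow> real \<Rightarrow> 'n::{finite,linorder} clifford \<Rightarrow> ('n clifford \<Rightarrow> 'n clifford)
    \<Rightarrow> (('v::banach, 'n) cmodule \<rightharpoonup> ('v, 'n) cmodule) \<Rightarrow> ('v, 'n) cmodule \<Rightarrow>\<^sub>L ('v, 'n) cmodule" where
  "ext_calc \<theta> \<phi> J g T =
     (let (g0, ginf, gt) = (SOME (g0, ginf, gt). bnd_components \<theta> g g0 ginf gt)
      in ginf *\<^sub>R id_blinfun + (g0 - ginf) *\<^sub>R to_blinfun (op_inv (poly_op [:1, 0, 1:] T))
         + omega_calc \<phi> J gt T)"

end

(*
  For an intrinsic f the contributions of s and of its conjugate to the integral defining f(T) add up
  to a real combination of Q_s[T]^-1 and T Q_s[T]^-1. The imaginary unit J disappears, and what remains is the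
  integral of the "imaginary part" of f(z) (T - z)^-1 dz over the rays in the complex plane.

  The function p/q - ginf - (g0 - ginf)/(1 + s^2) factors as h * (a/q) with h(s) = s/(1 + s^2) and
  deg a <= deg q. The poles of a/q lie outside the sectors. By the resolvent identity, replacing h by
  h/Q or by h s/Q, Q an irreducible quadratic factor of q, changes h(z) (T - z)^-1 into h(z) (T - z)^-1 Q[T]^-1
  or h(z) (T - z)^-1 T Q[T]^-1 plus scalar terms times bounded operators, and these scalar terms integrate to
  zero by Cauchy's theorem inside the sectors. By induction on q the calculus maps h * (a/q) to
  h(T) a[T] q[T]^-1, and only h(T) = T (1 + T^2)^-1 has to be computed. For h the integrand is again split
  by the resolvent identity. Besides an elementary logarithm, it contains the resolvent multiplied by
  T (1 + T^2)^-1. Its integral over a truncated ray is found by rotating the ray to the imaginary axis, where the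
  contributions of the two rays cancel, so that only the arcs at 0 and infinity remain.
*)

theory Submission
  imports Defs
    "HOL-Complex_Analysis.Complex_Analysis"
    "HOL-Real_Asymp.Real_Asymp"
    "HOL-Computational_Algebra.Fundamental_Theorem_Algebra"
begin

section \<open>Improper integrals of Banach space valued functions\<close>

text \<open>The Clifford module is real, so (T - z)^-1 for complex z is only a formal expression, (T
  - conj z) R_z with R_z the inverse of T^2 - 2 Re(z) T + |z|^2. Contour arguments are therefore
  carried out for its imaginary part, a real combination of R_z and T R_z, and the resolvent
  equations are used in real form. Being intrinsic becomes being real on the real axis; there the
  imaginary part of f vanishes, so that Cauchy's theorem can close the contour along the axis and
  holds for each ray separately. Taking out one quadratic factor of q at a time is an algebraic
  identity under a single integral; it stands in for a product rule with its double integrals. The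
  factor h stays throughout, since a/q alone need not decay at 0 or infinity. For h the rotated arcs
  themselves are merely bounded and need not converge; after multiplication by T (1 + T^2)^-1 the
  arc at 0 tends to zero and the arc at infinity to T (1 + T^2)^-1. The logarithm contributes 2
  \<phi> and the rotation pi - 2 \<phi>, with \<phi> the angle of the rays; the sum pi is
  independent of \<phi>.\<close>

lemma exists_primitive_pos:
  fixes f :: "real \<Rightarrow> 'a::banach"
  assumes "continuous_on {0<..} f"
  obtains F where "\<And>x. 0 < x \<Longrightarrow> (F has_vector_derivative f x) (at x)"
proof
  fix x :: real assume "0 < x"
  \<comment> \<open>An integral over an empty interval is 0, so this one formula is the oriented
    integral from 1 to \<open>x\<close> on both sides of 1.\<close>
  define F where "F = (\<lambda>x. integral {1..x} f - integral {x..1} f)"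
  define a b where "a = min 1 x / 2" and "b = max 1 x + 1"
  have ab: "0 < a" "a < 1" "1 < b" "x \<in> {a<..<b}"
    using \<open>0 < x\<close> by (auto simp: a_def b_def)
  have cont: "continuous_on {c..d} f" if "a \<le> c" for c d
    by (rule continuous_on_subset[OF assms]) (use that ab in auto)
  have int: "f integrable_on {c..d}" if "a \<le> c" for c d
    using cont[OF that] by (rule integrable_continuous_real)
  have F: "F y = integral {a..y} f - integral {a..1} f" if "y \<in> {a<..<b}" for y
  proof (cases "y \<le> 1")
    case True
    have "integral {a..1} f = integral {a..y} f + integral {y..1} f"
      by (rule Henstock_Kurzweil_Integration.integral_combine[symmetric]) (use True that int in auto)
    moreover have "integral {1..y} f = 0"
      using True by (cases "y = 1") (auto simp: atLeastatMost_empty)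
    ultimately show ?thesis by (simp add: F_def)
  next
    case False
    have "integral {a..y} f = integral {a..1} f + integral {1..y} f"
      by (rule Henstock_Kurzweil_Integration.integral_combine[symmetric]) (use False ab int in auto)
    then show ?thesis using False by (simp add: F_def)
  qed
  have "((\<lambda>u. integral {a..u} f) has_vector_derivative f x) (at x within {a..b})"
    by (rule integral_has_vector_derivative) (use ab cont in auto)
  then have "((\<lambda>u. integral {a..u} f) has_vector_derivative f x) (at x)"
    using ab by (metis at_within_Icc_at greaterThanLessThan_iff)
  then have D: "((\<lambda>u. integral {a..u} f - integral {a..1} f) has_vector_derivative f x) (at x)"
    by (rule has_vector_derivative_diff[OF _ has_vector_derivative_const, unfolded diff_zero])
  have "(F has_vector_derivative f x) (at x)"
    by (rule has_vector_derivative_transform_within_open[OF D open_greaterThanLessThan ab(4)])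
      (use F in \<open>auto\<close>)
  then show "((\<lambda>x. integral {1..x} f - integral {x..1} f) has_vector_derivative f x) (at x)"
    by (simp add: F_def)
qed

abbreviation trunc :: "nat \<Rightarrow> real set" where
  "trunc n \<equiv> {inverse (real (Suc n))..real (Suc n)}"

text \<open>The majorant has the primitive \<open>K * arctan\<close>, so a primitive of
  \<open>f\<close>, read in the variable arctan t, is Lipschitz on a bounded open interval and
  extends to its closure by completeness. The extension supplies the limits at 0 and at infinity at
  once, which gives both the gauge integral and its approximation over
  \<open>trunc n\<close>.\<close>

lemma improper_integral:
  fixes f :: "real \<Rightarrow> 'a::banach"
  assumes cont: "continuous_on {0<..} f"
    and bound: "\<And>t. 0 < t \<Longrightarrow> norm (f t) \<le> K / (1 + t\<^sup>2)"
  shows "f integrable_on {0..}"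
    and "(\<lambda>n. integral (trunc n) f) \<longlonglongrightarrow> integral {0..} f"
proof -
  obtain F where F: "\<And>x. 0 < x \<Longrightarrow> (F has_vector_derivative f x) (at x)"
    using exists_primitive_pos[OF cont] by blast
  have K0: "0 \<le> K"
    using order_trans[OF norm_ge_zero bound[of 1]] by simp
  have le: "norm (F y - F x) \<le> K * arctan y - K * arctan x" if "0 < x" "x \<le> y" for x y
  proof -
    have I: "(f has_integral (F y - F x)) {x..y}"
      using that by (intro fundamental_theorem_of_calculus)
        (auto intro!: has_vector_derivative_at_within F)
    have J: "((\<lambda>t. K / (1 + t\<^sup>2)) has_integral (K * arctan y - K * arctan x)) {x..y}"
      using that by (intro fundamental_theorem_of_calculus)
        (auto intro!: derivative_eq_intros simp: has_real_derivative_iff_has_vector_derivative[symmetric] field_simps)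
    show ?thesis
      using integral_norm_bound_integral[of f "{x..y}" "\<lambda>t. K / (1 + t\<^sup>2)"] I J bound that
      by (auto simp: has_integral_iff)
  qed
  define H where "H = (\<lambda>a. F (tan a))"
  have Hle: "norm (H b - H a) \<le> K * (b - a)" if "0 < a" "a \<le> b" "b < pi/2" for a b
  proof -
    have "tan a \<le> tan b" "0 < tan a"
      using that tan_mono_le[of a b] tan_gt_zero[of a] by auto
    with le[of "tan a" "tan b"] that show ?thesis
      by (simp add: H_def arctan_tan algebra_simps)
  qed
  have "K-lipschitz_on {0<..<pi/2} H"
  proof (rule lipschitz_onI[OF _ K0])
    fix a b assume "a \<in> {0<..<pi/2}" "b \<in> {0<..<pi/2}"
    then show "dist (H a) (H b) \<le> K * dist a b"
      using Hle[of a b] Hle[of b a]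
      by (cases "a \<le> b") (auto simp: dist_norm norm_minus_commute)
  qed
  from lipschitz_extend_closure[OF this] obtain G
    where "K-lipschitz_on (closure {0<..<pi/2}) G" and GH: "\<And>a. a \<in> {0<..<pi/2} \<Longrightarrow> G a = H a"
    by auto
  then have contG: "continuous_on {0..pi/2} G"
    using lipschitz_on_continuous_on by force
  define P where "P = (\<lambda>x. G (arctan x))"
  have PF: "P x = F x" if "0 < x" for x
    using that GH[of "arctan x"] arctan_ubound[of x] by (simp add: P_def H_def tan_arctan)
  have contP: "continuous_on {0..} P"
    unfolding P_def
  proof (rule continuous_on_compose2[OF contG])
    show "arctan ` {0..} \<subseteq> {0..pi/2}"
      using arctan_ubound less_imp_le by fastforce
  qed (intro continuous_intros)
  have Pd: "(P has_vector_derivative f x) (at x)" if "0 < x" for x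
    using F[OF that] by (rule has_vector_derivative_transform_within_open[of _ _ _ "{0<..}"]) (use that PF in auto)
  have int: "(f has_integral (P b - P a)) {a..b}" if "0 \<le> a" "a \<le> b" for a b
    by (rule fundamental_theorem_of_calculus_interior_strong[of "{}"])
      (use that in \<open>auto intro!: Pd continuous_on_subset[OF contP]\<close>)
  have lim: "(P \<longlongrightarrow> G (pi/2)) at_top"
  proof -
    have "(G \<longlongrightarrow> G (pi/2)) (at (pi/2) within {0..pi/2})"
      using contG by (simp add: continuous_on_def)
    moreover have "filterlim arctan (at (pi/2) within {0..pi/2}) at_top"
      unfolding filterlim_at
    proof (intro conjI)
      show "\<forall>\<^sub>F x in at_top. arctan x \<in> {0..pi/2} \<and> arctan x \<noteq> pi/2"
        using eventually_ge_at_top[of 0]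
      proof eventually_elim
        case (elim x)
        then show ?case using arctan_ubound[of x] by simp
      qed
    qed (rule tendsto_arctan_at_top)
    ultimately show ?thesis
      unfolding P_def by (rule filterlim_compose)
  qed
  have I: "(f has_integral (G (pi/2) - P 0)) {0..}"
  proof (subst has_integral', intro allI impI)
    fix e :: real assume "0 < e"
    then have "\<forall>\<^sub>F x in at_top. dist (P x) (G (pi/2)) < e"
      using lim by (rule tendstoD[rotated])
    then obtain B where B: "\<And>x. B \<le> x \<Longrightarrow> dist (P x) (G (pi/2)) < e"
      by (auto simp: eventually_at_top_linorder)
    define B' where "B' = max B 1"
    show "\<exists>B>0. \<forall>a b. ball 0 B \<subseteq> cbox a b \<longrightarrow>
      (\<exists>z. ((\<lambda>x. if x \<in> {0..} then f x else 0) has_integral z) (cbox a b) \<and> norm (z - (G (pi/2) - P 0)) < e)"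
    proof (intro exI[of _ B'] conjI allI impI)
      fix a b :: real assume "ball 0 B' \<subseteq> cbox a b"
      then have "{-B'<..<B'} \<subseteq> {a..b}"
        by (auto simp: ball_eq_greaterThanLessThan)
      then have ab: "a \<le> 0" "B' \<le> b"
        using greaterThanLessThan_subseteq_atLeastAtMost_iff[of "-B'" B' a b] by (auto simp: B'_def)
      have "(f has_integral (P b - P 0)) {0..b}"
        by (rule int) (use ab in \<open>auto simp: B'_def\<close>)
      then have "((\<lambda>x. if x \<in> {0..b} then f x else 0) has_integral (P b - P 0)) (cbox a b)"
        using has_integral_restrict_closed_subinterval[of f "P b - P 0" 0 b a b] ab by (simp add: cbox_interval)
      then have "((\<lambda>x. if x \<in> {0..} then f x else 0) has_integral (P b - P 0)) (cbox a b)"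
        by (rule has_integral_eq[rotated]) (simp add: cbox_interval)
      moreover have "norm (P b - P 0 - (G (pi/2) - P 0)) < e"
        using B[of b] ab by (simp add: dist_norm B'_def)
      ultimately show "\<exists>z. ((\<lambda>x. if x \<in> {0..} then f x else 0) has_integral z) (cbox a b) \<and> norm (z - (G (pi/2) - P 0)) < e"
        by blast
    qed (simp add: B'_def)
  qed
  then show "f integrable_on {0..}" by blast
  have "integral (trunc n) f = P (real (Suc n)) - P (inverse (real (Suc n)))" for n
  proof (intro integral_unique int)
    show "inverse (real (Suc n)) \<le> real (Suc n)"
      by (rule order_trans[of _ 1]) (simp_all add: field_simps)
  qed simp
  moreover have "(\<lambda>n. P (real (Suc n))) \<longlonglongrightarrow> G (pi/2)"
    using filterlim_compose[OF lim filterlim_compose[OF filterlim_real_sequentially filterlim_Suc]] .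
  moreover have "(\<lambda>n. P (inverse (real (Suc n)))) \<longlonglongrightarrow> P 0"
    by (rule continuous_on_tendsto_compose[OF contP LIMSEQ_inverse_real_of_nat]) auto
  ultimately show "(\<lambda>n. integral (trunc n) f) \<longlonglongrightarrow> integral {0..} f"
    using integral_unique[OF I] by (simp add: tendsto_diff)
qed

section \<open>A Cauchy theorem on double sectors\<close>

text \<open>The trace of the double sector of half-angle \<theta> in one complex plane. The tangent
  form covers both halves at once and turns membership into a strict inequality of continuous
  functions.\<close>

definition csec :: "real \<Rightarrow> complex set" where
  "csec \<theta> = {z. \<bar>Im z\<bar> < tan \<theta> * \<bar>Re z\<bar>}"

lemma open_csec: "open (csec \<theta>)"
  unfolding csec_def by (intro open_Collect_less continuous_intros)

lemma zero_notin_csec: "z \<in> csec \<theta> \<Longrightarrow> z \<noteq> 0"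
  by (auto simp: csec_def)

lemma csec_uminus: "- z \<in> csec \<theta> \<longleftrightarrow> z \<in> csec \<theta>"
  by (simp add: csec_def)

lemma csec_cnj: "cnj z \<in> csec \<theta> \<longleftrightarrow> z \<in> csec \<theta>"
  by (simp add: csec_def)

lemma sin_less_tan_cos:
  assumes "0 \<le> \<phi>" "\<phi> < \<theta>" "\<theta> < pi / 2"
  shows "sin \<phi> < tan \<theta> * cos \<phi>"
proof -
  have c: "0 < cos \<phi>" using assms by (intro cos_gt_zero_pi) auto
  have "tan \<phi> < tan \<theta>"
    using tan_monotone[of \<phi> \<theta>] assms by simp
  then show ?thesis using c by (simp add: tan_def pos_divide_less_eq)
qed

lemma ray_in_csec:
  assumes "0 \<le> \<phi>" "\<phi> < \<theta>" "\<theta> < pi / 2" "0 < t" "u = cis \<phi> \<or> u = - cis \<phi>"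
  shows "complex_of_real t * u \<in> csec \<theta>"
proof -
  have "0 < cos \<phi>" using assms by (intro cos_gt_zero_pi) auto
  moreover have "0 \<le> sin \<phi>" using assms by (intro sin_ge_zero) auto
  ultimately have "t * \<bar>sin \<phi>\<bar> < tan \<theta> * (t * \<bar>cos \<phi>\<bar>)"
    using sin_less_tan_cos[OF assms(1-3)] \<open>0 < t\<close> by (simp add: mult.left_commute)
  then show ?thesis using assms(4,5) by (auto simp: csec_def abs_mult)
qed

text \<open>On the convex half sector \<open>g\<close> has a primitive \<open>G\<close>, whose
  imaginary part is constant on the positive axis. With u = cis \<phi>, the integral over a
  truncated ray is therefore a difference of two values Im (G (b u) - G b), one for each end. The
  chord from b to b u has length at most 2 b and keeps the distance b cos \<phi> from 0, so such a
  value is of order b near 0 and of order 1/b near infinity.\<close>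

lemma right_ray_integral_zero:
  assumes "0 < \<phi>" "\<phi> < \<theta>" "\<theta> < pi / 2"
    and hol: "g holomorphic_on csec \<theta>"
    and real: "\<And>x. 0 < x \<Longrightarrow> Im (g (complex_of_real x)) = 0"
    and bound: "\<And>z. z \<in> csec \<theta> \<Longrightarrow> norm (g z) \<le> K / (1 + (norm z)\<^sup>2)"
  shows "((\<lambda>t. Im (g (complex_of_real t * cis \<phi>) * cis \<phi>)) has_integral 0) {0..}"
proof -
  define u where "u = cis \<phi>"
  define H where "H = {z. 0 < Re z \<and> Im z < tan \<theta> * Re z \<and> - Im z < tan \<theta> * Re z}"
  have H: "H = {z. 0 < Re z} \<inter> {z. Im z < tan \<theta> * Re z} \<inter> {z. - Im z < tan \<theta> * Re z}"
    by (auto simp: H_def)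
  have "open H"
    unfolding H by (intro open_Int open_Collect_less continuous_intros)
  have "convex H"
  proof -
    have "convex {z. Im z < tan \<theta> * Re z}" "convex {z. - Im z < tan \<theta> * Re z}"
      using convex_halfspace_lt[of "Complex (- tan \<theta>) 1" 0] convex_halfspace_lt[of "Complex (- tan \<theta>) (- 1)" 0]
      by (simp_all add: inner_complex_def minus_less_iff)
    then show ?thesis
      unfolding H by (intro convex_Int convex_halfspace_Re_gt)
  qed
  have HS: "H \<subseteq> csec \<theta>" by (auto simp: H_def csec_def abs_less_iff)
  have g: "g holomorphic_on H" using hol HS by (rule holomorphic_on_subset)
  obtain G where G0: "\<And>z. z \<in> H \<Longrightarrow> (G has_field_derivative g z) (at z within H)"
    using holomorphic_convex_primitive'[OF \<open>convex H\<close> \<open>open H\<close> g] by (metis (no_types))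
  have G: "(G has_field_derivative g z) (at z)" if "z \<in> H" for z
    using G0[OF that] by (simp add: at_within_open[OF that \<open>open H\<close>])
  have c: "0 < cos \<phi>" using assms(1-3) by (intro cos_gt_zero_pi) auto
  have tan: "0 < tan \<theta>" using assms(1-3) by (intro tan_gt_zero) auto
  have s: "0 \<le> sin \<phi>" using assms(1-3) by (intro sin_ge_zero) auto
  have ray: "complex_of_real t * u \<in> H" "complex_of_real t \<in> H" if "0 < t" for t
  proof -
    have "t * sin \<phi> < tan \<theta> * (t * cos \<phi>)"
      using mult_strict_left_mono[OF sin_less_tan_cos[of \<phi> \<theta>] that] assms(1-3) by (simp add: mult.left_commute)
    moreover have "- (t * sin \<phi>) < tan \<theta> * (t * cos \<phi>)"
    proof -
      have "0 \<le> t * sin \<phi>" "0 < tan \<theta> * (t * cos \<phi>)" using s c tan that by simp_all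
      then show ?thesis by linarith
    qed
    ultimately show "complex_of_real t * u \<in> H" using that c by (simp add: H_def u_def)
    show "complex_of_real t \<in> H" using that tan by (simp add: H_def)
  qed
  have int: "((\<lambda>t. g (complex_of_real t * w) * w) has_integral (G (b * w) - G (a * w))) {a..b}"
    if "0 < a" "a \<le> b" "w = 1 \<or> w = u" for a b :: real and w :: complex
  proof (rule fundamental_theorem_of_calculus[OF \<open>a \<le> b\<close>, where f = "\<lambda>t. G (complex_of_real t * w)"])
    fix t assume "t \<in> {a..b}"
    then have "complex_of_real t * w \<in> H" using that ray[of t] by auto
    then have "((G \<circ> (\<lambda>t. complex_of_real t * w)) has_vector_derivative w * g (complex_of_real t * w)) (at t)"
      by (intro field_vector_diff_chain_at G) (auto intro!: derivative_eq_intros)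
    then show "((\<lambda>t. G (complex_of_real t * w)) has_vector_derivative g (complex_of_real t * w) * w) (at t within {a..b})"
      by (auto intro: has_vector_derivative_at_within simp: o_def mult.commute)
  qed
  have close: "\<bar>Im (G (b * u) - G b)\<bar> \<le> 2 * b * K / (1 + b\<^sup>2 * (cos \<phi>)\<^sup>2)" if "0 < b" for b :: real
  proof -
    let ?B = "K / (1 + b\<^sup>2 * (cos \<phi>)\<^sup>2)"
    have K0: "0 \<le> K"
      using order_trans[OF norm_ge_zero bound[of 1]] tan by (simp add: csec_def)
    have sub: "closed_segment (complex_of_real b) (b * u) \<subseteq> H"
      using ray[OF that] \<open>convex H\<close> by (simp add: closed_segment_subset)
    have "norm (G (b * u) - G b) \<le> ?B * norm (b * u - complex_of_real b)"
    proof (rule field_differentiable_bound[OF convex_closed_segment, where f = G and f' = g])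
      fix z assume z: "z \<in> closed_segment (complex_of_real b) (b * u)"
      then show "(G has_field_derivative g z) (at z within closed_segment (complex_of_real b) (b * u))"
        using sub G by (blast intro: has_field_derivative_at_within)
      from z obtain v where v: "0 \<le> v" "v \<le> 1" "z = (1 - v) *\<^sub>R complex_of_real b + v *\<^sub>R (b * u)"
        by (auto simp: closed_segment_def)
      then have "Re z = b * (1 - v * (1 - cos \<phi>))"
        unfolding v(3) by (simp add: u_def algebra_simps)
      moreover have "v * (1 - cos \<phi>) \<le> 1 - cos \<phi>"
        using v by (intro mult_left_le_one_le) auto
      ultimately have "b * cos \<phi> \<le> Re z"
        using that by (simp)
      then have "b * cos \<phi> \<le> norm z" using complex_Re_le_cmod[of z] by linarith
      then have "(b * cos \<phi>)\<^sup>2 \<le> (norm z)\<^sup>2"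
        using that c by (intro power_mono) auto
      then have "K / (1 + (norm z)\<^sup>2) \<le> ?B"
        using K0 by (intro divide_left_mono) (auto simp: power_mult_distrib intro!: mult_pos_pos add_pos_nonneg)
      then show "norm (g z) \<le> ?B"
        using bound[of z] z sub HS by force
    qed auto
    also have "\<dots> \<le> ?B * (2 * b)"
    proof (rule mult_left_mono)
      have "norm (b * u - complex_of_real b) \<le> norm (b * u) + norm (complex_of_real b)"
        by (rule norm_triangle_ineq4)
      then show "norm (b * u - complex_of_real b) \<le> 2 * b"
        using that by (simp add: norm_mult u_def)
    qed (use K0 in simp)
    finally show ?thesis
      using abs_Im_le_cmod[of "G (b * u) - G b"] by (simp add: mult_ac)
  qed
  define f where "f = (\<lambda>t. Im (g (complex_of_real t * u) * u))"
  define e where "e = (\<lambda>b. 2 * b * K / (1 + b\<^sup>2 * (cos \<phi>)\<^sup>2))"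
  have cont: "continuous_on {0<..} f"
    unfolding f_def
    by (intro continuous_intros continuous_on_compose2[OF holomorphic_on_imp_continuous_on[OF g]])
       (use ray in auto)
  have fb: "norm (f t) \<le> K / (1 + t\<^sup>2)" if "0 < t" for t
  proof -
    have "norm (f t) \<le> norm (g (complex_of_real t * u))"
      unfolding f_def using abs_Im_le_cmod[of "g (complex_of_real t * u) * u"] by (simp add: norm_mult u_def)
    also have "\<dots> \<le> K / (1 + t\<^sup>2)"
      using bound[of "complex_of_real t * u"] ray[OF that] HS that by (auto simp: norm_mult u_def)
    finally show ?thesis .
  qed
  have bd: "\<bar>integral (trunc n) f\<bar> \<le> e (real (Suc n)) + e (inverse (real (Suc n)))" for n
  proof -
    let ?a = "inverse (real (Suc n))" and ?b = "real (Suc n)"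
    have le: "0 < ?a" "?a \<le> ?b" "0 < ?b"
      using order_trans[of ?a 1 ?b] by (auto simp: field_simps)
    have "integral {?a..?b} f = Im (G (?b * u) - G (?a * u))"
      unfolding f_def using int[OF le(1,2), of u] by (intro integral_unique has_integral_Im) auto
    moreover have "Im (G ?b - G ?a) = 0"
    proof -
      have "((\<lambda>t. Im (g (complex_of_real t * 1) * 1)) has_integral Im (G (?b * 1) - G (?a * 1))) {?a..?b}"
        using int[OF le(1,2), of 1] by (intro has_integral_Im) auto
      moreover have "((\<lambda>t. Im (g (complex_of_real t * 1) * 1)) has_integral 0) {?a..?b}"
        using real less_le_trans[OF le(1)] by (intro has_integral_is_0) simp
      ultimately have "Im (G (?b * 1) - G (?a * 1)) = 0" by (rule has_integral_unique)
      then show ?thesis by (simp only: mult_1_right)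
    qed
    ultimately show ?thesis
      using close[OF le(1)] close[OF le(3)] by (simp add: e_def)
  qed
  have "(\<lambda>n. integral (trunc n) f) \<longlonglongrightarrow> 0"
  proof (rule Lim_null_comparison)
    show "\<forall>\<^sub>F n in sequentially. norm (integral (trunc n) f)
        \<le> e (real (Suc n)) + e (inverse (real (Suc n)))"
      using bd by (intro always_eventually allI) (simp only: real_norm_def)
    have "0 < (cos \<phi>)\<^sup>2" using c by simp
    then have "(e \<longlongrightarrow> 0) at_top"
      unfolding e_def by real_asymp
    then have "(\<lambda>n. e (real (Suc n))) \<longlonglongrightarrow> 0"
      by (rule filterlim_compose) (rule filterlim_compose[OF filterlim_real_sequentially filterlim_Suc])
    moreover have "isCont e 0"
      unfolding e_def by (intro continuous_intros) auto
    then have "(\<lambda>n. e (inverse (real (Suc n)))) \<longlonglongrightarrow> e 0"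
      using LIMSEQ_inverse_real_of_nat by (rule isCont_tendsto_compose)
    ultimately show "(\<lambda>n. e (real (Suc n)) + e (inverse (real (Suc n)))) \<longlonglongrightarrow> 0"
      using tendsto_add by (fastforce simp: e_def)
  qed
  with improper_integral[OF cont fb] have "(f has_integral 0) {0..}"
    by (metis LIMSEQ_unique integrable_integral)
  then show ?thesis by (simp add: f_def u_def)
qed

text \<open>The left ray is reduced to the right one by replacing g(z) with g(-z), which preserves
  all hypotheses.\<close>

lemma ray_integral_zero:
  assumes "0 < \<phi>" "\<phi> < \<theta>" "\<theta> < pi / 2"
    and hol: "g holomorphic_on csec \<theta>"
    and real: "\<And>x. x \<noteq> 0 \<Longrightarrow> Im (g (complex_of_real x)) = 0"
    and bound: "\<And>z. z \<in> csec \<theta> \<Longrightarrow> norm (g z) \<le> K / (1 + (norm z)\<^sup>2)"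
    and u: "u = cis \<phi> \<or> u = - cis \<phi>"
  shows "((\<lambda>t. Im (g (complex_of_real t * u) * u)) has_integral 0) {0..}"
  using u
proof
  assume "u = cis \<phi>"
  then show ?thesis
    using right_ray_integral_zero[OF assms(1-4) real bound] by simp
next
  assume "u = - cis \<phi>"
  have "((\<lambda>t. Im (g (- (complex_of_real t * cis \<phi>)) * cis \<phi>)) has_integral 0) {0..}"
  proof (rule right_ray_integral_zero[OF assms(1-3), of "\<lambda>z. g (- z)" K])
    show "(\<lambda>z. g (- z)) holomorphic_on csec \<theta>"
      by (rule holomorphic_on_compose_gen[OF _ hol, unfolded o_def]) (auto intro: holomorphic_intros simp: csec_uminus)
    show "Im (g (- complex_of_real x)) = 0" if "0 < x" for x
      using real[of "- x"] that by simp
    show "norm (g (- z)) \<le> K / (1 + (norm z)\<^sup>2)" if "z \<in> csec \<theta>" for z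
      using bound[of "- z"] that by (simp add: csec_uminus)
  qed
  from has_integral_neg[OF this] show ?thesis by (simp add: \<open>u = - cis \<phi>\<close>)
qed

section \<open>Abstract resolvents\<close>

text \<open>Models \<open>R z = (T\<^sup>2 - 2 Re z T + \<bar>z\<bar>\<^sup>2)\<^sup>-\<^sup>1\<close> and \<open>S z = T R z\<close>; \<open>Z\<close> lies in the resolvent set.\<close>

locale resolvent_pair =
  fixes R S :: "complex \<Rightarrow> 'a::banach \<Rightarrow>\<^sub>L 'a" and Z :: "complex set"
  assumes RR: "z \<in> Z \<Longrightarrow> w \<in> Z \<Longrightarrow> R z (R w v) = R w (R z v)"
    and SR: "z \<in> Z \<Longrightarrow> w \<in> Z \<Longrightarrow> S z (R w v) = R z (S w v)"
    and SS: "z \<in> Z \<Longrightarrow> w \<in> Z \<Longrightarrow>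
      S z (S w v) = R w v + (2 * Re z) *\<^sub>R R z (S w v) - (norm z)\<^sup>2 *\<^sub>R R z (R w v)"
    and R_diff: "z \<in> Z \<Longrightarrow> w \<in> Z \<Longrightarrow>
      R z v - R w v = (2 * (Re z - Re w)) *\<^sub>R R z (S w v) + ((norm w)\<^sup>2 - (norm z)\<^sup>2) *\<^sub>R R z (R w v)"
    and S_diff: "z \<in> Z \<Longrightarrow> w \<in> Z \<Longrightarrow>
      S z v - S w v = (2 * (Re z - Re w)) *\<^sub>R S z (S w v) + ((norm w)\<^sup>2 - (norm z)\<^sup>2) *\<^sub>R R z (S w v)"
    and R_cnj: "R (cnj z) = R z" and S_cnj: "S (cnj z) = S z"
begin

text \<open>The imaginary part of g (T - z)^-1, where (T - z)^-1 stands for (T - cnj z) R z, taken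
  formally over the complex numbers.\<close>

definition Lam :: "complex \<Rightarrow> complex \<Rightarrow> 'a \<Rightarrow>\<^sub>L 'a" where
  "Lam z g = Im g *\<^sub>R S z - Im (g * cnj z) *\<^sub>R R z"

text \<open>Let Q_w(T) be the inverse of \<open>R w\<close>. Then Q_w(T) - Q_w(z) = (T - z) (T + z -
  2 Re w) and z Q_w(T) - T Q_w(z) = (T - z) (z T - |w|^2). Multiplying by g (T - z)^-1 and
  \<open>R w\<close> and passing to imaginary parts yields the two formulas. The leftover scalars
  are imaginary parts of g times a polynomial in z, the form to which Cauchy's theorem
  applies.\<close>

lemma Lam_factor:
  fixes g z w :: complex
  assumes z: "z \<in> Z" and w: "w \<in> Z"
  defines "Q \<equiv> z\<^sup>2 - 2 * Re w * z + (norm w)\<^sup>2"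
  shows "Lam z g = (Lam z (g * Q) o\<^sub>L R w) + Im g *\<^sub>R S w + Im (g * (z - 2 * Re w)) *\<^sub>R R w"
    and "Lam z (g * z) = (Lam z (g * Q) o\<^sub>L S w) + Im (g * z) *\<^sub>R S w - ((norm w)\<^sup>2 * Im g) *\<^sub>R R w"
proof -
  define x y a b where "x = Re z" and "y = Im z" and "a = Re g" and "b = Im g"
  note re = x_def[symmetric] y_def[symmetric] a_def[symmetric] b_def[symmetric]
  define p r where "p = Re w" and "r = (norm w)\<^sup>2"
  note pr = p_def[symmetric] r_def[symmetric]
  have n: "(norm z)\<^sup>2 = x\<^sup>2 + y\<^sup>2" by (simp add: x_def y_def cmod_power2)
  have Q: "Re Q = x\<^sup>2 - y\<^sup>2 - 2 * p * x + r" "Im Q = 2 * x * y - 2 * p * y"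
    by (simp_all add: Q_def re p_def r_def power2_eq_square)
  have dbl: "t * 2 = t + t" "t * 4 = t + t + t + t" for t :: real by simp_all
  have id: "Lam z g v = b *\<^sub>R S z v - (b * x - a * y) *\<^sub>R R z v"
    "Lam z (g * z) v = (a * y + b * x) *\<^sub>R S z v - (b * (x\<^sup>2 + y\<^sup>2)) *\<^sub>R R z v"
    "Lam z (g * Q) v = (a * Im Q + b * Re Q) *\<^sub>R S z v
       - ((a * Im Q + b * Re Q) * x - (a * Re Q - b * Im Q) * y) *\<^sub>R R z v" for v
    by (simp_all add: Lam_def blinfun.bilinear_simps re algebra_simps power2_eq_square)
  {
    fix v
    \<comment> \<open>Every term is expanded in these four vectors; the claims then reduce to
      polynomial identities between the coefficients.\<close>
    define A B C D where "A = R z (S w v)" and "B = R z (R w v)" and "C = R w v" and "D = S w v"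
    note ab = A_def[symmetric] B_def[symmetric] and cd = C_def[symmetric] D_def[symmetric]
    have SS': "S z D = C + (2 * x) *\<^sub>R A - (x\<^sup>2 + y\<^sup>2) *\<^sub>R B"
      using SS[OF z w, of v] unfolding n re pr ab unfolding cd .
    have SR': "S z C = A" using SR[OF z w, of v] unfolding ab unfolding cd .
    have RB: "R z v = C + (2 * (x - p)) *\<^sub>R A + (r - (x\<^sup>2 + y\<^sup>2)) *\<^sub>R B"
      using R_diff[OF z w, of v] unfolding n re pr ab unfolding cd by (simp add: algebra_simps)
    have SB: "S z v = D + (2 * (x - p)) *\<^sub>R (C + (2 * x) *\<^sub>R A - (x\<^sup>2 + y\<^sup>2) *\<^sub>R B) + (r - (x\<^sup>2 + y\<^sup>2)) *\<^sub>R A"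
      using S_diff[OF z w, of v] unfolding n re pr ab unfolding cd SS' by (simp add: algebra_simps)
    have RR': "R z C = B" "R z D = A" by (simp_all add: A_def B_def C_def D_def)
    have comb: "\<beta> *\<^sub>R (D + k *\<^sub>R (C + l *\<^sub>R A - m *\<^sub>R B) + q *\<^sub>R A) - n *\<^sub>R (C + k *\<^sub>R A + q *\<^sub>R B)
      = (\<beta> * (k * l + q) - n * k) *\<^sub>R A - (\<beta> * k * m + n * q) *\<^sub>R B + (\<beta> * k - n) *\<^sub>R C + \<beta> *\<^sub>R D"
      for \<beta> k l m n q :: real
      by (simp add: algebra_simps)
    have comb': "\<alpha> *\<^sub>R (C + l *\<^sub>R A - m *\<^sub>R B) - \<beta> *\<^sub>R A + \<delta> *\<^sub>R D - sg *\<^sub>R C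
      = (\<alpha> * l - \<beta>) *\<^sub>R A - (\<alpha> * m) *\<^sub>R B + (\<alpha> - sg) *\<^sub>R C + \<delta> *\<^sub>R D"
      for \<alpha> \<beta> l m \<delta> sg :: real
      by (simp add: algebra_simps)
    have cong4: "\<alpha> *\<^sub>R A - \<beta> *\<^sub>R B + \<gamma> *\<^sub>R C + \<delta> *\<^sub>R D = \<alpha>' *\<^sub>R A - \<beta>' *\<^sub>R B + \<gamma>' *\<^sub>R C + \<delta>' *\<^sub>R D"
      if "\<alpha> = \<alpha>'" "\<beta> = \<beta>'" "\<gamma> = \<gamma>'" "\<delta> = \<delta>'" for \<alpha> \<beta> \<gamma> \<delta> \<alpha>' \<beta>' \<gamma>' \<delta>' :: real
      using that by simp
    have swap: "(E + \<delta> *\<^sub>R D) + \<gamma> *\<^sub>R C = (E + \<gamma> *\<^sub>R C) + \<delta> *\<^sub>R D" for E and \<gamma> \<delta> :: real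
      by simp
    have Im: "Im (g * (z - 2 * Re w)) = b * (x - 2 * p) + a * y" "Im (g * z) = a * y + b * x" "Im g = b"
      by (simp_all add: re pr algebra_simps)
    have "Lam z g v = Lam z (g * Q) C + Im g *\<^sub>R D + Im (g * (z - 2 * Re w)) *\<^sub>R C"
      unfolding Im unfolding id RB SB SR' RR' comb Q swap pr
      by (rule cong4) (simp_all add: algebra_simps power2_eq_square)
    moreover have "Lam z (g * z) v = Lam z (g * Q) D + Im (g * z) *\<^sub>R D - ((norm w)\<^sup>2 * Im g) *\<^sub>R C"
      unfolding Im unfolding id RB SB SS' RR' comb comb' Q pr
      by (rule cong4) (simp_all add: algebra_simps power2_eq_square)
    ultimately have "Lam z g v = Lam z (g * Q) (R w v) + Im g *\<^sub>R S w v + Im (g * (z - 2 * Re w)) *\<^sub>R R w v"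
      "Lam z (g * z) v = Lam z (g * Q) (S w v) + Im (g * z) *\<^sub>R S w v - ((norm w)\<^sup>2 * Im g) *\<^sub>R R w v"
      unfolding C_def D_def by auto
  }
  then show "Lam z g = (Lam z (g * Q) o\<^sub>L R w) + Im g *\<^sub>R S w + Im (g * (z - 2 * Re w)) *\<^sub>R R w"
    "Lam z (g * z) = (Lam z (g * Q) o\<^sub>L S w) + Im (g * z) *\<^sub>R S w - ((norm w)\<^sup>2 * Im g) *\<^sub>R R w"
    by (auto intro!: blinfun_eqI simp: blinfun.bilinear_simps)
qed

end

section \<open>Differentiation of the resolvents along curves\<close>

text \<open>A product rule for the case that one factor vanishes at the point: the other factor then
  need only be continuous. Applied to the resolvent identity, whose scalars vanish on the diagonal,
  it yields derivatives of \<open>R\<close> and \<open>S\<close> from their continuity.\<close>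

lemma has_vector_derivative_vanishing_scaleR:
  fixes Y :: "real \<Rightarrow> 'a::real_normed_vector"
  assumes \<alpha>: "(\<alpha> has_real_derivative \<alpha>') (at t within U)" and "\<alpha> t = 0"
    and Y: "continuous (at t within U) Y"
  shows "((\<lambda>s. \<alpha> s *\<^sub>R Y s) has_vector_derivative \<alpha>' *\<^sub>R Y t) (at t within U)"
proof -
  have "((\<lambda>s. \<alpha> s *\<^sub>R (Y s - Y t)) has_derivative (\<lambda>_. 0)) (at t within U)"
    unfolding has_derivative_within
  proof (intro conjI bounded_linear_zero)
    have "((\<lambda>s. (\<alpha> s - \<alpha> t) / (s - t)) \<longlongrightarrow> \<alpha>') (at t within U)"
      using \<alpha> by (simp add: has_field_derivative_iff)
    moreover have "((\<lambda>s. Y s - Y t) \<longlongrightarrow> 0) (at t within U)"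
      using Y by (simp add: continuous_within LIM_zero)
    ultimately have "((\<lambda>s. norm (((\<alpha> s - \<alpha> t) / (s - t)) *\<^sub>R (Y s - Y t))) \<longlongrightarrow> 0) (at t within U)"
      using tendsto_norm_zero[OF tendsto_scaleR[of _ \<alpha>' _ _ 0, simplified]] by blast
    then have "((\<lambda>s. norm ((1 / norm (s - t)) *\<^sub>R (\<alpha> s *\<^sub>R (Y s - Y t) - (\<alpha> t *\<^sub>R (Y t - Y t) + 0)))) \<longlongrightarrow> 0) (at t within U)"
      by (simp add: \<open>\<alpha> t = 0\<close> abs_mult)
    then show "((\<lambda>s. (1 / norm (s - t)) *\<^sub>R (\<alpha> s *\<^sub>R (Y s - Y t) - (\<alpha> t *\<^sub>R (Y t - Y t) + 0))) \<longlongrightarrow> 0) (at t within U)"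
      by (rule tendsto_norm_zero_cancel)
  qed
  then have "((\<lambda>s. \<alpha> s *\<^sub>R (Y s - Y t)) has_vector_derivative 0) (at t within U)"
    by (simp add: has_vector_derivative_def)
  moreover have "((\<lambda>s. \<alpha> s *\<^sub>R Y t) has_vector_derivative \<alpha>' *\<^sub>R Y t) (at t within U)"
    using has_vector_derivative_scaleR[OF \<alpha> has_vector_derivative_const[of "Y t"]] by simp
  ultimately have "((\<lambda>s. \<alpha> s *\<^sub>R (Y s - Y t) + \<alpha> s *\<^sub>R Y t) has_vector_derivative 0 + \<alpha>' *\<^sub>R Y t) (at t within U)"
    by (rule has_vector_derivative_add)
  then show ?thesis by (simp add: algebra_simps)
qed

locale sector_resolvent = resolvent_pair +
  fixes \<phi> K :: real
  assumes phi: "0 < \<phi>" "\<phi> < pi / 2"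
    and sector: "z \<noteq> 0 \<Longrightarrow> tan \<phi> * \<bar>Re z\<bar> \<le> \<bar>Im z\<bar> \<Longrightarrow> z \<in> Z"
    and R_bound: "z \<noteq> 0 \<Longrightarrow> tan \<phi> * \<bar>Re z\<bar> \<le> \<bar>Im z\<bar> \<Longrightarrow> norm (R z) \<le> K / (norm z)\<^sup>2"
    and S_bound: "z \<noteq> 0 \<Longrightarrow> tan \<phi> * \<bar>Re z\<bar> \<le> \<bar>Im z\<bar> \<Longrightarrow> norm (S z) \<le> K / norm z"
begin

text \<open>The region is closed apart from the missing origin: it contains the rays of angle
  exactly \<phi>, on which the integrals are taken, and all rays met while turning them to the
  imaginary axis.\<close>

definition outer :: "complex set" where
  "outer = {z. z \<noteq> 0 \<and> tan \<phi> * \<bar>Re z\<bar> \<le> \<bar>Im z\<bar>}"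

lemma outer_Z: "z \<in> outer \<Longrightarrow> z \<in> Z"
  and R_le: "z \<in> outer \<Longrightarrow> norm (R z) \<le> K / (norm z)\<^sup>2"
  and S_le: "z \<in> outer \<Longrightarrow> norm (S z) \<le> K / norm z"
  by (simp_all add: outer_def sector R_bound S_bound)

lemma ii_outer: "\<i> \<in> outer"
  by (simp add: outer_def)

lemma K_nonneg: "0 \<le> K"
  using order_trans[OF norm_ge_zero S_le[OF ii_outer]] by simp

lemma ray_outer:
  assumes "\<phi> \<le> \<psi>" "\<psi> \<le> pi / 2" "0 < t" "sg = 1 \<or> sg = - 1"
  shows "complex_of_real (sg * t) * cis \<psi> \<in> outer"
proof -
  have s: "0 < sin \<psi>" using assms phi by (intro sin_gt_zero) auto
  have c: "0 \<le> cos \<psi>" using assms phi by (intro cos_ge_zero) auto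
  have "tan \<phi> * cos \<psi> \<le> sin \<psi>"
  proof -
    have "0 < cos \<phi>" using phi by (intro cos_gt_zero_pi) auto
    moreover have "0 \<le> sin (\<psi> - \<phi>)" using assms phi by (intro sin_ge_zero) auto
    ultimately show ?thesis by (simp add: tan_def sin_diff pos_divide_le_eq mult.commute)
  qed
  then have "t * (tan \<phi> * cos \<psi>) \<le> t * sin \<psi>"
    using \<open>0 < t\<close> by simp
  then show ?thesis using assms(3,4) s c
    by (auto simp: outer_def abs_mult mult.left_commute)
qed

lemma R_diff_op: "z \<in> Z \<Longrightarrow> w \<in> Z \<Longrightarrow>
    R z - R w = (2 * (Re z - Re w)) *\<^sub>R (R z o\<^sub>L S w) + ((norm w)\<^sup>2 - (norm z)\<^sup>2) *\<^sub>R (R z o\<^sub>L R w)"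
  by (rule blinfun_eqI) (simp add: blinfun.bilinear_simps R_diff)

lemma S_diff_op: "z \<in> Z \<Longrightarrow> w \<in> Z \<Longrightarrow>
    S z - S w = (2 * (Re z - Re w)) *\<^sub>R (S z o\<^sub>L S w) + ((norm w)\<^sup>2 - (norm z)\<^sup>2) *\<^sub>R (R z o\<^sub>L S w)"
  by (rule blinfun_eqI) (simp add: blinfun.bilinear_simps S_diff)

lemma SS_op: "z \<in> Z \<Longrightarrow> w \<in> Z \<Longrightarrow>
    (S z o\<^sub>L S w) = R w + (2 * Re z) *\<^sub>R (R z o\<^sub>L S w) - (norm z)\<^sup>2 *\<^sub>R (R z o\<^sub>L R w)"
  by (rule blinfun_eqI) (simp add: blinfun.bilinear_simps SS)

lemma norm_compose_le: "norm X \<le> a \<Longrightarrow> norm (X o\<^sub>L Y) \<le> a * norm Y"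
  for X Y :: "'a \<Rightarrow>\<^sub>L 'a"
  by (rule order_trans[OF norm_blinfun_compose]) (simp add: mult_right_mono)

text \<open>\<open>R\<close> and \<open>S\<close> satisfy resolvent identities of one and the same
  shape, so continuity is proved once for a family \<open>X\<close>. The scalars of the identity
  vanish at z = w while the operators stay locally bounded.\<close>

lemma continuous_on_family:
  fixes X :: "complex \<Rightarrow> 'a \<Rightarrow>\<^sub>L 'a"
  assumes bound: "\<And>z. z \<in> outer \<Longrightarrow> norm (X z) \<le> b z" and b: "continuous_on outer b"
    and diff: "\<And>z w. z \<in> Z \<Longrightarrow> w \<in> Z \<Longrightarrow>
      X z - X w = (2 * (Re z - Re w)) *\<^sub>R (X z o\<^sub>L S w) + ((norm w)\<^sup>2 - (norm z)\<^sup>2) *\<^sub>R (R z o\<^sub>L X w)"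
  shows "continuous_on outer X"
  unfolding continuous_on_def
proof
  fix w assume w: "w \<in> outer"
  let ?B = "\<lambda>z. \<bar>2 * (Re z - Re w)\<bar> * (b z * norm (S w)) + \<bar>(norm w)\<^sup>2 - (norm z)\<^sup>2\<bar> * (K / (norm z)\<^sup>2 * norm (X w))"
  have "((\<lambda>z. X z - X w) \<longlongrightarrow> 0) (at w within outer)"
  proof (rule Lim_null_comparison)
    show "\<forall>\<^sub>F z in at w within outer. norm (X z - X w) \<le> ?B z"
      unfolding eventually_at_filter
    proof (rule always_eventually, intro allI impI)
      fix z assume "z \<in> outer"
      then show "norm (X z - X w) \<le> ?B z"
        unfolding diff[OF outer_Z[OF \<open>z \<in> outer\<close>] outer_Z[OF w]]
        by (intro norm_triangle_mono) (auto simp only: norm_scaleR intro!: mult_left_mono norm_compose_le R_le bound)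
    qed
    have "(?B \<longlongrightarrow> ?B w) (at w within outer)"
      using w b by (intro tendsto_intros) (auto simp: outer_def continuous_on_def)
    then show "(?B \<longlongrightarrow> 0) (at w within outer)" by simp
  qed
  then show "(X \<longlongrightarrow> X w) (at w within outer)" by (simp add: LIM_zero_iff)
qed

lemma continuous_on_R: "continuous_on outer R"
  by (rule continuous_on_family[OF R_le _ R_diff_op]) (auto intro!: continuous_intros simp: outer_def)

lemma continuous_on_S: "continuous_on outer S"
  by (rule continuous_on_family[OF S_le _ S_diff_op]) (auto intro!: continuous_intros simp: outer_def)

text \<open>In the resolvent identity between c s and c t both scalars vanish at s = t; their
  derivatives there become the coefficients of the result.\<close>

lemma has_vector_derivative_along:
  fixes X :: "complex \<Rightarrow> 'a \<Rightarrow>\<^sub>L 'a"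
  assumes c: "(c has_vector_derivative c') (at t within U)" and cU: "\<And>s. s \<in> U \<Longrightarrow> c s \<in> outer" and t: "t \<in> U"
    and X: "continuous_on outer X"
    and diff: "\<And>z w. z \<in> Z \<Longrightarrow> w \<in> Z \<Longrightarrow>
      X z - X w = (2 * (Re z - Re w)) *\<^sub>R (X z o\<^sub>L S w) + ((norm w)\<^sup>2 - (norm z)\<^sup>2) *\<^sub>R (R z o\<^sub>L X w)"
  shows "((\<lambda>s. X (c s)) has_vector_derivative
    (2 * Re c') *\<^sub>R (X (c t) o\<^sub>L S (c t)) - (2 * (c t \<bullet> c')) *\<^sub>R (R (c t) o\<^sub>L X (c t))) (at t within U)"
proof -
  have cc: "continuous (at t within U) c"
    using has_vector_derivative_continuous[OF c] .
  have Xc: "continuous (at t within U) (\<lambda>s. Y (c s))" if "continuous_on outer Y" for Y :: "complex \<Rightarrow> 'a \<Rightarrow>\<^sub>L 'a"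
  proof -
    have "continuous (at (c t) within c ` U) Y"
      using that cU t by (auto simp: continuous_on_eq_continuous_within intro: continuous_within_subset)
    then show ?thesis using continuous_within_compose[OF cc] by (simp add: o_def)
  qed
  have Re: "((\<lambda>s. 2 * (Re (c s) - Re (c t))) has_real_derivative 2 * Re c') (at t within U)"
    using DERIV_cmult[OF DERIV_diff[OF bounded_linear.has_vector_derivative[OF bounded_linear_Re c,
      folded has_real_derivative_iff_has_vector_derivative] DERIV_const], of 2 "Re (c t)"] by simp
  have nn: "((\<lambda>s. (norm (c t))\<^sup>2 - (norm (c s))\<^sup>2) has_real_derivative - (2 * (c t \<bullet> c'))) (at t within U)"
  proof -
    have "((\<lambda>s. c s \<bullet> c s) has_real_derivative (c t \<bullet> c' + c' \<bullet> c t)) (at t within U)"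
      using bounded_bilinear.has_vector_derivative[OF bounded_bilinear_inner c c]
      by (simp add: has_real_derivative_iff_has_vector_derivative)
    then show ?thesis
      by (auto simp: power2_norm_eq_inner inner_commute intro!: derivative_eq_intros)
  qed
  have "((\<lambda>s. X (c t) + ((2 * (Re (c s) - Re (c t))) *\<^sub>R (X (c s) o\<^sub>L S (c t)) + ((norm (c t))\<^sup>2 - (norm (c s))\<^sup>2) *\<^sub>R (R (c s) o\<^sub>L X (c t))))
    has_vector_derivative 0 + ((2 * Re c') *\<^sub>R (X (c t) o\<^sub>L S (c t)) + (- (2 * (c t \<bullet> c'))) *\<^sub>R (R (c t) o\<^sub>L X (c t)))) (at t within U)"
    by (intro has_vector_derivative_add has_vector_derivative_const has_vector_derivative_vanishing_scaleR Re nn)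
      (auto intro!: continuous_intros Xc X continuous_on_R bounded_bilinear.continuous[OF bounded_bilinear_blinfun_compose])
  moreover have "X (c t) + ((2 * (Re (c s) - Re (c t))) *\<^sub>R (X (c s) o\<^sub>L S (c t)) + ((norm (c t))\<^sup>2 - (norm (c s))\<^sup>2) *\<^sub>R (R (c s) o\<^sub>L X (c t))) = X (c s)"
    if "s \<in> U" for s
    using diff[OF outer_Z outer_Z, OF cU[OF that] cU[OF t]] by (simp add: algebra_simps)
  ultimately show ?thesis
    using t by (simp add: has_vector_derivative_weaken[OF _ t subset_refl])
qed


lemma has_vector_derivative_R:
  assumes "(c has_vector_derivative c') (at t within U)" "\<forall>s\<in>U. c s \<in> outer" "t \<in> U"
  shows "((\<lambda>s. R (c s)) has_vector_derivative
    (2 * Re c') *\<^sub>R (R (c t) o\<^sub>L S (c t)) - (2 * (c t \<bullet> c')) *\<^sub>R (R (c t) o\<^sub>L R (c t))) (at t within U)"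
  by (rule has_vector_derivative_along[OF assms(1) assms(2)[rule_format] assms(3) continuous_on_R R_diff_op])

lemma has_vector_derivative_S:
  assumes "(c has_vector_derivative c') (at t within U)" "\<forall>s\<in>U. c s \<in> outer" "t \<in> U"
  shows "((\<lambda>s. S (c s)) has_vector_derivative
    (2 * Re c') *\<^sub>R (S (c t) o\<^sub>L S (c t)) - (2 * (c t \<bullet> c')) *\<^sub>R (R (c t) o\<^sub>L S (c t))) (at t within U)"
  by (rule has_vector_derivative_along[OF assms(1) assms(2)[rule_format] assms(3) continuous_on_S S_diff_op])

section \<open>Rotating a truncated ray to the imaginary axis\<close>

text \<open>Minus the real part of z (T - z)^-1 at z = sg t cis \<psi>. It is the end-point term
  when a truncated ray is turned: for holomorphic f the angular derivative of f(z) cis \<psi> equals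
  i times the radial derivative of t cis \<psi> f(z), z = t cis \<psi>.\<close>

definition bdry :: "real \<Rightarrow> real \<Rightarrow> real \<Rightarrow> 'a \<Rightarrow>\<^sub>L 'a" where
  "bdry sg \<psi> t = t\<^sup>2 *\<^sub>R R (complex_of_real (sg * t) * cis \<psi>) - (sg * t * cos \<psi>) *\<^sub>R S (complex_of_real (sg * t) * cis \<psi>)"

lemma norm_ray: "sg = 1 \<or> sg = - 1 \<Longrightarrow> 0 < t \<Longrightarrow> norm (complex_of_real (sg * t) * cis \<psi>) = t"
  by (auto simp: norm_mult)

text \<open>The differentiated operator is the imaginary part of (T - z)^-1 dz/dt: along a ray
  through 0 the \<open>R\<close> part of \<open>Lam\<close> vanishes.\<close>

lemma angle_derivative:
  assumes \<psi>: "\<psi> \<in> {\<phi>..pi/2}" and t: "0 < t" and sg: "sg = 1 \<or> sg = - 1"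
  defines "z \<equiv> complex_of_real (sg * t) * cis \<psi>"
  shows "((\<lambda>\<psi>. (sg * sin \<psi>) *\<^sub>R S (complex_of_real (sg * t) * cis \<psi>)) has_vector_derivative
     (sg * cos \<psi>) *\<^sub>R S z - (2 * t * (sin \<psi>)\<^sup>2) *\<^sub>R (S z o\<^sub>L S z)) (at \<psi> within {\<phi>..pi/2})"
proof -
  have c: "((\<lambda>\<psi>. complex_of_real (sg * t) * cis \<psi>) has_vector_derivative complex_of_real (sg * t) * (\<i> * cis \<psi>)) (at \<psi> within {\<phi>..pi/2})"
    by (rule has_vector_derivative_at_within)
      (auto intro!: derivative_eq_intros has_vector_derivative_mult_right simp: has_vector_derivative_complex_iff)
  have "\<forall>s\<in>{\<phi>..pi/2}. complex_of_real (sg * t) * cis s \<in> outer"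
    using ray_outer[OF _ _ t sg] by auto
  note D = has_vector_derivative_S[OF c this \<psi>]
  have "((\<lambda>\<psi>. sg * sin \<psi>) has_real_derivative sg * cos \<psi>) (at \<psi> within {\<phi>..pi/2})"
    by (auto intro!: derivative_eq_intros)
  note P = has_vector_derivative_scaleR[OF this D]
  have e: "sg * sg = 1" using sg by auto
  have ee: "sg * (sg * x) = x" for x using e by (metis mult.assoc mult_1)
  \<comment> \<open>The velocity of a rotation is orthogonal to z, so the term with \<open>R\<close>
    composed with \<open>S\<close> drops out.\<close>
  have i: "z \<bullet> (complex_of_real (sg * t) * (\<i> * cis \<psi>)) = 0"
    by (simp add: z_def inner_complex_def algebra_simps)
  have r: "Re (complex_of_real (sg * t) * (\<i> * cis \<psi>)) = - (sg * t * sin \<psi>)"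
    by simp
  have "(sg * sin \<psi>) * (2 * - (sg * t * sin \<psi>)) = - (2 * t * (sin \<psi>)\<^sup>2)"
    using e by (simp add: power2_eq_square algebra_simps) 
  then show ?thesis
    using P unfolding i[unfolded z_def] r z_def
    by (simp add: algebra_simps ee power2_eq_square)
qed

text \<open>The radial derivative is the negative of the angular derivative found above: a
  Cauchy-Riemann equation in polar coordinates.\<close>

lemma radius_derivative:
  assumes \<psi>: "\<phi> \<le> \<psi>" "\<psi> \<le> pi / 2" and t: "0 < t" and sg: "sg = 1 \<or> sg = - 1"
  defines "z \<equiv> complex_of_real (sg * t) * cis \<psi>"
  shows "(bdry sg \<psi> has_vector_derivative
     - ((sg * cos \<psi>) *\<^sub>R S z - (2 * t * (sin \<psi>)\<^sup>2) *\<^sub>R (S z o\<^sub>L S z))) (at t)"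
proof -
  have c: "((\<lambda>t. complex_of_real (sg * t) * cis \<psi>) has_vector_derivative complex_of_real sg * cis \<psi>) (at t within {0<..})"
    by (rule has_vector_derivative_at_within)
      (auto intro!: derivative_eq_intros simp: has_vector_derivative_complex_iff)
  have "\<forall>s\<in>{0<..}. complex_of_real (sg * s) * cis \<psi> \<in> outer"
    using ray_outer[OF \<psi> _ sg] by auto
  note out = this
  have tin: "t \<in> {0<..}" using t by simp
  note DS = has_vector_derivative_S[OF c out tin] and DR = has_vector_derivative_R[OF c out tin]
  have a: "((\<lambda>t. t\<^sup>2) has_real_derivative 2 * t) (at t within {0<..})"
    and b: "((\<lambda>t. sg * t * cos \<psi>) has_real_derivative sg * cos \<psi>) (at t within {0<..})"
    by (auto intro!: derivative_eq_intros)
  note P = has_vector_derivative_diff[OF has_vector_derivative_scaleR[OF a DR] has_vector_derivative_scaleR[OF b DS]]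
  have e: "sg * sg = 1" using sg by auto
  have zZ: "z \<in> Z" using outer_Z[OF ray_outer[OF \<psi> t sg]] by (simp add: z_def)
  have i: "z \<bullet> (complex_of_real sg * cis \<psi>) = t"
  proof -
    have "z \<bullet> (complex_of_real sg * cis \<psi>) = (sg * sg) * (t * (cos \<psi> * cos \<psi> + sin \<psi> * sin \<psi>))"
      by (simp add: z_def inner_complex_def algebra_simps del: sin_cos_squared_add3)
    then show ?thesis using e by simp
  qed
  have r: "Re (complex_of_real sg * cis \<psi>) = sg * cos \<psi>" by simp
  have rz: "Re z = sg * t * cos \<psi>" by (simp add: z_def)
  have nz: "norm z = t" using norm_ray[OF sg t] by (simp add: z_def)
  define A B C D where "A = (R z o\<^sub>L S z)" and "B = (R z o\<^sub>L R z)" and "C = R z" and "D = S z"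
  \<comment> \<open>The resolvent equation on the diagonal expresses the square of S z through
    \<open>A\<close>, \<open>B\<close> and \<open>C\<close>; after that only coefficients are
    compared.\<close>
  have SS: "(D o\<^sub>L D) = C + (2 * (sg * t * cos \<psi>)) *\<^sub>R A - t\<^sup>2 *\<^sub>R B"
    unfolding A_def B_def C_def D_def SS_op[OF zZ zZ] rz nz ..
  have lin: "t\<^sup>2 *\<^sub>R (k *\<^sub>R A - l *\<^sub>R B) + m *\<^sub>R C - (n *\<^sub>R (k *\<^sub>R (C + p *\<^sub>R A - t\<^sup>2 *\<^sub>R B) - l *\<^sub>R A) + q *\<^sub>R D)
     = (t\<^sup>2 * k - n * k * p + n * l) *\<^sub>R A + (n * k * t\<^sup>2 - t\<^sup>2 * l) *\<^sub>R B + (m - n * k) *\<^sub>R C - q *\<^sub>R D"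
    for k l m n p q :: real by (simp add: algebra_simps)
  have lin': "- (q *\<^sub>R D - m *\<^sub>R (C + p *\<^sub>R A - t\<^sup>2 *\<^sub>R B)) = (m * p) *\<^sub>R A + (- (m * t\<^sup>2)) *\<^sub>R B + m *\<^sub>R C - q *\<^sub>R D"
    for m p q :: real by (simp add: algebra_simps)
  have s2: "(sin \<psi>)\<^sup>2 = 1 - (cos \<psi>)\<^sup>2" by (simp add: cos_squared_eq)
  have ee: "sg * (sg * x) = x" for x using e by (metis mult.assoc mult_1)
  have E: "t\<^sup>2 *\<^sub>R ((2 * (sg * cos \<psi>)) *\<^sub>R A - (2 * t) *\<^sub>R B) + (2 * t) *\<^sub>R C
      - ((sg * t * cos \<psi>) *\<^sub>R ((2 * (sg * cos \<psi>)) *\<^sub>R (D o\<^sub>L D) - (2 * t) *\<^sub>R A) + (sg * cos \<psi>) *\<^sub>R D)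
    = - ((sg * cos \<psi>) *\<^sub>R D - (2 * t * (sin \<psi>)\<^sup>2) *\<^sub>R (D o\<^sub>L D))"
    unfolding SS lin lin' s2
    by (intro arg_cong2[where f = "(+)"] arg_cong2[where f = "(-)"] arg_cong2[where f = scaleR] refl)
      (simp_all add: algebra_simps power2_eq_square ee)
  have "((\<lambda>t. t\<^sup>2 *\<^sub>R R (complex_of_real (sg * t) * cis \<psi>) - (sg * t * cos \<psi>) *\<^sub>R S (complex_of_real (sg * t) * cis \<psi>))
      has_vector_derivative - ((sg * cos \<psi>) *\<^sub>R D - (2 * t * (sin \<psi>)\<^sup>2) *\<^sub>R (D o\<^sub>L D))) (at t within {0<..})"
    using P[folded z_def, unfolded i r, folded A_def B_def, folded C_def, folded D_def]
    unfolding E .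
  then show ?thesis
    using t by (simp add: D_def bdry_def[abs_def] at_within_open[OF tin open_greaterThan])
qed


text \<open>Leibniz's rule moves the angular derivative under the integral, where it equals minus a
  radial derivative and integrates to end-point terms. Integration over the angle then compares the
  two positions of the ray.\<close>

lemma integral_rotate:
  assumes ab: "0 < a" "a \<le> b" and sg: "sg = 1 \<or> sg = - 1"
  defines "G \<equiv> \<lambda>\<psi>. integral {a..b} (\<lambda>t. (sg * sin \<psi>) *\<^sub>R S (complex_of_real (sg * t) * cis \<psi>))"
  shows "((\<lambda>\<psi>. bdry sg \<psi> b - bdry sg \<psi> a) has_integral (G \<phi> - G (pi/2))) {\<phi>..pi/2}"
proof -
  define F where "F = (\<lambda>\<psi> t. (sg * cos \<psi>) *\<^sub>R S (complex_of_real (sg * t) * cis \<psi>)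
     - (2 * t * (sin \<psi>)\<^sup>2) *\<^sub>R (S (complex_of_real (sg * t) * cis \<psi>) o\<^sub>L S (complex_of_real (sg * t) * cis \<psi>)))"
  have cS: "continuous_on ({\<phi>..pi/2} \<times> {a..b}) (\<lambda>x. S (complex_of_real (sg * snd x) * cis (fst x)))"
  proof (rule continuous_on_compose2[OF continuous_on_S])
    show "continuous_on ({\<phi>..pi/2} \<times> {a..b}) (\<lambda>x. complex_of_real (sg * snd x) * cis (fst x))"
      by (intro continuous_intros)
    show "(\<lambda>x. complex_of_real (sg * snd x) * cis (fst x)) ` ({\<phi>..pi/2} \<times> {a..b}) \<subseteq> outer"
    proof safe
      fix \<psi> t assume "\<psi> \<in> {\<phi>..pi/2}" "t \<in> {a..b}"
      then show "complex_of_real (sg * snd (\<psi>, t)) * cis (fst (\<psi>, t)) \<in> outer"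
        using ray_outer[of \<psi> t sg] ab sg by auto
    qed
  qed
  have "(G has_vector_derivative integral (cbox a b) (F \<psi>)) (at \<psi> within {\<phi>..pi/2})" if "\<psi> \<in> {\<phi>..pi/2}" for \<psi>
    unfolding G_def cbox_interval[of a b, symmetric]
  proof (rule leibniz_rule_vector_derivative[OF _ _ _ that])
    fix x t assume "x \<in> {\<phi>..pi/2}" "t \<in> cbox a b"
    then show "((\<lambda>x. (sg * sin x) *\<^sub>R S (complex_of_real (sg * t) * cis x)) has_vector_derivative F x t) (at x within {\<phi>..pi/2})"
      unfolding F_def using ab sg by (intro angle_derivative) auto
  next
    fix x assume x: "x \<in> {\<phi>..pi/2}"
    have "continuous_on (cbox a b) (\<lambda>t. S (complex_of_real (sg * snd (x, t)) * cis (fst (x, t))))"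
      by (rule continuous_on_compose2[OF cS, where f = "\<lambda>t. (x, t)"]) (use x in \<open>auto intro!: continuous_intros\<close>)
    then show "(\<lambda>t. (sg * sin x) *\<^sub>R S (complex_of_real (sg * t) * cis x)) integrable_on cbox a b"
      by (intro integrable_continuous continuous_intros) simp
  next
    show "continuous_on ({\<phi>..pi/2} \<times> cbox a b) (\<lambda>(x, t). F x t)"
      unfolding F_def split_beta cbox_interval
      by (intro continuous_intros cS bounded_bilinear.continuous_on[OF bounded_bilinear_blinfun_compose])
  qed auto
  moreover have "integral (cbox a b) (F \<psi>) = - (bdry sg \<psi> b - bdry sg \<psi> a)" if "\<psi> \<in> {\<phi>..pi/2}" for \<psi>
  proof -
    have "((\<lambda>t. - F \<psi> t) has_integral (bdry sg \<psi> b - bdry sg \<psi> a)) {a..b}"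
    proof (rule fundamental_theorem_of_calculus[OF ab(2)])
      fix t assume "t \<in> {a..b}"
      then show "(bdry sg \<psi> has_vector_derivative - F \<psi> t) (at t within {a..b})"
        unfolding F_def using that ab
        by (intro has_vector_derivative_at_within[OF radius_derivative[OF _ _ _ sg]]) auto
    qed
    from has_integral_neg[OF this] show ?thesis by (simp add: integral_unique)
  qed
  ultimately have "(G has_vector_derivative - (bdry sg \<psi> b - bdry sg \<psi> a)) (at \<psi> within {\<phi>..pi/2})" if "\<psi> \<in> {\<phi>..pi/2}" for \<psi>
    using that by simp
  then have "((\<lambda>\<psi>. - (bdry sg \<psi> b - bdry sg \<psi> a)) has_integral (G (pi/2) - G \<phi>)) {\<phi>..pi/2}"
    using phi by (intro fundamental_theorem_of_calculus) auto
  from has_integral_neg[OF this] show ?thesis by simp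
qed

text \<open>For an operator T these are (1 + T^2)^-1 and T (1 + T^2)^-1, since \<open>\<i>\<close>
  has real part 0 and norm 1.\<close>

abbreviation "M \<equiv> R \<i>"
abbreviation "C \<equiv> S \<i>"

lemma iZ: "\<i> \<in> Z" by (rule outer_Z[OF ii_outer])

text \<open>S z C occurs in two forms: the first shows the order |z|^-2 at infinity, the second
  boundedness as z tends to 0. The last formula shows that |z|^2 R z C tends to C at
  infinity.\<close>

lemma SC_formulas:
  assumes "z \<in> Z"
  shows "(S z o\<^sub>L C) = R z - (R z o\<^sub>L M)"
    and "(S z o\<^sub>L C) = M + (2 * Re z) *\<^sub>R (S z o\<^sub>L M) - (norm z)\<^sup>2 *\<^sub>R (R z o\<^sub>L M)"
    and "(R z o\<^sub>L C) = (S z o\<^sub>L M)"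
    and "(norm z)\<^sup>2 *\<^sub>R (R z o\<^sub>L C) = C - S z + (2 * Re z) *\<^sub>R (S z o\<^sub>L C) + (R z o\<^sub>L C)"
proof -
  show RC: "(R z o\<^sub>L C) = (S z o\<^sub>L M)"
    by (rule blinfun_eqI) (simp add: SR[OF assms iZ])
  show 2: "(S z o\<^sub>L C) = M + (2 * Re z) *\<^sub>R (S z o\<^sub>L M) - (norm z)\<^sup>2 *\<^sub>R (R z o\<^sub>L M)"
    unfolding SS_op[OF assms iZ] RC ..
  have "R z - M = (2 * Re z) *\<^sub>R (S z o\<^sub>L M) + (1 - (norm z)\<^sup>2) *\<^sub>R (R z o\<^sub>L M)"
    using R_diff_op[OF assms iZ] by (simp add: RC)
  then show "(S z o\<^sub>L C) = R z - (R z o\<^sub>L M)"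
    unfolding 2 by (simp add: algebra_simps)
  have "S z - C = (2 * Re z) *\<^sub>R (S z o\<^sub>L C) + (1 - (norm z)\<^sup>2) *\<^sub>R (R z o\<^sub>L C)"
    using S_diff_op[OF assms iZ] by simp
  then show "(norm z)\<^sup>2 *\<^sub>R (R z o\<^sub>L C) = C - S z + (2 * Re z) *\<^sub>R (S z o\<^sub>L C) + (R z o\<^sub>L C)"
    by (simp add: algebra_simps)
qed

end

section \<open>Bounds for rational functions on closed sectors\<close>

lemma poly_over_power_tendsto:
  fixes p :: "complex poly"
  assumes "degree p \<le> n"
  shows "((\<lambda>z. poly p z / z ^ n) \<longlongrightarrow> coeff p n) at_infinity"
proof -
  have "((\<lambda>z. \<Sum>i\<le>n. coeff p i * (z ^ i / z ^ n)) \<longlongrightarrow> (\<Sum>i\<le>n. coeff p i * (if i = n then 1 else 0))) at_infinity"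
  proof (intro tendsto_sum tendsto_mult tendsto_const)
    fix i assume i: "i \<in> {..n}"
    have nz: "\<forall>\<^sub>F z::complex in at_infinity. z \<noteq> 0"
      unfolding eventually_at_infinity by (intro exI[of _ 1]) auto
    show "((\<lambda>z::complex. z ^ i / z ^ n) \<longlongrightarrow> (if i = n then 1 else 0)) at_infinity"
    proof (cases "i = n")
      case True
      have "((\<lambda>z::complex. 1) \<longlongrightarrow> 1) at_infinity" by (rule tendsto_const)
      then have "((\<lambda>z::complex. z ^ n / z ^ n) \<longlongrightarrow> 1) at_infinity"
        by (rule Lim_transform_eventually) (use nz in eventually_elim, simp)
      then show ?thesis using True by simp
    next
      case False
      have "((\<lambda>z::complex. inverse z ^ (n - i)) \<longlongrightarrow> 0 ^ (n - i)) at_infinity"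
        by (intro tendsto_power tendsto_inverse_0)
      moreover have "\<forall>\<^sub>F z::complex in at_infinity. inverse z ^ (n - i) = z ^ i / z ^ n"
        using nz
      proof eventually_elim
        case (elim z)
        have "z ^ n = z ^ i * z ^ (n - i)" using i by (simp flip: power_add)
        then show ?case using elim by (simp add: power_inverse divide_inverse)
      qed
      ultimately have "((\<lambda>z::complex. z ^ i / z ^ n) \<longlongrightarrow> 0 ^ (n - i)) at_infinity"
        by (rule Lim_transform_eventually)
      then show ?thesis using False i by (simp add: power_0_left)
    qed
  qed
  moreover have "poly p z / z ^ n = (\<Sum>i\<le>n. coeff p i * (z ^ i / z ^ n))" for z
  proof -
    have "poly p z = (\<Sum>i\<le>n. coeff p i * z ^ i)"
      unfolding poly_altdef using assms
      by (intro sum.mono_neutral_left) (auto simp: coeff_eq_0)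
    then show ?thesis by (simp add: sum_divide_distrib)
  qed
  moreover have "(\<Sum>i\<le>n. coeff p i * (if i = n then 1 else 0)) = coeff p n"
    by (simp add: if_distrib[of "(*) _"] cong: if_cong)
  ultimately show ?thesis by simp
qed

text \<open>Far out the quotient is close to the ratio of the coefficients of order
  \<open>degree q\<close>; on the remaining compact part it is continuous.\<close>

lemma rational_bounded:
  fixes p q :: "complex poly"
  assumes deg: "degree p \<le> degree q" and "closed S" and nz: "\<And>z. z \<in> S \<Longrightarrow> poly q z \<noteq> 0"
  obtains K where "0 \<le> K" "\<And>z. z \<in> S \<Longrightarrow> norm (poly p z / poly q z) \<le> K"
proof (cases "q = 0")
  case True
  with nz have "S = {}" by auto
  then show ?thesis using that[of 0] by auto
next
  case False
  define n L where "n = degree q" and "L = coeff p n / coeff q n"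
  have "((\<lambda>z. (poly p z / z ^ n) / (poly q z / z ^ n)) \<longlongrightarrow> L) at_infinity"
    unfolding L_def using deg False
    by (intro tendsto_divide poly_over_power_tendsto) (auto simp: n_def)
  then have "\<forall>\<^sub>F z in at_infinity. dist ((poly p z / z ^ n) / (poly q z / z ^ n)) L < 1"
    by (rule tendstoD) simp
  then obtain b where b: "\<And>z. b \<le> norm z \<Longrightarrow> dist ((poly p z / z ^ n) / (poly q z / z ^ n)) L < 1"
    by (auto simp: eventually_at_infinity)
  define B where "B = max b 1"
  have far: "norm (poly p z / poly q z) \<le> norm L + 1" if "B \<le> norm z" for z
  proof -
    have "z \<noteq> 0" "b \<le> norm z" using that by (auto simp: B_def)
    then have "norm (poly p z / poly q z - L) < 1"
      using b[of z] by (simp add: dist_norm)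
    then show ?thesis
      using norm_triangle_ineq2[of "poly p z / poly q z" L] by linarith
  qed
  have "compact (S \<inter> cball 0 B)"
    using \<open>closed S\<close> by (simp add: closed_Int_compact)
  then have "compact ((\<lambda>z. poly p z / poly q z) ` (S \<inter> cball 0 B))"
    using nz by (intro compact_continuous_image) (auto intro!: continuous_intros)
  from compact_imp_bounded[OF this]
  obtain D where D: "\<And>z. z \<in> S \<inter> cball 0 B \<Longrightarrow> norm (poly p z / poly q z) \<le> D"
    unfolding bounded_iff by blast
  have "norm (poly p z / poly q z) \<le> max (max D (norm L + 1)) 0" if "z \<in> S" for z
    using far[of z] D[of z] that by (cases "norm z \<le> B") auto
  then show ?thesis by (intro that[of "max (max D (norm L + 1)) 0"]) auto
qed

definition csec_closure :: "real \<Rightarrow> complex set" where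
  "csec_closure \<theta> = {z. \<bar>Im z\<bar> \<le> tan \<theta> * \<bar>Re z\<bar>}"

lemma closed_csec_closure: "closed (csec_closure \<theta>)"
  unfolding csec_closure_def by (intro closed_Collect_le continuous_intros)

lemma csec_subset_closure: "csec \<theta> \<subseteq> csec_closure \<theta>"
  by (auto simp: csec_def csec_closure_def)

text \<open>The zeros \<i> and - \<i> lie on the imaginary axis, which meets the closed sector only
  in 0. Bounds for 1 and for z^2 divided by 1 + z^2 add up to the weighted bound.\<close>

lemma one_plus_square_bound:
  obtains K where "0 \<le> K" "\<And>z. z \<in> csec_closure \<theta> \<Longrightarrow> 1 + z\<^sup>2 \<noteq> 0"
    "\<And>z. z \<in> csec_closure \<theta> \<Longrightarrow> norm (1 / (1 + z\<^sup>2)) \<le> K / (1 + (norm z)\<^sup>2)"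
proof -
  have p: "poly [:1, 0, 1:] z = 1 + z\<^sup>2" "poly [:0, 0, 1:] z = z\<^sup>2" for z :: complex
    by (simp_all add: power2_eq_square)
  have nz: "1 + z\<^sup>2 \<noteq> 0" if "z \<in> csec_closure \<theta>" for z
  proof
    assume *: "1 + z\<^sup>2 = 0"
    have "z\<^sup>2 - \<i>\<^sup>2 = 0" using * by (simp add: add.commute)
    then have "(z - \<i>) * (z + \<i>) = 0" by (simp add: power2_eq_square algebra_simps)
    then have "z = \<i> \<or> z = - \<i>" by (auto simp: add_eq_0_iff2)
    then show False using that by (auto simp: csec_closure_def)
  qed
  obtain K1 where K1: "0 \<le> K1" "\<And>z. z \<in> csec_closure \<theta> \<Longrightarrow> norm (poly 1 z / poly [:1, 0, 1:] z) \<le> K1"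
    by (rule rational_bounded[of 1 "[:1, 0, 1:]", OF _ closed_csec_closure]) (use nz p in auto)
  obtain K2 where K2: "0 \<le> K2" "\<And>z. z \<in> csec_closure \<theta> \<Longrightarrow> norm (poly [:0, 0, 1:] z / poly [:1, 0, 1:] z) \<le> K2"
    by (rule rational_bounded[of "[:0, 0, 1:]" "[:1, 0, 1:]", OF _ closed_csec_closure]) (use nz p in auto)
  show ?thesis
  proof (rule that[of "K1 + K2"])
    show "norm (1 / (1 + z\<^sup>2)) \<le> (K1 + K2) / (1 + (norm z)\<^sup>2)" if z: "z \<in> csec_closure \<theta>" for z
    proof -
      have "norm (1 / (1 + z\<^sup>2)) \<le> K1" "norm (z\<^sup>2 / (1 + z\<^sup>2)) \<le> K2"
        using K1(2)[OF z] K2(2)[OF z] unfolding p by simp_all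
      then have "norm (1 / (1 + z\<^sup>2)) + norm (z\<^sup>2 / (1 + z\<^sup>2)) \<le> K1 + K2" by linarith
      then have "norm (1 / (1 + z\<^sup>2)) * (1 + (norm z)\<^sup>2) \<le> K1 + K2"
        by (simp add: norm_divide norm_power add_divide_distrib)
      then show ?thesis by (simp add: pos_le_divide_eq add_pos_nonneg)
    qed
  qed (use K1 K2 nz in auto)
qed

lemma norm_scaleR_le: "\<bar>a\<bar> \<le> b \<Longrightarrow> norm x \<le> c \<Longrightarrow> norm (a *\<^sub>R x) \<le> b * c"
  by (simp add: mult_mono')

section \<open>Arc terms at 0 and at infinity\<close>

context sector_resolvent
begin

text \<open>Near 0 the arc term itself is only known to be bounded. The factor T contained in C
  lowers the singularity: t^2 R z C = t^2 S z M is of order t, and S z C stays bounded.\<close>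

lemma bdry_C_near:
  assumes "\<phi> \<le> \<psi>" "\<psi> \<le> pi / 2" "0 < t" "sg = 1 \<or> sg = - 1"
  shows "norm (bdry sg \<psi> t o\<^sub>L C) \<le> t * (norm M * (1 + 4 * K))"
proof -
  define z where "z = complex_of_real (sg * t) * cis \<psi>"
  have z: "z \<in> outer" using ray_outer[OF assms] by (simp add: z_def)
  have nz: "norm z = t" using norm_ray[OF assms(4,3)] by (simp add: z_def)
  have at: "\<bar>t\<^sup>2\<bar> \<le> t\<^sup>2" by simp
  have ec: "\<bar>sg * t * cos \<psi>\<bar> \<le> t" and ec2: "\<bar>2 * Re z\<bar> \<le> 2 * t"
    using assms(3,4) by (auto simp: abs_mult z_def)
  have SM: "norm (S z o\<^sub>L M) \<le> K / t * norm M" and RM: "norm (R z o\<^sub>L M) \<le> K / t\<^sup>2 * norm M"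
    using norm_compose_le[OF S_le[OF z]] norm_compose_le[OF R_le[OF z]] nz by simp_all
  have "norm (S z o\<^sub>L C) \<le> (norm M + 2 * t * (K / t * norm M)) + t\<^sup>2 * (K / t\<^sup>2 * norm M)"
    unfolding SC_formulas(2)[OF outer_Z[OF z]] nz
    by (intro order_trans[OF norm_triangle_ineq4] add_mono order_trans[OF norm_triangle_ineq])
      (rule order_refl norm_scaleR_le[OF ec2 SM] norm_scaleR_le[OF at RM])+
  also have "\<dots> = norm M * (1 + 3 * K)"
    using assms(3) by (simp add: field_simps)
  finally have SC: "norm (S z o\<^sub>L C) \<le> norm M * (1 + 3 * K)" .
  have "bdry sg \<psi> t o\<^sub>L C = t\<^sup>2 *\<^sub>R (S z o\<^sub>L M) - (sg * t * cos \<psi>) *\<^sub>R (S z o\<^sub>L C)"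
    unfolding SC_formulas(3)[OF outer_Z[OF z], symmetric]
    by (rule blinfun_eqI) (simp add: bdry_def z_def blinfun.bilinear_simps)
  also have "norm \<dots> \<le> t\<^sup>2 * (K / t * norm M) + t * (norm M * (1 + 3 * K))"
    by (intro order_trans[OF norm_triangle_ineq4] add_mono)
      (rule norm_scaleR_le[OF at SM] norm_scaleR_le[OF ec SC])+
  also have "\<dots> = t * (norm M * (1 + 4 * K))"
    using assms(3) by (simp add: field_simps power2_eq_square)
  finally show ?thesis .
qed

text \<open>C cancels against the leading part of t^2 R z C. What is left consists of S z M, S z and
  Re z S z C, all of order 1/t.\<close>

lemma bdry_C_far:
  assumes "\<phi> \<le> \<psi>" "\<psi> \<le> pi / 2" "0 < t" "sg = 1 \<or> sg = - 1"
  shows "norm ((bdry sg \<psi> t o\<^sub>L C) - C) \<le> 2 * K * (1 + norm M) / t"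
proof -
  define z where "z = complex_of_real (sg * t) * cis \<psi>"
  have z: "z \<in> outer" using ray_outer[OF assms] by (simp add: z_def)
  have nz: "norm z = t" using norm_ray[OF assms(4,3)] by (simp add: z_def)
  have rz: "Re z = sg * t * cos \<psi>" by (simp add: z_def)
  have ec: "\<bar>sg * t * cos \<psi>\<bar> \<le> t"
    using assms(3,4) by (auto simp: abs_mult)
  have SM: "norm (S z o\<^sub>L M) \<le> K / t * norm M" and RM: "norm (R z o\<^sub>L M) \<le> K / t\<^sup>2 * norm M"
    using norm_compose_le[OF S_le[OF z]] norm_compose_le[OF R_le[OF z]] nz by simp_all
  have SC: "norm (S z o\<^sub>L C) \<le> K / t\<^sup>2 + K / t\<^sup>2 * norm M"
    unfolding SC_formulas(1)[OF outer_Z[OF z]]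
    by (rule order_trans[OF norm_triangle_ineq4]) (use R_le[OF z] RM nz in simp)
  have "(bdry sg \<psi> t o\<^sub>L C) - C = (t\<^sup>2 *\<^sub>R (R z o\<^sub>L C) - (sg * t * cos \<psi>) *\<^sub>R (S z o\<^sub>L C)) - C"
    by (rule blinfun_eqI) (simp add: bdry_def z_def blinfun.bilinear_simps)
  also have "\<dots> = ((S z o\<^sub>L M) - S z) + (sg * t * cos \<psi>) *\<^sub>R (S z o\<^sub>L C)"
    using SC_formulas(4)[OF outer_Z[OF z]] unfolding nz rz SC_formulas(3)[OF outer_Z[OF z]]
    by (simp add: algebra_simps flip: scaleR_2)
  also have "norm \<dots> \<le> (K / t * norm M + K / t) + t * (K / t\<^sup>2 + K / t\<^sup>2 * norm M)"
    by (intro order_trans[OF norm_triangle_ineq] add_mono order_trans[OF norm_triangle_ineq4])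
      (rule SM S_le[OF z, unfolded nz] norm_scaleR_le[OF ec SC])+
  also have "\<dots> = 2 * K * (1 + norm M) / t"
    using assms(3) by (simp add: field_simps power2_eq_square)
  finally show ?thesis .
qed


section \<open>Operator integrals along the rays\<close>

text \<open>\<open>sg\<close> = 1 gives the ray in the right half-plane, \<open>sg\<close> = - 1 the
  opposite one. One ray of each conjugate pair suffices, because \<open>R\<close> and
  \<open>S\<close> are invariant under conjugation.\<close>

definition pt :: "real \<Rightarrow> real \<Rightarrow> complex" where
  "pt sg t = complex_of_real (sg * t) * cis \<phi>"

definition dir :: "real \<Rightarrow> complex" where
  "dir sg = complex_of_real sg * cis \<phi>"

lemma pt_dir: "pt sg t = complex_of_real t * dir sg"
  by (simp add: pt_def dir_def)

lemma dir_cases: "sg = 1 \<or> sg = - 1 \<Longrightarrow> dir sg = cis \<phi> \<or> dir sg = - cis \<phi>"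
  by (auto simp: dir_def)

lemma pt_outer: "sg = 1 \<or> sg = - 1 \<Longrightarrow> 0 < t \<Longrightarrow> pt sg t \<in> outer"
  using ray_outer[of \<phi> t sg] phi by (simp add: pt_def)

lemma norm_pt: "sg = 1 \<or> sg = - 1 \<Longrightarrow> 0 < t \<Longrightarrow> norm (pt sg t) = t"
  using norm_ray by (simp add: pt_def)

lemma norm_dir: "sg = 1 \<or> sg = - 1 \<Longrightarrow> norm (dir sg) = 1"
  by (auto simp: dir_def norm_mult)

lemma pt_csec: "sg = 1 \<or> sg = - 1 \<Longrightarrow> 0 < t \<Longrightarrow> \<phi> < \<theta> \<Longrightarrow> \<theta> < pi / 2 \<Longrightarrow> pt sg t \<in> csec \<theta>"
  using ray_in_csec[of \<phi> \<theta> t "dir sg"] phi dir_cases by (simp add: pt_dir)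

lemma continuous_on_pt: "continuous_on A (pt sg)"
  unfolding pt_def by (intro continuous_intros)

text \<open>The imaginary part of the integral of h(z) (T - z)^-1 dz along one ray.\<close>

definition ray :: "(complex \<Rightarrow> complex) \<Rightarrow> real \<Rightarrow> 'a \<Rightarrow>\<^sub>L 'a" where
  "ray h sg = integral {0..} (\<lambda>t. Lam (pt sg t) (h (pt sg t) * dir sg))"

text \<open>The factor |z| in the bound for h compensates the order |z|^-1 of \<open>S\<close> and,
  with the additional |z| in front of it, the order |z|^-2 of \<open>R\<close>; each of the two
  terms contributes B K / (1 + t^2).\<close>

lemma Lam_ray:
  assumes \<theta>: "\<phi> < \<theta>" "\<theta> < pi / 2" and sg: "sg = 1 \<or> sg = - 1"
    and h: "continuous_on (csec \<theta>) h"
    and bound: "\<And>z. z \<in> csec \<theta> \<Longrightarrow> norm (h z) \<le> B * norm z / (1 + (norm z)\<^sup>2)"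
  shows "continuous_on {0<..} (\<lambda>t. Lam (pt sg t) (h (pt sg t) * dir sg))"
    and "0 < t \<Longrightarrow> norm (Lam (pt sg t) (h (pt sg t) * dir sg)) \<le> 2 * B * K / (1 + t\<^sup>2)"
    and "(\<lambda>t. Lam (pt sg t) (h (pt sg t) * dir sg)) integrable_on {0..}"
    and "(\<lambda>n. integral (trunc n) (\<lambda>t. Lam (pt sg t) (h (pt sg t) * dir sg)))
      \<longlonglongrightarrow> ray h sg"
proof -
  have ch: "continuous_on {0<..} (\<lambda>t. h (pt sg t))"
    by (rule continuous_on_compose2[OF h continuous_on_pt]) (use pt_csec[OF sg _ \<theta>] in auto)
  have out: "pt sg ` {0<..} \<subseteq> outer" using pt_outer[OF sg] by auto
  note cR = continuous_on_compose2[OF continuous_on_R continuous_on_pt out]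
    and cS = continuous_on_compose2[OF continuous_on_S continuous_on_pt out]
  show c: "continuous_on {0<..} (\<lambda>t. Lam (pt sg t) (h (pt sg t) * dir sg))"
    unfolding Lam_def by (intro continuous_intros ch cR cS continuous_on_pt)
  show b: "norm (Lam (pt sg t) (h (pt sg t) * dir sg)) \<le> 2 * B * K / (1 + t\<^sup>2)" if "0 < t" for t
  proof -
    let ?z = "pt sg t"
    have n: "norm ?z = t" and nd: "norm (dir sg) = 1" using norm_pt[OF sg that] norm_dir[OF sg] by auto
    have hb: "norm (h ?z) \<le> B * t / (1 + t\<^sup>2)" using bound[OF pt_csec[OF sg that \<theta>]] n by simp
    have "norm (Lam ?z (h ?z * dir sg)) \<le> (B * t / (1 + t\<^sup>2)) * (K / t) + (B * t / (1 + t\<^sup>2) * t) * (K / t\<^sup>2)"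
      unfolding Lam_def
    proof (intro order_trans[OF norm_triangle_ineq4] add_mono norm_scaleR_le)
      show "\<bar>Im (h ?z * dir sg)\<bar> \<le> B * t / (1 + t\<^sup>2)"
        using abs_Im_le_cmod[of "h ?z * dir sg"] hb nd by (simp add: norm_mult)
      have "\<bar>Im (h ?z * dir sg * cnj ?z)\<bar> \<le> norm (h ?z) * t"
        using abs_Im_le_cmod[of "h ?z * dir sg * cnj ?z"] nd n by (simp add: norm_mult)
      also have "\<dots> \<le> B * t / (1 + t\<^sup>2) * t"
        using hb that by (intro mult_right_mono) auto
      finally show "\<bar>Im (h ?z * dir sg * cnj ?z)\<bar> \<le> B * t / (1 + t\<^sup>2) * t" .
      show "norm (S ?z) \<le> K / t" "norm (R ?z) \<le> K / t\<^sup>2"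
        using S_le[OF pt_outer[OF sg that]] R_le[OF pt_outer[OF sg that]] n by simp_all
    qed
    also have "\<dots> = 2 * B * K / (1 + t\<^sup>2)"
      using that by (simp add: power2_eq_square)
    finally show ?thesis .
  qed
  show "(\<lambda>t. Lam (pt sg t) (h (pt sg t) * dir sg)) integrable_on {0..}"
    by (rule improper_integral(1)[OF c b])
  show "(\<lambda>n. integral (trunc n) (\<lambda>t. Lam (pt sg t) (h (pt sg t) * dir sg)))
      \<longlonglongrightarrow> ray h sg"
    unfolding ray_def by (rule improper_integral(2)[OF c b])
qed

end

section \<open>The truncated integrals for z / (1 + z^2)\<close>

context sector_resolvent
begin

lemma Im_dir: "Im (dir sg) = sg * sin \<phi>"
  by (simp add: dir_def)

lemma ray_scalar_zero:
  assumes "\<phi> < \<theta>" "\<theta> < pi / 2" "sg = 1 \<or> sg = - 1"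
    and "g holomorphic_on csec \<theta>" "\<And>x. x \<noteq> 0 \<Longrightarrow> Im (g (complex_of_real x)) = 0"
    and "\<And>z. z \<in> csec \<theta> \<Longrightarrow> norm (g z) \<le> B / (1 + (norm z)\<^sup>2)"
  shows "((\<lambda>t. Im (g (pt sg t) * dir sg)) has_integral 0) {0..}"
  unfolding pt_dir
  by (rule ray_integral_zero[OF phi(1) assms(1,2,4,5,6) dir_cases[OF assms(3)]])

text \<open>The factorization with w = \<i> and g = dir / (1 + z^2): the quadratic factor cancels
  the denominator, and for the bare direction of the ray the \<open>R\<close> part of
  \<open>Lam\<close> vanishes.\<close>

lemma Lam_base:
  assumes sg: "sg = 1 \<or> sg = - 1" and t: "0 < t" and nz: "1 + (pt sg t)\<^sup>2 \<noteq> 0"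
  shows "Lam (pt sg t) (pt sg t / (1 + (pt sg t)\<^sup>2) * dir sg)
    = ((sg * sin \<phi>) *\<^sub>R S (pt sg t) o\<^sub>L C) + Im (pt sg t / (1 + (pt sg t)\<^sup>2) * dir sg) *\<^sub>R C
      - Im (1 / (1 + (pt sg t)\<^sup>2) * dir sg) *\<^sub>R M"
proof -
  define z g where "z = pt sg t" and "g = 1 / (1 + z\<^sup>2) * dir sg"
  have zZ: "z \<in> Z" unfolding z_def by (rule outer_Z[OF pt_outer[OF sg t]])
  have nz': "1 + z\<^sup>2 \<noteq> 0" using nz by (simp add: z_def)
  have gQ: "g * (z\<^sup>2 - 2 * Re \<i> * z + (norm \<i>)\<^sup>2) = dir sg"
    using nz' by (simp add: g_def add.commute)
  have "Im (dir sg * cnj z) = 0"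
    by (simp add: z_def pt_dir dir_def)
  then have "Lam z (dir sg) = (sg * sin \<phi>) *\<^sub>R S z"
    by (simp add: Lam_def Im_dir)
  moreover have "g * z = z / (1 + z\<^sup>2) * dir sg" by (simp add: g_def)
  ultimately show ?thesis
    using Lam_factor(2)[OF zZ iZ, of g] unfolding gQ unfolding z_def g_def by (simp add: mult.commute)
qed

text \<open>The integrand is the derivative of half the argument of 1 + z^2, and that argument moves
  from 0 to 2 \<phi>. Both rays give the same value, since z^2 does not see the sign.\<close>

lemma integral_log_limit:
  assumes sg: "sg = 1 \<or> sg = - 1"
  shows "(\<lambda>n. integral (trunc n) (\<lambda>t. Im (pt sg t / (1 + (pt sg t)\<^sup>2) * dir sg)))
     \<longlonglongrightarrow> \<phi>"
proof -
  define c where "c = cis (2 * \<phi>)"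
  have Imc: "0 < Im c" using phi by (simp add: c_def sin_gt_zero)
  have e: "sg * sg = 1" using sg by auto
  have pd: "pt sg t * dir sg = complex_of_real t * c" "(pt sg t)\<^sup>2 = complex_of_real (t\<^sup>2) * c" for t
  proof -
    have dd: "dir sg * dir sg = c"
    proof -
      have "dir sg * dir sg = complex_of_real (sg * sg) * (cis \<phi> * cis \<phi>)"
        by (simp add: dir_def)
      then show ?thesis by (simp add: e c_def cis_mult)
    qed
    show "pt sg t * dir sg = complex_of_real t * c" by (simp add: pt_dir dd mult.assoc)
    show "(pt sg t)\<^sup>2 = complex_of_real (t\<^sup>2) * c" by (simp add: pt_dir dd power2_eq_square mult.assoc mult.left_commute)
  qed
  define H where "H = (\<lambda>t. Im (Ln (1 + complex_of_real (t\<^sup>2) * c)) / 2)"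
  \<comment> \<open>For t other than 0 the imaginary part is positive, so the principal logarithm is
    smooth along the whole path.\<close>
  have nonneg: "1 + complex_of_real (t\<^sup>2) * c \<notin> \<real>\<^sub>\<le>\<^sub>0" for t
    using Imc by (cases "t = 0") (auto simp: complex_nonpos_Reals_iff)
  have "((\<lambda>t. Im (pt sg t / (1 + (pt sg t)\<^sup>2) * dir sg)) has_integral (H b - H a)) {a..b}" if "a \<le> b" for a b
  proof (rule fundamental_theorem_of_calculus[OF that, where f = H])
    fix t
    have "((\<lambda>t. 1 + complex_of_real (t\<^sup>2) * c) has_vector_derivative complex_of_real (2 * t) * c) (at t)"
      by (auto intro!: derivative_eq_intros simp: has_vector_derivative_complex_iff)
    from field_vector_diff_chain_at[OF this has_field_derivative_Ln[OF nonneg]]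
    have "((\<lambda>t. Ln (1 + complex_of_real (t\<^sup>2) * c)) has_vector_derivative
        complex_of_real (2 * t) * c * inverse (1 + complex_of_real (t\<^sup>2) * c)) (at t)"
      by (simp add: o_def)
    from bounded_linear.has_vector_derivative[OF bounded_linear_Im this]
    have "((\<lambda>t. Im (Ln (1 + complex_of_real (t\<^sup>2) * c)) / 2) has_vector_derivative
        Im (complex_of_real (2 * t) * c * inverse (1 + complex_of_real (t\<^sup>2) * c)) / 2) (at t)"
      by (rule has_vector_derivative_divide)
    moreover have "pt sg t / (1 + (pt sg t)\<^sup>2) * dir sg = complex_of_real t * c * inverse (1 + complex_of_real (t\<^sup>2) * c)"
      using pd[of t] by (simp add: divide_inverse mult_ac)
    moreover have "Im (complex_of_real (2 * t) * w) / 2 = Im (complex_of_real t * w)" for w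
      by simp
    ultimately have "((\<lambda>t. Im (Ln (1 + complex_of_real (t\<^sup>2) * c)) / 2) has_vector_derivative
        Im (pt sg t / (1 + (pt sg t)\<^sup>2) * dir sg)) (at t)"
      by (simp only: mult.assoc)
    then show "(H has_vector_derivative Im (pt sg t / (1 + (pt sg t)\<^sup>2) * dir sg)) (at t within {a..b})"
      unfolding H_def by (rule has_vector_derivative_at_within)
  qed
  note int0 = this
  have int: "integral (trunc n) (\<lambda>t. Im (pt sg t / (1 + (pt sg t)\<^sup>2) * dir sg))
    = H (real (Suc n)) - H (inverse (real (Suc n)))" for n
    by (rule integral_unique, rule int0) (rule order_trans[of _ 1], simp_all add: field_simps)
  have "(\<lambda>n. H (inverse (real (Suc n)))) \<longlonglongrightarrow> H 0"
  proof (rule isCont_tendsto_compose[OF _ LIMSEQ_inverse_real_of_nat])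
    show "isCont H 0" unfolding H_def using nonneg[of 0] by (intro continuous_intros) auto
  qed
  then have 0: "(\<lambda>n. H (inverse (real (Suc n)))) \<longlonglongrightarrow> 0" by (simp add: H_def)
  \<comment> \<open>The positive factor (n + 1)^2 does not affect the argument; dividing it out
    leaves an expression that converges to c.\<close>
  have Hn: "H (real (Suc n)) = Im (Ln (complex_of_real ((inverse (real (Suc n)))\<^sup>2) + c)) / 2" for n
  proof -
    let ?r = "real (Suc n)"
    have "1 + complex_of_real (?r\<^sup>2) * c = complex_of_real (?r\<^sup>2) * (complex_of_real ((inverse ?r)\<^sup>2) + c)"
      by (simp add: algebra_simps power_inverse del: of_nat_Suc)
    moreover have "complex_of_real ((inverse ?r)\<^sup>2) + c \<noteq> 0"
      using Imc by (auto simp: complex_eq_iff)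
    ultimately show ?thesis
      by (simp add: H_def Ln_times_of_real del: of_nat_Suc of_real_power)
  qed
  have "(\<lambda>n. Im (Ln (complex_of_real ((inverse (real (Suc n)))\<^sup>2) + c)) / 2) \<longlonglongrightarrow> Im (Ln (complex_of_real (0\<^sup>2) + c)) / 2"
  proof (rule isCont_tendsto_compose[OF _ LIMSEQ_inverse_real_of_nat])
    have "c \<notin> \<real>\<^sub>\<le>\<^sub>0" using Imc by (auto simp: complex_nonpos_Reals_iff)
    then show "isCont (\<lambda>x. Im (Ln (complex_of_real (x\<^sup>2) + c)) / 2) 0" by (intro continuous_intros) auto
  qed
  moreover have "Ln c = \<i> * complex_of_real (2 * \<phi>)"
    unfolding c_def cis_conv_exp using phi by (intro Ln_exp) auto
  ultimately have "(\<lambda>n. H (real (Suc n))) \<longlonglongrightarrow> \<phi>"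
    unfolding Hn by simp
  from tendsto_diff[OF this 0] show ?thesis unfolding int by simp
qed

text \<open>At angle pi/2 the two rays are conjugate to each other and carry opposite signs, so
  their integrals cancel. Hence the integrals at angle \<phi> equal the integral over [\<phi>, pi/2]
  of the arc terms of both rays. Multiplied by C, these tend to C at infinity and to 0 at the
  origin, so the limit is twice the length of the interval times C.\<close>

lemma integral_S_limit:
  "(\<lambda>n. (integral (trunc n) (\<lambda>t. (1 * sin \<phi>) *\<^sub>R S (pt 1 t)) o\<^sub>L C)
      + (integral (trunc n) (\<lambda>t. (- 1 * sin \<phi>) *\<^sub>R S (pt (- 1) t)) o\<^sub>L C))
     \<longlonglongrightarrow> (pi - 2 * \<phi>) *\<^sub>R C"
proof -
  define G where "G = (\<lambda>a b sg \<psi>. integral {a..b} (\<lambda>t. (sg * sin \<psi>) *\<^sub>R S (complex_of_real (sg * t) * cis \<psi>)))"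
  \<comment> \<open>For both rays together: the errors of the arcs of radius n + 1 and of radius
    1/(n + 1).\<close>
  define E where "E = (\<lambda>n. 4 * K * (1 + norm M) / real (Suc n) + 2 * (inverse (real (Suc n)) * (norm M * (1 + 4 * K))))"
  have bd: "norm ((G a b 1 \<phi> o\<^sub>L C) + (G a b (- 1) \<phi> o\<^sub>L C) - (pi - 2 * \<phi>) *\<^sub>R C) \<le> E n * (pi / 2 - \<phi>)"
    if ab: "a = inverse (real (Suc n))" "b = real (Suc n)" for a b n
  proof -
    have a: "0 < a" "a \<le> b"
      unfolding ab by (simp, rule order_trans[of _ 1], simp_all add: field_simps)
    have "G a b (- 1) (pi/2) = integral {a..b} (\<lambda>t. - S (complex_of_real t * \<i>))"
      unfolding G_def
    proof (rule Henstock_Kurzweil_Integration.integral_cong)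
      fix t :: real
      have "complex_of_real (- 1 * t) * cis (pi/2) = cnj (complex_of_real t * \<i>)" by (simp add: complex_eq_iff)
      then show "(- 1 * sin (pi/2)) *\<^sub>R S (complex_of_real (- 1 * t) * cis (pi/2)) = - S (complex_of_real t * \<i>)"
        by (simp only: S_cnj) simp
    qed
    also have "\<dots> = - G a b 1 (pi/2)" by (simp add: G_def)
    finally have G0: "G a b 1 (pi/2) + G a b (- 1) (pi/2) = 0" by simp
    have "((\<lambda>\<psi>. (bdry 1 \<psi> b - bdry 1 \<psi> a) + (bdry (- 1) \<psi> b - bdry (- 1) \<psi> a)) has_integral
        ((G a b 1 \<phi> - G a b 1 (pi/2)) + (G a b (- 1) \<phi> - G a b (- 1) (pi/2)))) {\<phi>..pi/2}"
      unfolding G_def by (intro has_integral_add integral_rotate a) auto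
    moreover have "(G a b 1 \<phi> - G a b 1 (pi/2)) + (G a b (- 1) \<phi> - G a b (- 1) (pi/2)) = G a b 1 \<phi> + G a b (- 1) \<phi>"
      using G0 by (simp add: algebra_simps)
    ultimately have "((\<lambda>\<psi>. (bdry 1 \<psi> b - bdry 1 \<psi> a) + (bdry (- 1) \<psi> b - bdry (- 1) \<psi> a)) has_integral
        (G a b 1 \<phi> + G a b (- 1) \<phi>)) {\<phi>..pi/2}" by simp
    from has_integral_linear[OF this bounded_bilinear.bounded_linear_left[OF bounded_bilinear_blinfun_compose, of C]]
    have "((\<lambda>\<psi>. (((bdry 1 \<psi> b - bdry 1 \<psi> a) + (bdry (- 1) \<psi> b - bdry (- 1) \<psi> a)) o\<^sub>L C) - 2 *\<^sub>R C) has_integral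
        ((G a b 1 \<phi> + G a b (- 1) \<phi>) o\<^sub>L C) - measure lborel {\<phi>..pi/2} *\<^sub>R (2 *\<^sub>R C)) {\<phi>..pi/2}"
      by (intro has_integral_diff has_integral_const_real) (simp add: o_def)
    then have I: "((\<lambda>\<psi>. (((bdry 1 \<psi> b - bdry 1 \<psi> a) + (bdry (- 1) \<psi> b - bdry (- 1) \<psi> a)) o\<^sub>L C) - 2 *\<^sub>R C) has_integral
        ((G a b 1 \<phi> + G a b (- 1) \<phi>) o\<^sub>L C) - (pi - 2 * \<phi>) *\<^sub>R C) (cbox \<phi> (pi/2))"
      using phi by (simp add: cbox_interval algebra_simps)
    have "norm (((G a b 1 \<phi> + G a b (- 1) \<phi>) o\<^sub>L C) - (pi - 2 * \<phi>) *\<^sub>R C) \<le> E n * measure lborel (cbox \<phi> (pi/2))"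
    proof (rule has_integral_bound[OF _ I])
      show "0 \<le> E n" unfolding E_def using K_nonneg by simp
      fix \<psi> assume "\<psi> \<in> cbox \<phi> (pi/2)"
      then have \<psi>: "\<phi> \<le> \<psi>" "\<psi> \<le> pi/2" by auto
      have eq: "(((bdry 1 \<psi> b - bdry 1 \<psi> a) + (bdry (- 1) \<psi> b - bdry (- 1) \<psi> a)) o\<^sub>L C) - 2 *\<^sub>R C
        = ((((bdry 1 \<psi> b o\<^sub>L C) - C) - (bdry 1 \<psi> a o\<^sub>L C)) + (((bdry (- 1) \<psi> b o\<^sub>L C) - C) - (bdry (- 1) \<psi> a o\<^sub>L C)))"
        by (rule blinfun_eqI) (simp add: blinfun.bilinear_simps scaleR_2)
      have b0: "0 < b" using a by simp
      have "norm ((((bdry (1) \<psi> b o\<^sub>L C) - C) - (bdry (1) \<psi> a o\<^sub>L C)) + (((bdry (- 1) \<psi> b o\<^sub>L C) - C) - (bdry (- 1) \<psi> a o\<^sub>L C)))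
        \<le> (2 * K * (1 + norm M) / b + a * (norm M * (1 + 4 * K))) + (2 * K * (1 + norm M) / b + a * (norm M * (1 + 4 * K)))"
        by (intro order_trans[OF norm_triangle_ineq] add_mono order_trans[OF norm_triangle_ineq4]
          bdry_C_near[OF \<psi> a(1)] bdry_C_far[OF \<psi> b0]) auto
      also have "\<dots> = E n" unfolding E_def ab by simp
      finally show "norm ((((bdry 1 \<psi> b - bdry 1 \<psi> a) + (bdry (- 1) \<psi> b - bdry (- 1) \<psi> a)) o\<^sub>L C) - 2 *\<^sub>R C) \<le> E n"
        unfolding eq .
    qed
    moreover have "((G a b 1 \<phi> + G a b (- 1) \<phi>) o\<^sub>L C) = (G a b 1 \<phi> o\<^sub>L C) + (G a b (- 1) \<phi> o\<^sub>L C)"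
      by (rule blinfun_eqI) (simp add: blinfun.bilinear_simps)
    moreover have "measure lborel (cbox \<phi> (pi/2)) = pi / 2 - \<phi>" using phi by simp
    ultimately show ?thesis by simp
  qed
  have "(\<lambda>n. E n * (pi / 2 - \<phi>)) \<longlonglongrightarrow> 0" unfolding E_def by real_asymp
  from Lim_null_comparison[OF always_eventually[OF allI[OF bd[OF refl refl]]] this]
  have "(\<lambda>n. (G (inverse (real (Suc n))) (real (Suc n)) 1 \<phi> o\<^sub>L C) + (G (inverse (real (Suc n))) (real (Suc n)) (- 1) \<phi> o\<^sub>L C))
     \<longlonglongrightarrow> (pi - 2 * \<phi>) *\<^sub>R C"
    by (simp only: LIM_zero_iff)
  then show ?thesis unfolding G_def pt_def by simp
qed

end

section \<open>Rational functions under the integral\<close>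

text \<open>Real values on the axis are the hypothesis of Cauchy's theorem for a single ray.
  First-order decay at 0 and at infinity makes \<open>ray\<close> converge and survives
  multiplication by bounded functions.\<close>

definition hclass :: "real \<Rightarrow> (complex \<Rightarrow> complex) \<Rightarrow> bool" where
  "hclass \<theta> h \<longleftrightarrow> h holomorphic_on csec \<theta> \<and> (\<forall>x. x \<noteq> 0 \<longrightarrow> Im (h (complex_of_real x)) = 0) \<and>
     (\<exists>B. \<forall>z\<in>csec \<theta>. norm (h z) \<le> B * norm z / (1 + (norm z)\<^sup>2))"

lemma Im_one_plus_square: "Im (1 / (1 + (complex_of_real x)\<^sup>2)) = 0" "Im (complex_of_real x / (1 + (complex_of_real x)\<^sup>2)) = 0"
proof -
  have "1 + (complex_of_real x)\<^sup>2 = complex_of_real (1 + x\<^sup>2)" by simp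
  then show "Im (1 / (1 + (complex_of_real x)\<^sup>2)) = 0" "Im (complex_of_real x / (1 + (complex_of_real x)\<^sup>2)) = 0"
    by (simp_all only: Im_divide_of_real one_complex.sel Im_complex_of_real div_0)
qed

lemma hclass_base: "hclass \<theta> (\<lambda>z. z / (1 + z\<^sup>2))"
proof -
  obtain K where K: "\<And>z. z \<in> csec_closure \<theta> \<Longrightarrow> 1 + z\<^sup>2 \<noteq> 0"
    "\<And>z. z \<in> csec_closure \<theta> \<Longrightarrow> norm (1 / (1 + z\<^sup>2)) \<le> K / (1 + (norm z)\<^sup>2)"
    by (rule one_plus_square_bound[of \<theta>]) blast
  have "norm (z / (1 + z\<^sup>2)) \<le> K * norm z / (1 + (norm z)\<^sup>2)" if "z \<in> csec \<theta>" for z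
    using mult_left_mono[OF K(2)[of z] norm_ge_zero[of z]] that csec_subset_closure[of \<theta>]
    by (auto simp: norm_divide mult.commute)
  moreover have "1 + z\<^sup>2 \<noteq> 0" if "z \<in> csec \<theta>" for z
    using K(1) that csec_subset_closure by blast
  then have "(\<lambda>z. z / (1 + z\<^sup>2)) holomorphic_on csec \<theta>"
    by (intro holomorphic_intros) auto
  ultimately show ?thesis
    unfolding hclass_def using Im_one_plus_square(2) by blast
qed

text \<open>The scalar symbol of T^2 - 2 Re w T + |w|^2.\<close>

definition quad :: "complex \<Rightarrow> complex \<Rightarrow> complex" where
  "quad w z = z\<^sup>2 - complex_of_real (2 * Re w) * z + complex_of_real ((norm w)\<^sup>2)"

lemma quad_factor: "quad w z = (z - w) * (z - cnj w)"
  unfolding quad_def complex_norm_square[of w] complex_add_cnj[of w, symmetric]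
  by (simp add: algebra_simps power2_eq_square)

lemma quad_nonzero:
  assumes "w \<notin> csec_closure \<theta>" "z \<in> csec_closure \<theta>"
  shows "quad w z \<noteq> 0"
  using assms by (auto simp: quad_factor csec_closure_def)

lemma quad_bounds:
  assumes "w \<notin> csec_closure \<theta>"
  obtains B where "0 \<le> B" "\<And>z. z \<in> csec_closure \<theta> \<Longrightarrow> norm (1 / quad w z) \<le> B"
    "\<And>z. z \<in> csec_closure \<theta> \<Longrightarrow> norm (z / quad w z) \<le> B"
    "\<And>z. z \<in> csec_closure \<theta> \<Longrightarrow> norm (z\<^sup>2 / quad w z) \<le> B"
proof -
  define q where "q = [:complex_of_real ((norm w)\<^sup>2), complex_of_real (- 2 * Re w), 1:]"
  have q: "poly q z = quad w z" for z
    by (simp add: q_def quad_def algebra_simps power2_eq_square)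
  have *: "\<exists>B\<ge>0. \<forall>z\<in>csec_closure \<theta>. norm (poly p z / quad w z) \<le> B" if "degree p \<le> 2" for p
    using rational_bounded[of p q, OF _ closed_csec_closure[of \<theta>]] that quad_nonzero[OF assms]
    unfolding q by (metis q_def degree_pCons_eq_if one_neq_zero pCons_eq_0_iff degree_1 numeral_2_eq_2 One_nat_def one_pCons)
  obtain B0 where B0: "B0 \<ge> 0" "\<forall>z\<in>csec_closure \<theta>. norm (poly 1 z / quad w z) \<le> B0" using *[of 1] by auto
  obtain B1 where B1: "B1 \<ge> 0" "\<forall>z\<in>csec_closure \<theta>. norm (poly [:0,1:] z / quad w z) \<le> B1" using *[of "[:0,1:]"] by auto
  obtain B2 where B2: "B2 \<ge> 0" "\<forall>z\<in>csec_closure \<theta>. norm (poly [:0,0,1:] z / quad w z) \<le> B2" using *[of "[:0,0,1:]"] by auto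
  show ?thesis
    by (rule that[of "B0 + B1 + B2"]) (use B0 B1 B2 in \<open>force simp: power2_eq_square\<close>)+
qed

text \<open>1/quad and z/quad are bounded on the sector, so both products stay in the class. Since
  z/quad and z^2/quad are bounded as well, the factor |z| in the bound for h can be absorbed; this
  produces the decay 1/(1 + |z|^2) that Cauchy's theorem asks for.\<close>

lemma
  assumes h: "hclass \<theta> h" and w: "w \<notin> csec_closure \<theta>"
  shows hclass_quad0: "hclass \<theta> (\<lambda>z. h z / quad w z)"
    and hclass_quad1: "hclass \<theta> (\<lambda>z. h z * z / quad w z)"
    and quad_decay: "\<exists>B. \<forall>z\<in>csec \<theta>. norm (h z / quad w z) \<le> B / (1 + (norm z)\<^sup>2) \<and>
      norm (h z * z / quad w z) \<le> B / (1 + (norm z)\<^sup>2)"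
proof -
  obtain B where "0 \<le> B" and B: "\<And>z. z \<in> csec_closure \<theta> \<Longrightarrow> norm (1 / quad w z) \<le> B"
    "\<And>z. z \<in> csec_closure \<theta> \<Longrightarrow> norm (z / quad w z) \<le> B"
    "\<And>z. z \<in> csec_closure \<theta> \<Longrightarrow> norm (z\<^sup>2 / quad w z) \<le> B"
    using quad_bounds[OF w] by blast
  obtain A where A: "\<And>z. z \<in> csec \<theta> \<Longrightarrow> norm (h z) \<le> A * norm z / (1 + (norm z)\<^sup>2)"
    and hol: "h holomorphic_on csec \<theta>" and real: "\<And>x. x \<noteq> 0 \<Longrightarrow> Im (h (complex_of_real x)) = 0"
    using h unfolding hclass_def by blast
  have Im0: "Im (u * v) = 0" if "Im u = 0" "Im v = 0" for u v :: complex
    using that by simp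
  have qr: "Im (1 / quad w (complex_of_real x)) = 0" "Im (complex_of_real x / quad w (complex_of_real x)) = 0" for x
  proof -
    have "quad w (complex_of_real x) = complex_of_real (x\<^sup>2 - 2 * Re w * x + (norm w)\<^sup>2)"
      by (simp add: quad_def)
    then show "Im (1 / quad w (complex_of_real x)) = 0" "Im (complex_of_real x / quad w (complex_of_real x)) = 0"
      by (simp_all only: Im_divide_of_real one_complex.sel Im_complex_of_real div_0)
  qed
  have qn: "quad w z \<noteq> 0" if "z \<in> csec \<theta>" for z
    using quad_nonzero[OF w, of z] that csec_subset_closure by blast
  have qh: "(\<lambda>z. 1 / quad w z) holomorphic_on csec \<theta>" "(\<lambda>z. z / quad w z) holomorphic_on csec \<theta>"
    using qn unfolding quad_def by (auto intro!: holomorphic_intros)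
  have scale: "norm (h z * r) \<le> (A * B) * norm z / (1 + (norm z)\<^sup>2)" if "norm r \<le> B" "z \<in> csec \<theta>" for z r
    using mult_mono[OF A[OF that(2)] that(1)] \<open>0 \<le> B\<close> order_trans[OF norm_ge_zero A[OF that(2)]]
    by (simp add: norm_mult mult_ac)
  show "hclass \<theta> (\<lambda>z. h z / quad w z)"
    unfolding hclass_def
  proof (intro conjI exI[of _ "A * B"] ballI allI impI)
    show "(\<lambda>z. h z / quad w z) holomorphic_on csec \<theta>"
      using holomorphic_on_mult[OF hol qh(1)] by simp
    show "Im (h (complex_of_real x) / quad w (complex_of_real x)) = 0" if "x \<noteq> 0" for x
      using Im0[OF real[OF that] qr(1)[of x]] by simp
    show "norm (h z / quad w z) \<le> A * B * norm z / (1 + (norm z)\<^sup>2)" if "z \<in> csec \<theta>" for z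
      using scale[OF B(1) that] that csec_subset_closure[of \<theta>] by auto
  qed
  show "hclass \<theta> (\<lambda>z. h z * z / quad w z)"
    unfolding hclass_def
  proof (intro conjI exI[of _ "A * B"] ballI allI impI)
    show "(\<lambda>z. h z * z / quad w z) holomorphic_on csec \<theta>"
      using holomorphic_on_mult[OF hol qh(2)] by simp
    show "Im (h (complex_of_real x) * complex_of_real x / quad w (complex_of_real x)) = 0" if "x \<noteq> 0" for x
      using Im0[OF real[OF that] qr(2)[of x]] by (simp only: times_divide_eq_right)
    show "norm (h z * z / quad w z) \<le> A * B * norm z / (1 + (norm z)\<^sup>2)" if "z \<in> csec \<theta>" for z
      using scale[OF B(2) that] that csec_subset_closure[of \<theta>] by auto
  qed
  have decay: "norm (h z * r) \<le> (A * B) / (1 + (norm z)\<^sup>2)" if "norm (z * r) \<le> B" "z \<in> csec \<theta>" for z r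
  proof -
    have "0 < norm z" using zero_notin_csec[OF that(2)] by simp
    moreover have "0 < 1 + (norm z)\<^sup>2" by (simp add: add_pos_nonneg)
    ultimately have "0 \<le> A" using order_trans[OF norm_ge_zero A[OF that(2)]]
      by (simp add: pos_le_divide_eq zero_le_mult_iff)
    have "norm (h z * r) \<le> A * norm z / (1 + (norm z)\<^sup>2) * norm r"
      unfolding norm_mult by (rule mult_right_mono[OF A[OF that(2)] norm_ge_zero])
    also have "\<dots> = A * norm (z * r) / (1 + (norm z)\<^sup>2)" by (simp add: norm_mult)
    also have "\<dots> \<le> A * B / (1 + (norm z)\<^sup>2)"
      using that(1) \<open>0 \<le> A\<close> by (intro divide_right_mono mult_left_mono) auto
    finally show ?thesis .
  qed
  show "\<exists>B. \<forall>z\<in>csec \<theta>. norm (h z / quad w z) \<le> B / (1 + (norm z)\<^sup>2) \<and> norm (h z * z / quad w z) \<le> B / (1 + (norm z)\<^sup>2)"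
  proof (intro exI[of _ "A * B"] ballI conjI)
    fix z assume z: "z \<in> csec \<theta>"
    then have "z \<in> csec_closure \<theta>" using csec_subset_closure by blast
    note Bz = B(2)[OF this] B(3)[OF this]
    show "norm (h z / quad w z) \<le> A * B / (1 + (norm z)\<^sup>2)"
      using decay[of z "1 / quad w z"] Bz(1) z by simp
    show "norm (h z * z / quad w z) \<le> A * B / (1 + (norm z)\<^sup>2)"
      using decay[of z "z / quad w z"] Bz(2) z by (simp add: power2_eq_square)
  qed
qed

context sector_resolvent
begin

lemma hclass_ray:
  assumes \<theta>: "\<phi> < \<theta>" "\<theta> < pi / 2" and sg: "sg = 1 \<or> sg = - 1" and h: "hclass \<theta> h"
  shows "((\<lambda>t. Lam (pt sg t) (h (pt sg t) * dir sg)) has_integral ray h sg) {0..}"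
    and "(\<lambda>n. integral (trunc n) (\<lambda>t. Lam (pt sg t) (h (pt sg t) * dir sg)))
      \<longlonglongrightarrow> ray h sg"
proof -
  obtain B where h': "continuous_on (csec \<theta>) h"
    "\<And>z. z \<in> csec \<theta> \<Longrightarrow> norm (h z) \<le> B * norm z / (1 + (norm z)\<^sup>2)"
    using h unfolding hclass_def by (blast intro: holomorphic_on_imp_continuous_on)
  show "((\<lambda>t. Lam (pt sg t) (h (pt sg t) * dir sg)) has_integral ray h sg) {0..}"
    unfolding ray_def by (rule integrable_integral[OF Lam_ray(3)[OF \<theta> sg h']])
  show "(\<lambda>n. integral (trunc n) (\<lambda>t. Lam (pt sg t) (h (pt sg t) * dir sg)))
      \<longlonglongrightarrow> ray h sg"
    by (rule Lam_ray(4)[OF \<theta> sg h'])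
qed

text \<open>The factorization is integrated along the ray. Its scalar terms come from functions that
  are holomorphic in the sector, real on the axis and of quadratic decay, so they integrate to
  zero.\<close>

lemma ray_step:
  assumes \<theta>: "\<phi> < \<theta>" "\<theta> < pi / 2" and sg: "sg = 1 \<or> sg = - 1" and h: "hclass \<theta> h"
    and w: "w \<in> Z" "w \<notin> csec_closure \<theta>"
  shows "ray (\<lambda>z. h z / quad w z) sg = (ray h sg o\<^sub>L R w)"
    and "ray (\<lambda>z. h z * z / quad w z) sg = (ray h sg o\<^sub>L S w)"
proof -
  let ?u = "\<lambda>t. Im (h (pt sg t) / quad w (pt sg t) * dir sg)"
  let ?v = "\<lambda>t. Im (h (pt sg t) * pt sg t / quad w (pt sg t) * dir sg)"
  obtain B where B: "\<And>z. z \<in> csec \<theta> \<Longrightarrow> norm (h z / quad w z) \<le> B / (1 + (norm z)\<^sup>2)"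
    "\<And>z. z \<in> csec \<theta> \<Longrightarrow> norm (h z * z / quad w z) \<le> B / (1 + (norm z)\<^sup>2)"
    using quad_decay[OF h w(2)] by blast
  have u: "(?u has_integral 0) {0..}"
    using hclass_quad0[OF h w(2)] unfolding hclass_def by (intro ray_scalar_zero[OF \<theta> sg _ _ B(1)]) auto
  have v: "(?v has_integral 0) {0..}"
    using hclass_quad1[OF h w(2)] unfolding hclass_def by (intro ray_scalar_zero[OF \<theta> sg _ _ B(2)]) auto
  note hi = hclass_ray(1)[OF \<theta> sg h]
  note comp = bounded_bilinear.bounded_linear_left[OF bounded_bilinear_blinfun_compose]
  have pt0: "pt sg t \<in> Z \<and> quad w (pt sg t) \<noteq> 0" if "t \<in> {0..} - {0}" for t
    using that outer_Z[OF pt_outer[OF sg, of t]] quad_nonzero[OF w(2), of "pt sg t"]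
      pt_csec[OF sg _ \<theta>, of t] csec_subset_closure[of \<theta>] by auto
  have "((\<lambda>t. (Lam (pt sg t) (h (pt sg t) * dir sg) o\<^sub>L R w) + ?u t *\<^sub>R S w + (?v t *\<^sub>R R w - (?u t * (2 * Re w)) *\<^sub>R R w))
      has_integral ((ray h sg o\<^sub>L R w) + 0 *\<^sub>R S w + (0 *\<^sub>R R w - (0 * (2 * Re w)) *\<^sub>R R w))) {0..}"
    by (intro has_integral_add has_integral_diff has_integral_scaleR_left has_integral_mult_left u v
      has_integral_linear[OF hi comp, unfolded o_def])
  note spike = has_integral_spike[OF negligible_sing[of 0] _ this]
  have "Lam (pt sg t) (h (pt sg t) / quad w (pt sg t) * dir sg)
      = (Lam (pt sg t) (h (pt sg t) * dir sg) o\<^sub>L R w) + ?u t *\<^sub>R S w + (?v t *\<^sub>R R w - (?u t * (2 * Re w)) *\<^sub>R R w)"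
    if t: "t \<in> {0..} - {0}" for t
  proof -
    let ?g = "h (pt sg t) / quad w (pt sg t) * dir sg"
    have "?g * ((pt sg t)\<^sup>2 - 2 * Re w * pt sg t + (norm w)\<^sup>2) = h (pt sg t) * dir sg"
      using pt0[OF t] unfolding quad_def by simp
    moreover have "Im (?g * (pt sg t - 2 * Re w)) = ?v t - ?u t * (2 * Re w)"
    proof -
      have "?g * (pt sg t - 2 * Re w) = h (pt sg t) * pt sg t / quad w (pt sg t) * dir sg - ?g * complex_of_real (2 * Re w)"
        by (simp add: diff_divide_distrib algebra_simps)
      moreover have "Im (x * complex_of_real r) = Im x * r" for x r by simp
      ultimately show ?thesis by (simp only: minus_complex.sel)
    qed
    ultimately show ?thesis
      using Lam_factor(1)[of "pt sg t" w ?g] pt0[OF t] w(1) by (simp only: scaleR_left_diff_distrib)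
  qed
  from spike[OF this] have "((\<lambda>t. Lam (pt sg t) (h (pt sg t) / quad w (pt sg t) * dir sg)) has_integral (ray h sg o\<^sub>L R w)) {0..}"
    by simp
  then show "ray (\<lambda>z. h z / quad w z) sg = (ray h sg o\<^sub>L R w)"
    unfolding ray_def by (rule integral_unique)
  have "((\<lambda>t. (Lam (pt sg t) (h (pt sg t) * dir sg) o\<^sub>L S w) + ?v t *\<^sub>R S w - ((norm w)\<^sup>2 * ?u t) *\<^sub>R R w)
      has_integral ((ray h sg o\<^sub>L S w) + 0 *\<^sub>R S w - ((norm w)\<^sup>2 * 0) *\<^sub>R R w)) {0..}"
    by (intro has_integral_add has_integral_diff has_integral_scaleR_left has_integral_mult_right u v
      has_integral_linear[OF hi comp, unfolded o_def])
  note spike = has_integral_spike[OF negligible_sing[of 0] _ this]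
  have "Lam (pt sg t) (h (pt sg t) * pt sg t / quad w (pt sg t) * dir sg)
      = (Lam (pt sg t) (h (pt sg t) * dir sg) o\<^sub>L S w) + ?v t *\<^sub>R S w - ((norm w)\<^sup>2 * ?u t) *\<^sub>R R w"
    if t: "t \<in> {0..} - {0}" for t
  proof -
    let ?g = "h (pt sg t) / quad w (pt sg t) * dir sg"
    have "?g * ((pt sg t)\<^sup>2 - 2 * Re w * pt sg t + (norm w)\<^sup>2) = h (pt sg t) * dir sg"
      using pt0[OF t] unfolding quad_def by simp
    moreover have "?g * pt sg t = h (pt sg t) * pt sg t / quad w (pt sg t) * dir sg"
      by simp
    ultimately show ?thesis
      using Lam_factor(2)[of "pt sg t" w ?g] pt0[OF t] w(1) by (simp only:)
  qed
  from spike[OF this] have "((\<lambda>t. Lam (pt sg t) (h (pt sg t) * pt sg t / quad w (pt sg t) * dir sg)) has_integral (ray h sg o\<^sub>L S w)) {0..}"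
    by simp
  then show "ray (\<lambda>z. h z * z / quad w z) sg = (ray h sg o\<^sub>L S w)"
    unfolding ray_def by (rule integral_unique)
qed

text \<open>The integrals split into the rotated part, a logarithmic part and a part that Cauchy's
  theorem sends to 0; the limits (pi - 2 \<phi>) C and 2 \<phi> C add up. The split is made on
  truncated rays, where the integral of \<open>S\<close> alone exists.\<close>

lemma ray_base: "ray (\<lambda>z. z / (1 + z\<^sup>2)) 1 + ray (\<lambda>z. z / (1 + z\<^sup>2)) (- 1) = pi *\<^sub>R C"
proof -
  define \<theta> where "\<theta> = (\<phi> + pi / 2) / 2"
  have \<theta>: "\<phi> < \<theta>" "\<theta> < pi / 2" using phi by (auto simp: \<theta>_def field_simps)
  obtain B where B: "\<And>z. z \<in> csec_closure \<theta> \<Longrightarrow> 1 + z\<^sup>2 \<noteq> 0"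
    "\<And>z. z \<in> csec_closure \<theta> \<Longrightarrow> norm (1 / (1 + z\<^sup>2)) \<le> B / (1 + (norm z)\<^sup>2)"
    by (rule one_plus_square_bound[of \<theta>]) blast
  define N where "N = (\<lambda>sg n. integral (trunc n) (\<lambda>t. Im (1 / (1 + (pt sg t)\<^sup>2) * dir sg)))"
  define L where "L = (\<lambda>sg n. integral (trunc n) (\<lambda>t. Im (pt sg t / (1 + (pt sg t)\<^sup>2) * dir sg)))"
  define G where "G = (\<lambda>sg n. integral (trunc n) (\<lambda>t. (sg * sin \<phi>) *\<^sub>R S (pt sg t)))"
  define I where "I = (\<lambda>sg n. integral (trunc n) (\<lambda>t. Lam (pt sg t) (pt sg t / (1 + (pt sg t)\<^sup>2) * dir sg)))"
  have nz: "1 + (pt sg t)\<^sup>2 \<noteq> 0" if "sg = 1 \<or> sg = - 1" "0 < t" for sg t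
    using B(1) pt_csec[OF that \<theta>] csec_subset_closure by blast
  have cN: "continuous_on {0<..} (\<lambda>t. Im (1 / (1 + (pt sg t)\<^sup>2) * dir sg))"
    and cL: "continuous_on {0<..} (\<lambda>t. Im (pt sg t / (1 + (pt sg t)\<^sup>2) * dir sg))"
    if "sg = 1 \<or> sg = - 1" for sg
    using nz[OF that] by (auto intro!: continuous_intros continuous_on_pt)
  have N: "N sg \<longlonglongrightarrow> 0" if sg: "sg = 1 \<or> sg = - 1" for sg
  proof -
    have hol: "(\<lambda>z. 1 / (1 + z\<^sup>2)) holomorphic_on csec \<theta>"
      using B(1) csec_subset_closure[of \<theta>] by (intro holomorphic_intros) blast
    have "((\<lambda>t. Im (1 / (1 + (pt sg t)\<^sup>2) * dir sg)) has_integral 0) {0..}"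
      by (rule ray_scalar_zero[OF \<theta> sg hol Im_one_plus_square(1)])
        (use B(2) csec_subset_closure[of \<theta>] in blast)
    then have i0: "integral {0..} (\<lambda>t. Im (1 / (1 + (pt sg t)\<^sup>2) * dir sg)) = 0"
      by (rule integral_unique)
    have "norm (Im (1 / (1 + (pt sg t)\<^sup>2) * dir sg)) \<le> B / (1 + t\<^sup>2)" if "0 < t" for t
    proof -
      have "norm (Im (1 / (1 + (pt sg t)\<^sup>2) * dir sg)) \<le> norm (1 / (1 + (pt sg t)\<^sup>2))"
        using abs_Im_le_cmod[of "1 / (1 + (pt sg t)\<^sup>2) * dir sg"] norm_dir[OF sg] by (simp add: norm_divide)
      then show ?thesis
        using B(2)[of "pt sg t"] pt_csec[OF sg that \<theta>] csec_subset_closure[of \<theta>] norm_pt[OF sg that] by fastforce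
    qed
    from improper_integral(2)[OF cN[OF sg] this] show ?thesis
      unfolding N_def i0 .
  qed
  have I: "I sg n = (G sg n o\<^sub>L C) + L sg n *\<^sub>R C - N sg n *\<^sub>R M" if sg: "sg = 1 \<or> sg = - 1" for sg n
  proof -
    have pos: "0 < t" if "t \<in> trunc n" for t
      using that less_le_trans[of 0 "inverse (real (Suc n))" t] by simp
    then have sub: "trunc n \<subseteq> {0<..}" by auto
    have "continuous_on (trunc n) (\<lambda>t. S (pt sg t))"
      by (rule continuous_on_compose2[OF continuous_on_S continuous_on_pt]) (use pos pt_outer[OF sg] in blast)
    then have iG: "((\<lambda>t. (sg * sin \<phi>) *\<^sub>R S (pt sg t)) has_integral G sg n) (trunc n)"
      unfolding G_def by (intro integrable_integral integrable_continuous_real continuous_intros)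
    have iL: "((\<lambda>t. Im (pt sg t / (1 + (pt sg t)\<^sup>2) * dir sg)) has_integral L sg n) (trunc n)"
      unfolding L_def by (intro integrable_integral integrable_continuous_real continuous_on_subset[OF cL[OF sg] sub])
    have iN: "((\<lambda>t. Im (1 / (1 + (pt sg t)\<^sup>2) * dir sg)) has_integral N sg n) (trunc n)"
      unfolding N_def by (intro integrable_integral integrable_continuous_real continuous_on_subset[OF cN[OF sg] sub])
    have "((\<lambda>t. ((sg * sin \<phi>) *\<^sub>R S (pt sg t) o\<^sub>L C) + Im (pt sg t / (1 + (pt sg t)\<^sup>2) * dir sg) *\<^sub>R C
      - Im (1 / (1 + (pt sg t)\<^sup>2) * dir sg) *\<^sub>R M) has_integral ((G sg n o\<^sub>L C) + L sg n *\<^sub>R C - N sg n *\<^sub>R M)) (trunc n)"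
      by (intro has_integral_add has_integral_diff has_integral_scaleR_left iL iN
        has_integral_linear[OF iG bounded_bilinear.bounded_linear_left[OF bounded_bilinear_blinfun_compose], unfolded o_def])
    then have "((\<lambda>t. Lam (pt sg t) (pt sg t / (1 + (pt sg t)\<^sup>2) * dir sg)) has_integral ((G sg n o\<^sub>L C) + L sg n *\<^sub>R C - N sg n *\<^sub>R M)) (trunc n)"
      by (rule has_integral_eq[rotated]) (use Lam_base[OF sg] nz[OF sg] pos in metis)
    then show ?thesis unfolding I_def by (rule integral_unique)
  qed
  have Lp: "L 1 \<longlonglongrightarrow> \<phi>" "L (- 1) \<longlonglongrightarrow> \<phi>"
    unfolding L_def by (rule integral_log_limit; simp)+
  have "(\<lambda>n. ((G 1 n o\<^sub>L C) + (G (- 1) n o\<^sub>L C)) + (L 1 n *\<^sub>R C + L (- 1) n *\<^sub>R C) - (N 1 n *\<^sub>R M + N (- 1) n *\<^sub>R M))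
    \<longlonglongrightarrow> (pi - 2 * \<phi>) *\<^sub>R C + (\<phi> *\<^sub>R C + \<phi> *\<^sub>R C) - (0 *\<^sub>R M + 0 *\<^sub>R M)"
    unfolding G_def by (intro tendsto_add tendsto_diff tendsto_scaleR tendsto_const integral_S_limit Lp N) auto
  moreover have "((G 1 n o\<^sub>L C) + (G (- 1) n o\<^sub>L C)) + (L 1 n *\<^sub>R C + L (- 1) n *\<^sub>R C) - (N 1 n *\<^sub>R M + N (- 1) n *\<^sub>R M)
    = I 1 n + I (- 1) n" for n
    using I[of 1 n] I[of "- 1" n] by simp
  moreover have "(pi - 2 * \<phi>) *\<^sub>R C + (\<phi> *\<^sub>R C + \<phi> *\<^sub>R C) - (0 *\<^sub>R M + 0 *\<^sub>R M) = pi *\<^sub>R C"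
    by (simp add: scaleR_left_diff_distrib flip: scaleR_2)
  ultimately have "(\<lambda>n. I 1 n + I (- 1) n) \<longlonglongrightarrow> pi *\<^sub>R C" by simp
  moreover have "(\<lambda>n. I 1 n + I (- 1) n) \<longlonglongrightarrow> ray (\<lambda>z. z / (1 + z\<^sup>2)) 1 + ray (\<lambda>z. z / (1 + z\<^sup>2)) (- 1)"
    unfolding I_def by (intro tendsto_add hclass_ray(2)[OF \<theta> _ hclass_base]) auto
  ultimately show ?thesis by (rule LIMSEQ_unique[symmetric])
qed

end

section \<open>Polynomials of a partial linear operator\<close>

text \<open>\<open>op_pow\<close> applies T last; peeling off the first application instead gives
  the recursion for domains.\<close>

lemma op_pow_Suc2: "op_pow T (Suc k) = op_pow T k \<circ>\<^sub>m T"
proof (induction k)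
  case 0
  then show ?case by (simp add: fun_eq_iff map_comp_def split: option.splits)
next
  case (Suc k)
  have "op_pow T (Suc (Suc k)) = T \<circ>\<^sub>m (op_pow T k \<circ>\<^sub>m T)"
    using Suc.IH by simp
  also have "\<dots> = op_pow T (Suc k) \<circ>\<^sub>m T"
    by (simp add: fun_eq_iff map_comp_def split: option.splits)
  finally show ?case .
qed

locale linear_partial =
  fixes T :: "'a::real_vector \<rightharpoonup> 'a"
  assumes zero_dom: "0 \<in> dom T"
    and add_T: "v \<in> dom T \<Longrightarrow> w \<in> dom T \<Longrightarrow> T (v + w) = Some (the (T v) + the (T w))"
    and scale_T: "v \<in> dom T \<Longrightarrow> T (r *\<^sub>R v) = Some (r *\<^sub>R the (T v))"
begin

text \<open>Total, with unspecified values outside \<open>dom T\<close>: powers and polynomials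
  become ordinary functions, and domains appear as hypotheses \<open>v \<in> D k\<close> wherever
  linearity of T is used.\<close>

definition A :: "'a \<Rightarrow> 'a" where "A v = the (T v)"

definition D :: "nat \<Rightarrow> 'a set" where "D k = dom (op_pow T k)"

definition pev :: "real poly \<Rightarrow> 'a \<Rightarrow> 'a" where
  "pev p v = (\<Sum>k\<le>degree p. coeff p k *\<^sub>R (A ^^ k) v)"

lemma D_0: "D 0 = UNIV"
  by (simp add: D_def dom_def)

lemma D_Suc: "v \<in> D (Suc k) \<longleftrightarrow> v \<in> dom T \<and> A v \<in> D k"
  by (auto simp only: D_def op_pow_Suc2) (auto simp: A_def map_comp_def dom_def split: option.splits)

lemma D_1: "v \<in> D (Suc 0) \<longleftrightarrow> v \<in> dom T"
  using D_Suc[of v 0] by (simp add: D_0)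

lemma op_pow_D: "v \<in> D k \<Longrightarrow> op_pow T k v = Some ((A ^^ k) v)"
proof (induction k arbitrary: v)
  case (Suc k)
  then have "v \<in> dom T" "A v \<in> D k" by (simp_all add: D_Suc)
  then have "T v = Some (A v)" "op_pow T k (A v) = Some ((A ^^ k) (A v))"
    using Suc.IH by (auto simp: A_def[of v])
  then show ?case unfolding op_pow_Suc2 by (simp add: map_comp_def funpow_swap1)
qed simp

lemma D_Suc_subset: "D (Suc k) \<subseteq> D k"
  by (auto simp: D_def map_comp_def dom_def split: option.splits)

lemma D_antimono: "m \<le> n \<Longrightarrow> D n \<subseteq> D m"
  using D_Suc_subset by (rule lift_Suc_antimono_le)

lemma A_add: "v \<in> dom T \<Longrightarrow> w \<in> dom T \<Longrightarrow> v + w \<in> dom T \<and> A (v + w) = A v + A w"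
  using add_T by (auto simp: A_def)

lemma A_scale: "v \<in> dom T \<Longrightarrow> r *\<^sub>R v \<in> dom T \<and> A (r *\<^sub>R v) = r *\<^sub>R A v"
  using scale_T by (auto simp: A_def)

lemma A_zero: "A 0 = 0"
  using A_scale[OF zero_dom, of 0] by simp

lemma D_add: "v \<in> D k \<Longrightarrow> w \<in> D k \<Longrightarrow> v + w \<in> D k"
proof (induction k arbitrary: v w)
  case (Suc k)
  then show ?case using A_add[of v w] by (auto simp: D_Suc)
qed (simp add: D_0)

lemma D_scale: "v \<in> D k \<Longrightarrow> r *\<^sub>R v \<in> D k"
proof (induction k arbitrary: v)
  case (Suc k)
  then show ?case using A_scale[of v r] by (auto simp: D_Suc)
qed (simp add: D_0)

lemma D_zero: "0 \<in> D k"
  by (induction k) (auto simp: D_Suc D_0 zero_dom A_zero)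

lemma D_sum: "(\<And>i. i \<in> I \<Longrightarrow> f i \<in> D k) \<Longrightarrow> sum f I \<in> D k"
  by (induction I rule: infinite_finite_induct) (auto intro: D_add D_zero)

lemma A_sum: "(\<And>i. i \<in> I \<Longrightarrow> f i \<in> dom T) \<Longrightarrow> A (sum f I) = (\<Sum>i\<in>I. A (f i))"
proof (induction I rule: infinite_finite_induct)
  case (insert x F)
  have "sum f F \<in> dom T" using D_sum[of F f "Suc 0"] insert.prems by (simp add: D_1)
  then show ?case using insert A_add[of "f x" "sum f F"] by simp
qed (simp_all add: A_zero)

lemma funpow_D: "v \<in> D (m + k) \<Longrightarrow> (A ^^ k) v \<in> D m"
proof (induction k arbitrary: v)
  case (Suc k)
  then show ?case by (auto simp: D_Suc funpow_swap1)
qed simp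

lemma pev_upto: "degree p \<le> n \<Longrightarrow> pev p v = (\<Sum>k\<le>n. coeff p k *\<^sub>R (A ^^ k) v)"
  unfolding pev_def by (rule sum.mono_neutral_left) (auto simp: coeff_eq_0)

lemma poly_op_pev: "poly_op p T v = (if v \<in> D (degree p) then Some (pev p v) else None)"
proof (cases "v \<in> D (degree p)")
  case True
  have "the (op_pow T k v) = (A ^^ k) v" if "k \<le> degree p" for k
    using op_pow_D[of v k] True D_antimono[OF that] by auto
  then show ?thesis using True by (simp add: poly_op_def pev_def D_def)
qed (simp add: poly_op_def D_def)

lemma pev_add: "pev (p + q) v = pev p v + pev q v"
proof -
  have "pev (p + q) v = (\<Sum>k\<le>max (degree p) (degree q). coeff (p + q) k *\<^sub>R (A ^^ k) v)"
    by (rule pev_upto) (rule degree_add_le_max)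
  then show ?thesis
    using pev_upto[of p "max (degree p) (degree q)" v] pev_upto[of q "max (degree p) (degree q)" v]
    by (simp add: scaleR_left_distrib sum.distrib)
qed

lemma pev_smult: "pev (smult c p) v = c *\<^sub>R pev p v"
  using pev_upto[of "smult c p" "degree p" v] by (simp add: pev_def scaleR_sum_right degree_smult_le)

lemma pev_pCons: "pev (pCons c p) v = c *\<^sub>R v + pev p (A v)"
proof -
  have "pev (pCons c p) v = (\<Sum>k\<le>Suc (degree p). coeff (pCons c p) k *\<^sub>R (A ^^ k) v)"
    by (rule pev_upto) (rule degree_pCons_le)
  then show ?thesis
    unfolding sum.atMost_Suc_shift by (simp add: pev_def funpow_swap1)
qed

lemma pev_0: "pev 0 v = 0"
  by (simp add: pev_def)

lemma pev_D: "v \<in> D (n + degree p) \<Longrightarrow> pev p v \<in> D n"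
  unfolding pev_def
  by (intro D_sum D_scale funpow_D, rule subsetD[OF D_antimono]) auto

lemma A_pev: "v \<in> D (Suc (degree p)) \<Longrightarrow> A (pev p v) = pev p (A v)"
proof -
  assume v: "v \<in> D (Suc (degree p))"
  have d: "(A ^^ k) v \<in> dom T" if "k \<le> degree p" for k
    using funpow_D[of v "Suc 0" k] D_antimono[of "Suc 0 + k" "Suc (degree p)"] v that D_1 by auto
  have "A (pev p v) = (\<Sum>k\<le>degree p. A (coeff p k *\<^sub>R (A ^^ k) v))"
    unfolding pev_def by (rule A_sum) (use d A_scale in auto)
  also have "\<dots> = pev p (A v)"
    unfolding pev_def by (rule sum.cong[OF refl]) (use d A_scale in \<open>simp add: funpow_swap1\<close>)
  finally show ?thesis .
qed

lemma pev_mult: "v \<in> D (degree p + degree q) \<Longrightarrow> pev (p * q) v = pev p (pev q v)"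
proof (induction p arbitrary: v)
  case (pCons c p)
  have *: "pev (pCons c p * q) v = c *\<^sub>R pev q v + pev (p * q) (A v)"
    by (simp add: pev_add pev_smult pev_pCons)
  show ?case
  proof (cases "p = 0")
    case False
    then have "v \<in> D (Suc (degree p + degree q))" using pCons.prems by simp
    then have "A v \<in> D (degree p + degree q)" and v: "v \<in> D (Suc (degree q))"
      using D_Suc subsetD[OF D_antimono[of "Suc (degree q)" "Suc (degree p + degree q)"]] by simp_all
    then show ?thesis
      unfolding * using pCons.IH by (simp add: pev_pCons A_pev[OF v])
  qed (simp add: pev_smult pev_pCons pev_0)
qed (simp add: pev_0)

definition inverts :: "('a \<Rightarrow> 'a) \<Rightarrow> real poly \<Rightarrow> bool" where
  "inverts B q \<longleftrightarrow> (\<forall>v. B v \<in> D (degree q) \<and> pev q (B v) = v) \<and> (\<forall>u\<in>D (degree q). B (pev q u) = u)"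

lemma op_inv_inverts:
  assumes "inverts B q"
  shows "op_inv (poly_op q T) v = Some (B v)"
proof -
  have "poly_op q T u = Some v \<longleftrightarrow> u = B v" for u
    using assms unfolding inverts_def by (auto simp: poly_op_pev)
  then show ?thesis by (simp add: op_inv_def)
qed

lemma bij_inverts:
  assumes "inverts B q"
  shows "bij_betw (\<lambda>v. the (poly_op q T v)) (dom (poly_op q T)) UNIV"
proof -
  have dom: "dom (poly_op q T) = D (degree q)"
    by (auto simp: poly_op_pev dom_def)
  show ?thesis
    unfolding dom
    by (rule bij_betw_byWitness[where f' = B]) (use assms in \<open>auto simp: poly_op_pev inverts_def\<close>)
qed

end

section \<open>Resolvents of a partial operator\<close>

definition qp :: "complex \<Rightarrow> real poly" where
  "qp w = [:(norm w)\<^sup>2, - 2 * Re w, 1:]"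

lemma degree_qp: "degree (qp w) = 2"
  by (simp add: qp_def)

lemma qp_cnj: "qp (cnj w) = qp w"
  by (simp add: qp_def)

locale op_resolvent = linear_partial T for T :: "'a::banach \<rightharpoonup> 'a" +
  fixes R S :: "complex \<Rightarrow> 'a \<Rightarrow>\<^sub>L 'a" and Z :: "complex set"
  assumes R_inverts: "w \<in> Z \<Longrightarrow> inverts (R w) (qp w)"
    and S_eq: "w \<in> Z \<Longrightarrow> S w v = A (R w v)"
    and R_sym: "R (cnj w) = R w" and S_sym: "S (cnj w) = S w"
begin

lemma R_D2: "w \<in> Z \<Longrightarrow> R w v \<in> D 2"
  using R_inverts[of w] by (auto simp: inverts_def degree_qp)

lemma pev_qp: "pev (qp w) u = (norm w)\<^sup>2 *\<^sub>R u - (2 * Re w) *\<^sub>R A u + A (A u)"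
  by (simp add: qp_def pev_pCons pev_0)

lemma pev_qp_R: "w \<in> Z \<Longrightarrow> pev (qp w) (R w v) = v"
  using R_inverts[of w] by (simp add: inverts_def)

lemma R_pev_qp: "w \<in> Z \<Longrightarrow> u \<in> D 2 \<Longrightarrow> R w (pev (qp w) u) = u"
  using R_inverts[of w] by (auto simp: inverts_def degree_qp)

lemma AA_R: "w \<in> Z \<Longrightarrow> A (A (R w v)) = v + (2 * Re w) *\<^sub>R A (R w v) - (norm w)\<^sup>2 *\<^sub>R R w v"
  using pev_qp_R[of w v] by (simp add: pev_qp algebra_simps)

text \<open>Bootstrapping with T^2 R = 1 + 2 Re w T R - |w|^2 R: the order of v and the order of R v
  known so far bound the order of T^2 R v from below.\<close>

lemma R_D: "w \<in> Z \<Longrightarrow> v \<in> D k \<Longrightarrow> R w v \<in> D (Suc (Suc k))"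
proof (induction k)
  case 0
  then show ?case using R_D2[of w v] by (simp add: numeral_2_eq_2)
next
  case (Suc k)
  then have u: "R w v \<in> D (Suc (Suc k))" using D_Suc_subset[of k] by auto
  then have "A (R w v) \<in> D (Suc k)" "R w v \<in> D (Suc k)"
    using D_Suc_subset[of "Suc k"] D_Suc[of "R w v" "Suc k"] by blast+
  then have "v + (2 * Re w) *\<^sub>R A (R w v) + (- (norm w)\<^sup>2) *\<^sub>R R w v \<in> D (Suc k)"
    using Suc.prems by (intro D_add D_scale)
  then have "A (A (R w v)) \<in> D (Suc k)"
    using AA_R[OF \<open>w \<in> Z\<close>] by simp
  then show ?case using u by (simp add: D_Suc)
qed

text \<open>The quadratic polynomial maps both sides to T v and is injective on the domain of T^2.
  It may be applied to T R v because R v lies in the domain of T^3.\<close>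

lemma R_A: 
  assumes w: "w \<in> Z" and v: "v \<in> dom T"
  shows "A (R w v) = R w (A v)"
proof -
  have u: "R w v \<in> D 3" using R_D[OF w, of v "Suc 0"] v by (simp add: D_1 numeral_3_eq_3)
  then have "A (R w v) \<in> D 2" by (simp add: numeral_3_eq_3 numeral_2_eq_2 D_Suc)
  then have "A (R w v) = R w (pev (qp w) (A (R w v)))" using R_pev_qp[OF w] by simp
  also have "pev (qp w) (A (R w v)) = A (pev (qp w) (R w v))"
    using A_pev[of "R w v" "qp w"] u by (simp add: degree_qp numeral_3_eq_3)
  finally show ?thesis by (simp add: pev_qp_R[OF w])
qed

lemma R_funpow: "w \<in> Z \<Longrightarrow> v \<in> D k \<Longrightarrow> (A ^^ k) (R w v) = R w ((A ^^ k) v)"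
proof (induction k arbitrary: v)
  case (Suc k)
  then show ?case using R_A[of w v] by (auto simp: D_Suc funpow_swap1)
qed simp

lemma R_pev: "w \<in> Z \<Longrightarrow> v \<in> D (degree p) \<Longrightarrow> pev p (R w v) = R w (pev p v)"
  unfolding pev_def
  using R_funpow[of w v] D_antimono[of _ "degree p"]
  by (auto simp: blinfun.sum_right blinfun.scaleR_right subset_eq intro!: sum.cong)

lemma R_dom: "w \<in> Z \<Longrightarrow> R w v \<in> dom T"
  using R_D2[of w v] by (simp add: numeral_2_eq_2 D_Suc)

text \<open>All equations come from inserting Q_w(T) R w = 1 or R z Q_z(T) = 1. In the difference of
  the two quadratic polynomials T^2 cancels, which leaves only \<open>R\<close> and \<open>S\<close>
  in the resolvent identities.\<close>

sublocale resolvent_pair R S Z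
proof
  fix z w v assume z: "z \<in> Z" and w: "w \<in> Z"
  have zw: "R z (R w v) \<in> D 2" by (rule R_D2[OF z])
  show "R z (R w v) = R w (R z v)"
  proof -
    have "R z v = R z (pev (qp w) (R w v))" by (simp add: pev_qp_R[OF w])
    also have "\<dots> = pev (qp w) (R z (R w v))"
      using R_pev[OF z, of "R w v" "qp w"] R_D2[OF w] by (simp add: degree_qp)
    finally show ?thesis using R_pev_qp[OF w zw] by simp
  qed
  show SR: "S z (R w v) = R z (S w v)"
    using R_A[OF z R_dom[OF w]] by (simp add: S_eq z w)
  show "S z (S w v) = R w v + (2 * Re z) *\<^sub>R R z (S w v) - (norm z)\<^sup>2 *\<^sub>R R z (R w v)"
    using AA_R[OF z, of "R w v"] SR R_A[OF z R_dom[OF w], of v] by (simp add: S_eq z w)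
  have "pev (qp w) (R w v) - pev (qp z) (R w v) = ((norm w)\<^sup>2 - (norm z)\<^sup>2) *\<^sub>R R w v + (2 * (Re z - Re w)) *\<^sub>R S w v"
    by (simp add: pev_qp S_eq w algebra_simps)
  moreover have "R z (pev (qp w) (R w v) - pev (qp z) (R w v)) = R z v - R w v"
    by (simp add: blinfun.diff_right pev_qp_R[OF w] R_pev_qp[OF z R_D2[OF w]])
  ultimately show R: "R z v - R w v = (2 * (Re z - Re w)) *\<^sub>R R z (S w v) + ((norm w)\<^sup>2 - (norm z)\<^sup>2) *\<^sub>R R z (R w v)"
    by (simp add: blinfun.bilinear_simps add.commute)
  show "S z v - S w v = (2 * (Re z - Re w)) *\<^sub>R S z (S w v) + ((norm w)\<^sup>2 - (norm z)\<^sup>2) *\<^sub>R R z (S w v)"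
  proof -
    have d: "R z u \<in> dom T" for u by (rule R_dom[OF z])
    have "R z v = R w v + ((2 * (Re z - Re w)) *\<^sub>R R z (S w v) + ((norm w)\<^sup>2 - (norm z)\<^sup>2) *\<^sub>R R z (R w v))"
      using R by (simp only: diff_eq_eq add.commute[of "R w v"])
    then have "A (R z v) = A (R w v + ((2 * (Re z - Re w)) *\<^sub>R R z (S w v) + ((norm w)\<^sup>2 - (norm z)\<^sup>2) *\<^sub>R R z (R w v)))" by simp
    also have "\<dots> = A (R w v) + ((2 * (Re z - Re w)) *\<^sub>R A (R z (S w v)) + ((norm w)\<^sup>2 - (norm z)\<^sup>2) *\<^sub>R A (R z (R w v)))"
      using A_add A_scale d R_dom[OF w] by simp
    finally show ?thesis using SR by (simp add: S_eq z w)
  qed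
qed (rule R_sym S_sym)+

end

section \<open>Real polynomials at complex points\<close>

abbreviation cp :: "real poly \<Rightarrow> complex \<Rightarrow> complex" where
  "cp p z \<equiv> poly (map_poly complex_of_real p) z"

lemma cp_pCons: "cp (pCons c p) z = complex_of_real c + z * cp p z"
  by (simp add: map_poly_pCons)

lemma cp_add: "cp (p + q) z = cp p z + cp q z"
proof -
  have "map_poly complex_of_real (p + q) = map_poly complex_of_real p + map_poly complex_of_real q"
    by (rule poly_eqI) (simp add: coeff_map_poly)
  then show ?thesis by simp
qed

lemma cp_smult: "cp (smult c p) z = complex_of_real c * cp p z"
proof -
  have "map_poly complex_of_real (smult c p) = smult (complex_of_real c) (map_poly complex_of_real p)"
    by (rule poly_eqI) (simp add: coeff_map_poly)
  then show ?thesis by simp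
qed

lemma cp_mult: "cp (p * q) z = cp p z * cp q z"
  by (induction p) (simp_all add: cp_pCons cp_add cp_smult algebra_simps mult_pCons_left)

lemma cp_cnj: "cp p (cnj z) = cnj (cp p z)"
  by (induction p) (simp_all add: cp_pCons)

lemma cp_qp: "cp (qp w) z = quad w z"
  by (simp add: qp_def cp_pCons quad_def algebra_simps power2_eq_square)

lemma exists_cp_root:
  assumes "0 < degree p"
  obtains w where "cp p w = 0"
proof -
  have "degree (map_poly complex_of_real p) = degree p"
    by (rule degree_map_poly) simp
  then have "\<not> constant (poly (map_poly complex_of_real p))"
    using assms by (simp add: constant_degree)
  then show ?thesis using fundamental_theorem_of_algebra that by blast
qed

lemma poly_degree_le_1:
  assumes "degree r \<le> 1"
  shows "r = [:coeff r 0, coeff r 1:]"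
  by (rule poly_eqI) (use assms in \<open>auto simp: coeff_pCons coeff_eq_0 split: nat.split\<close>)

text \<open>The remainder of p modulo \<open>qp w\<close> is real of degree at most 1, and a nonreal
  zero forces it to vanish.\<close>

lemma qp_dvd:
  assumes "cp p w = 0" and "Im w \<noteq> 0"
  shows "qp w dvd p"
proof -
  define r where "r = p mod qp w"
  have "cp (qp w) w = 0" unfolding cp_qp by (simp add: quad_factor)
  moreover have "p = p div qp w * qp w + r" by (simp add: r_def)
  ultimately have r0: "cp r w = 0"
    using assms(1) by (metis add_0 cp_add cp_mult mult_zero_right)
  have "r = 0 \<or> degree r < 2"
    using degree_mod_less[of "qp w" p] by (auto simp: r_def degree_qp qp_def)
  then have "degree r \<le> 1" by auto
  then obtain a b where r: "r = [:a, b:]" using poly_degree_le_1 by blast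
  have "complex_of_real a + w * complex_of_real b = 0" using r0 unfolding r by (simp add: cp_pCons)
  then have "Im w * b = 0" "a + Re w * b = 0"
    by (simp_all add: complex_eq_iff)
  then have "r = 0" using assms(2) by (simp add: r)
  then show ?thesis by (simp add: r_def mod_eq_0_iff_dvd)
qed

section \<open>Linearity of the function class and of the ray integrals\<close>

lemma hclass_cong: "(\<And>z. z \<in> csec \<theta> \<Longrightarrow> h z = h' z) \<Longrightarrow> 0 < tan \<theta> \<Longrightarrow> hclass \<theta> h \<longleftrightarrow> hclass \<theta> h'"
proof -
  assume eq: "\<And>z. z \<in> csec \<theta> \<Longrightarrow> h z = h' z" and t: "0 < tan \<theta>"
  then have "complex_of_real x \<in> csec \<theta>" if "x \<noteq> 0" for x using that by (simp add: csec_def)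
  then show ?thesis
    unfolding hclass_def using eq by (simp cong: holomorphic_cong conj_cong)
qed

lemma hclass_scale:
  assumes "hclass \<theta> h"
  shows "hclass \<theta> (\<lambda>z. h z * complex_of_real c)"
proof -
  obtain B where B: "\<And>z. z \<in> csec \<theta> \<Longrightarrow> norm (h z) \<le> B * norm z / (1 + (norm z)\<^sup>2)"
    using assms unfolding hclass_def by blast
  have "norm (h z * complex_of_real c) \<le> (B * \<bar>c\<bar>) * norm z / (1 + (norm z)\<^sup>2)" if "z \<in> csec \<theta>" for z
    using mult_right_mono[OF B[OF that], of "\<bar>c\<bar>"] by (simp add: norm_mult mult_ac)
  then show ?thesis using assms unfolding hclass_def by (auto intro!: holomorphic_intros)
qed

lemma hclass_add:
  assumes "hclass \<theta> h" "hclass \<theta> k"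
  shows "hclass \<theta> (\<lambda>z. h z + k z)"
proof -
  obtain B where B: "\<And>z. z \<in> csec \<theta> \<Longrightarrow> norm (h z) \<le> B * norm z / (1 + (norm z)\<^sup>2)"
    using assms unfolding hclass_def by blast
  obtain B' where B': "\<And>z. z \<in> csec \<theta> \<Longrightarrow> norm (k z) \<le> B' * norm z / (1 + (norm z)\<^sup>2)"
    using assms unfolding hclass_def by blast
  have "norm (h z + k z) \<le> (B + B') * norm z / (1 + (norm z)\<^sup>2)" if "z \<in> csec \<theta>" for z
    using norm_triangle_mono[OF B[OF that] B'[OF that]] by (simp add: algebra_simps add_divide_distrib)
  then show ?thesis using assms unfolding hclass_def by (auto intro!: holomorphic_intros)
qed

context sector_resolvent
begin

lemma ray_cong:
  assumes "\<phi> < \<theta>" "\<theta> < pi / 2" "sg = 1 \<or> sg = - 1" "\<And>z. z \<in> csec \<theta> \<Longrightarrow> h z = h' z"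
  shows "ray h sg = ray h' sg"
  unfolding ray_def
  by (rule integral_spike[OF negligible_sing[of 0]])
    (use assms(4) pt_csec[OF assms(3) _ assms(1,2)] in auto)

lemma ray_scale:
  "ray (\<lambda>z. h z * complex_of_real c) sg = c *\<^sub>R ray h sg"
proof -
  have "Lam z (g * complex_of_real c * d) = c *\<^sub>R Lam z (g * d)" for z g d
  proof -
    have "Im (g * complex_of_real c * d) = c * Im (g * d)" for g d by (simp add: algebra_simps)
    from this[of g d] this[of g "d * cnj z"] show ?thesis
      by (simp only: Lam_def scaleR_diff_right scaleR_scaleR mult.assoc)
  qed
  then show ?thesis unfolding ray_def by simp
qed

lemma ray_add:
  assumes "\<phi> < \<theta>" "\<theta> < pi / 2" "sg = 1 \<or> sg = - 1" "hclass \<theta> h" "hclass \<theta> k"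
  shows "ray (\<lambda>z. h z + k z) sg = ray h sg + ray k sg"
proof -
  have "Lam z ((a + b) * d) = Lam z (a * d) + Lam z (b * d)" for z a b d
    by (simp add: Lam_def algebra_simps)
  then show ?thesis
    unfolding ray_def[of "\<lambda>z. h z + k z"]
    using has_integral_add[OF hclass_ray(1)[OF assms(1-4)] hclass_ray(1)[OF assms(1-3,5)]]
    by (simp add: integral_unique)
qed

end

section \<open>Rational multipliers\<close>

locale sector_op = op_resolvent + sector_resolvent
begin

text \<open>Quantified over all h of the class, so that the factors of r can be removed one after
  the other, each time with a different h.\<close>

definition multiplier :: "real \<Rightarrow> (complex \<Rightarrow> complex) \<Rightarrow> ('a \<Rightarrow>\<^sub>L 'a) \<Rightarrow> bool" where
  "multiplier \<theta> r X \<longleftrightarrow> (\<forall>h. hclass \<theta> h \<longrightarrow> hclass \<theta> (\<lambda>z. h z * r z) \<and>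
     (\<forall>sg\<in>{1, - 1}. ray (\<lambda>z. h z * r z) sg = (ray h sg o\<^sub>L X)))"

text \<open>With q = \<open>qp w\<close> q', division of a by \<open>qp w\<close> gives a/q = a'/q'
  + (\<alpha> z + \<beta>) / (quad q'). The first part is the induction hypothesis for a', the
  second the hypothesis for the numerator 1 followed by one factorization step. Both numerators 1
  and a' occur, hence the claim for all numerators of degree at most that of q.\<close>

lemma rational_calculus:
  fixes q :: "real poly"
  assumes \<theta>: "\<phi> < \<theta>" "\<theta> < pi / 2"
  shows "q \<noteq> 0 \<Longrightarrow> (\<And>z. cp q z = 0 \<Longrightarrow> z \<in> Z \<and> z \<notin> csec_closure \<theta>) \<Longrightarrow>
    \<exists>B :: 'a \<Rightarrow>\<^sub>L 'a. inverts (blinfun_apply B) q \<and> (\<forall>a. degree a \<le> degree q \<longrightarrow> (\<exists>X :: 'a \<Rightarrow>\<^sub>L 'a.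
      (\<forall>v. blinfun_apply X v = pev a (blinfun_apply B v)) \<and>
      multiplier \<theta> (\<lambda>z. cp a z / cp q z) X))"
proof (induction "degree q" arbitrary: q rule: less_induct)
  case less
  have tan: "0 < tan \<theta>" using \<theta> phi by (intro tan_gt_zero) auto
  show ?case
  proof (cases "degree q = 0")
    case True
    then obtain c where q: "q = [:c:]" by (rule degree_eq_zeroE)
    with less.prems have "c \<noteq> 0" by auto
    show ?thesis
    proof (rule exI[of _ "(1 / c) *\<^sub>R id_blinfun"], intro conjI allI impI)
      show "inverts ((1 / c) *\<^sub>R id_blinfun) q"
        using \<open>c \<noteq> 0\<close> by (simp add: inverts_def q D_0 pev_pCons pev_0 blinfun.bilinear_simps)
    next
      fix a :: "real poly" assume "degree a \<le> degree q"
      then obtain d where a: "a = [:d:]" using True degree_eq_zeroE by auto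
      have eq: "cp a z / cp q z = complex_of_real (d / c)" for z
        by (simp add: a q cp_pCons)
      show "\<exists>X :: 'a \<Rightarrow>\<^sub>L 'a. (\<forall>v. blinfun_apply X v = pev a (blinfun_apply ((1 / c) *\<^sub>R id_blinfun) v)) \<and>
        multiplier \<theta> (\<lambda>z. cp a z / cp q z) X"
        unfolding eq multiplier_def ray_scale
      proof (intro exI[of _ "(d / c) *\<^sub>R id_blinfun"] conjI allI impI ballI)
        show "blinfun_apply ((d / c) *\<^sub>R id_blinfun) v = pev a (blinfun_apply ((1 / c) *\<^sub>R id_blinfun) v)" for v
          by (simp add: a pev_pCons pev_0 blinfun.bilinear_simps)
        show "hclass \<theta> (\<lambda>z. h z * complex_of_real (d / c))" if "hclass \<theta> h" for h
          by (rule hclass_scale[OF that])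
        fix h sg
        show "(d / c) *\<^sub>R ray h sg = (ray h sg o\<^sub>L (d / c) *\<^sub>R id_blinfun)"
          by (rule blinfun_eqI) (simp add: blinfun.bilinear_simps)
      qed
    qed
  next
    case False
    then obtain w where root: "cp q w = 0" using exists_cp_root by blast
    then have w: "w \<in> Z" "w \<notin> csec_closure \<theta>" using less.prems by auto
    have "0 \<le> tan \<theta> * \<bar>Re w\<bar>" using tan by simp
    \<comment> \<open>The closed sector contains the whole real axis, so zeros of q are
      nonreal.\<close>
    then have "Im w \<noteq> 0" using w(2) by (auto simp: csec_closure_def)
    then obtain q' where q: "q = qp w * q'" using qp_dvd[OF root] by (auto elim: dvdE)
    have q0: "qp w \<noteq> 0" "q' \<noteq> 0" using less.prems q by auto
    have deg: "degree q = degree q' + 2"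
      using q0 unfolding q by (simp add: degree_mult_eq degree_qp)
    have "\<And>z. cp q' z = 0 \<Longrightarrow> z \<in> Z \<and> z \<notin> csec_closure \<theta>"
      using less.prems(2) by (simp add: q cp_mult)
    from less.hyps[OF _ q0(2) this] deg obtain B' :: "'a \<Rightarrow>\<^sub>L 'a" where B': "inverts B' q'"
      and X': "\<And>a. degree a \<le> degree q' \<Longrightarrow> \<exists>X :: 'a \<Rightarrow>\<^sub>L 'a. (\<forall>v. blinfun_apply X v = pev a (blinfun_apply B' v)) \<and>
      multiplier \<theta> (\<lambda>z. cp a z / cp q' z) X"
      by auto
    have B'D: "B' v \<in> D (degree q')" and qB': "pev q' (B' v) = v" and B'q: "u \<in> D (degree q') \<Longrightarrow> B' (pev q' u) = u" for u v
      using B' by (auto simp: inverts_def)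
    have RB'D: "R w (B' v) \<in> D (degree q' + 2)" for v
      using R_D[OF w(1) B'D[of v]] by (simp add: numeral_2_eq_2)
    \<comment> \<open>q'(T) commutes with \<open>R w\<close> on its domain and maps the left side to
      \<open>R w v\<close>. Commutation matters because the factors leave the integral in the order
      B', R w, opposite to that in the inverse of q[T].\<close>
    have RB': "R w (B' v) = B' (R w v)" for v
      using B'q[of "R w (B' v)"] R_pev[OF w(1) B'D[of v]] qB'[of v] RB'D[of v]
        D_antimono[of "degree q'" "degree q' + 2"] by auto
    have SB': "S w (B' v) = B' (S w v)" for v
    proof -
      have "R w (B' v) \<in> D (Suc (degree q'))"
        using RB'D[of v] D_antimono[of "Suc (degree q')" "degree q' + 2"] by auto
      then have "pev q' (A (R w (B' v))) = A (R w v)" "A (R w (B' v)) \<in> D (degree q')"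
        using A_pev[of "R w (B' v)" q'] R_pev[OF w(1) B'D[of v]] qB'[of v] by (auto simp: D_Suc)
      then show ?thesis using B'q[of "A (R w (B' v))"] by (simp add: S_eq[OF w(1)])
    qed
    obtain X1 :: "'a \<Rightarrow>\<^sub>L 'a" where X1: "\<And>v. X1 v = pev 1 (B' v)" and X1h: "\<And>h. hclass \<theta> h \<Longrightarrow>
        hclass \<theta> (\<lambda>z. h z * (cp 1 z / cp q' z)) \<and>
        (\<forall>sg\<in>{1, - 1}. ray (\<lambda>z. h z * (cp 1 z / cp q' z)) sg = (ray h sg o\<^sub>L X1))"
      using X'[of 1] unfolding multiplier_def by auto
    have "X1 = B'" by (rule blinfun_eqI) (simp add: X1 pev_def)
    note X1h = X1h[unfolded this]
    have nz: "cp q' z \<noteq> 0" "quad w z \<noteq> 0" if "z \<in> csec \<theta>" for z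
      using less.prems(2)[of z] that csec_subset_closure[of \<theta>] by (auto simp: q cp_mult cp_qp)
    show ?thesis
    proof (rule exI[of _ "R w o\<^sub>L B'"], intro conjI allI impI)
      show "inverts (R w o\<^sub>L B') q"
        unfolding inverts_def deg
      proof (intro conjI allI ballI)
        fix v show "(R w o\<^sub>L B') v \<in> D (degree q' + 2)" using RB'D by simp
        have "pev q (R w (B' v)) = pev q' (pev (qp w) (R w (B' v)))"
          unfolding q mult.commute[of "qp w"] by (rule pev_mult) (use RB'D in \<open>simp add: degree_qp\<close>)
        then show "pev q ((R w o\<^sub>L B') v) = v" by (simp add: pev_qp_R[OF w(1)] qB')
      next
        fix u assume u: "u \<in> D (degree q' + 2)"
        then have "pev q u = pev q' (pev (qp w) u)" "pev (qp w) u \<in> D (degree q')"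
          using pev_mult[of u q' "qp w"] pev_D[of u "degree q'" "qp w"] by (simp_all add: q mult.commute degree_qp)
        then show "(R w o\<^sub>L B') (pev q u) = u"
          using B'q R_pev_qp[OF w(1)] u D_antimono[of 2 "degree q' + 2"] by auto
      qed
    next
      fix a :: "real poly" assume "degree a \<le> degree q"
      define a' r where "a' = a div qp w" and "r = a mod qp w"
      have a: "a = a' * qp w + r" by (simp add: a'_def r_def)
      have "r = 0 \<or> degree r < 2"
        using degree_mod_less[OF q0(1), of a] by (auto simp: r_def degree_qp)
      then have "degree r \<le> 1" by auto
      then obtain \<beta> \<alpha> where r: "r = [:\<beta>, \<alpha>:]" using poly_degree_le_1 by blast
      have a'deg: "degree a' \<le> degree q'"
      proof (cases "a' = 0")
        case False
        then have *: "degree (a' * qp w) = degree a' + 2"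
          using q0(1) by (simp add: degree_mult_eq degree_qp)
        have "degree r < degree (a' * qp w)" using \<open>degree r \<le> 1\<close> * by simp
        from degree_add_eq_left[OF this] have "degree a = degree a' + 2" using a * by simp
        then show ?thesis using \<open>degree a \<le> degree q\<close> deg by simp
      qed simp
      from X'[OF a'deg] obtain X2 :: "'a \<Rightarrow>\<^sub>L 'a" where X2: "\<And>v. X2 v = pev a' (B' v)" and X2h: "\<And>h. hclass \<theta> h \<Longrightarrow>
        hclass \<theta> (\<lambda>z. h z * (cp a' z / cp q' z)) \<and>
        (\<forall>sg\<in>{1, - 1}. ray (\<lambda>z. h z * (cp a' z / cp q' z)) sg = (ray h sg o\<^sub>L X2))"
        unfolding multiplier_def by auto
      \<comment> \<open>a(T) q(T)^-1, split according to a = a' \<open>qp w\<close> + r with r =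
        \<alpha> z + \<beta>.\<close>
      define X where "X = X2 + \<alpha> *\<^sub>R (S w o\<^sub>L B') + \<beta> *\<^sub>R (R w o\<^sub>L B')"
      have "X v = pev a ((R w o\<^sub>L B') v)" for v
      proof -
        have "R w (B' v) \<in> D (degree a' + degree (qp w))"
          using RB'D[of v] a'deg D_antimono[of "degree a' + 2" "degree q' + 2"] by (auto simp: degree_qp)
        then have "pev a (R w (B' v)) = pev a' (B' v) + pev r (R w (B' v))"
          unfolding a pev_add by (simp add: pev_mult pev_qp_R[OF w(1)])
        then show ?thesis
          by (simp add: X_def X2 r pev_pCons pev_0 blinfun.bilinear_simps S_eq[OF w(1)])
      qed
      moreover have "hclass \<theta> (\<lambda>z. h z * (cp a z / cp q z)) \<and>
        (\<forall>sg\<in>{1, - 1}. ray (\<lambda>z. h z * (cp a z / cp q z)) sg = (ray h sg o\<^sub>L X))" if h: "hclass \<theta> h" for h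
      proof -
        define k where "k = (\<lambda>z. h z * (cp 1 z / cp q' z))"
        define k2 where "k2 = (\<lambda>z. h z * (cp a' z / cp q' z))"
        have k: "hclass \<theta> k" and kr: "\<And>sg. sg \<in> {1, - 1} \<Longrightarrow> ray k sg = (ray h sg o\<^sub>L B')"
          using X1h[OF h] by (auto simp: k_def)
        have k2: "hclass \<theta> k2" and k2r: "\<And>sg. sg \<in> {1, - 1} \<Longrightarrow> ray k2 sg = (ray h sg o\<^sub>L X2)"
          using X2h[OF h] by (auto simp: k2_def)
        note k0 = hclass_scale[OF hclass_quad0[OF k w(2)], of \<beta>] and k1 = hclass_scale[OF hclass_quad1[OF k w(2)], of \<alpha>]
        note k01 = hclass_add[OF k1 k0]
        define H where "H = (\<lambda>z. k2 z + (k z * z / quad w z * complex_of_real \<alpha> + k z / quad w z * complex_of_real \<beta>))"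
        have eq: "h z * (cp a z / cp q z) = H z" if "z \<in> csec \<theta>" for z
        proof -
          have "cp a z / cp q z = cp a' z / cp q' z + (complex_of_real \<beta> + z * complex_of_real \<alpha>) / (quad w z * cp q' z)"
            unfolding a q cp_add cp_mult cp_qp r using nz[OF that] by (simp add: cp_pCons add_divide_distrib)
          then show ?thesis
            unfolding H_def k_def k2_def by (simp add: cp_pCons one_pCons add_divide_distrib algebra_simps)
        qed
        have "hclass \<theta> H" unfolding H_def by (rule hclass_add[OF k2 k01])
        then have "hclass \<theta> (\<lambda>z. h z * (cp a z / cp q z))"
          using hclass_cong[OF eq tan] by simp
        moreover have "ray (\<lambda>z. h z * (cp a z / cp q z)) sg = (ray h sg o\<^sub>L X)" if "sg \<in> {1, - 1}" for sg
        proof -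
          have sg: "sg = 1 \<or> sg = - 1" using that by auto
          have "ray (\<lambda>z. h z * (cp a z / cp q z)) sg = ray H sg"
            by (rule ray_cong[OF \<theta> sg eq])
          also have "\<dots> = ray k2 sg + (\<alpha> *\<^sub>R (ray k sg o\<^sub>L S w) + \<beta> *\<^sub>R (ray k sg o\<^sub>L R w))"
            unfolding H_def ray_add[OF \<theta> sg k2 k01] ray_add[OF \<theta> sg k1 k0] ray_scale ray_step[OF \<theta> sg k w] ..
          also have "\<dots> = (ray h sg o\<^sub>L X)"
            unfolding kr[OF that] k2r[OF that] X_def
            by (rule blinfun_eqI) (simp add: blinfun.bilinear_simps RB' SB')
          finally show ?thesis .
        qed
        ultimately show ?thesis by blast
      qed
      ultimately show "\<exists>X :: 'a \<Rightarrow>\<^sub>L 'a. (\<forall>v. blinfun_apply X v = pev a (blinfun_apply (R w o\<^sub>L B') v)) \<and>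
        multiplier \<theta> (\<lambda>z. cp a z / cp q z) X"
        unfolding multiplier_def by (intro exI[of _ X]) blast
    qed
  qed
qed

end

section \<open>Slices of the Clifford algebra\<close>

lemma axis_add: "axis C (x + y :: 'b::monoid_add) = axis C x + axis C y"
  by (simp add: vec_eq_iff axis_def)

lemma axis_scaleR: "axis C (r *\<^sub>R x :: 'b::real_vector) = r *\<^sub>R axis C x"
  by (simp add: vec_eq_iff axis_def)

lemma bounded_linear_axis_component:
  "bounded_linear (\<lambda>v :: ('v::real_normed_vector, 'n::finite) vec. axis C (c *\<^sub>R (v $ B)) :: ('v, 'm::finite) vec)"
proof (rule bounded_linear_intro[of _ "\<bar>c\<bar>"])
  fix v w :: "('v, 'n) vec" and r
  show "axis C (c *\<^sub>R ((v + w) $ B)) = axis C (c *\<^sub>R (v $ B)) + axis C (c *\<^sub>R (w $ B))"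
    by (simp add: vec_eq_iff axis_def scaleR_add_right)
  show "axis C (c *\<^sub>R ((r *\<^sub>R v) $ B)) = r *\<^sub>R axis C (c *\<^sub>R (v $ B))"
    by (simp add: vec_eq_iff axis_def)
  have "norm (axis C x :: ('v, 'm) vec) = norm x" for x
    by (simp add: norm_vec_def L2_set_def axis_def if_distrib[of norm] if_distrib[of "\<lambda>x. x\<^sup>2"] cong: if_cong)
  then show "norm (axis C (c *\<^sub>R (v $ B)) :: ('v, 'm) vec) \<le> norm v * \<bar>c\<bar>"
    by (simp add: mult.commute[of "norm v"] mult_left_mono Finite_Cartesian_Product.norm_nth_le)
qed

lemma bounded_linear_lmul: "bounded_linear (lmul a :: ('v::real_normed_vector, 'n::{finite,linorder}) cmodule \<Rightarrow> _)"
  unfolding lmul_def[abs_def] by (intro bounded_linear_sum bounded_linear_axis_component)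

lemma lmul_add_left: "lmul (a + b) v = lmul a v + lmul b v"
  by (simp add: lmul_def distrib_left scaleR_left_distrib axis_add sum.distrib)

lemma lmul_scale_left: "lmul (r *\<^sub>R a) v = r *\<^sub>R lmul a v"
  by (simp add: lmul_def scaleR_sum_right axis_scaleR[symmetric] mult.left_commute)

lemma lmul_add_right: "lmul a (v + w) = lmul a v + lmul a w"
  for v w :: "('v::real_normed_vector, 'n::{finite,linorder}) cmodule"
  by (rule bounded_linear.linear[OF bounded_linear_lmul, THEN linear_add])

lemma lmul_scale_right: "lmul a (r *\<^sub>R v) = r *\<^sub>R lmul a v"
  for v :: "('v::real_normed_vector, 'n::{finite,linorder}) cmodule"
  by (rule bounded_linear.linear[OF bounded_linear_lmul, THEN linear_scale])

lemma lmul_op_apply: "blinfun_apply (lmul_op a) v = lmul a v"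
  unfolding lmul_op_def by (simp add: bounded_linear_Blinfun_apply bounded_linear_lmul)

lemma cmul_one: "cmul (ebasis {}) a = a" "cmul a (ebasis {}) = a"
  by (simp_all add: cmul_eq_lmul) (simp add: cmul_eq_rmul flip: cmul_eq_lmul)

lemma rmul_creal: "rmul v (creal r) = r *\<^sub>R v"
proof -
  have "rmul v (creal r) = r *\<^sub>R rmul v (ebasis {})"
    by (simp add: rmul_def creal_def scaleR_sum_right axis_scaleR[symmetric] mult.left_commute)
  then show ?thesis by simp
qed

lemma cmul_bilinear:
  "cmul (a + b) c = cmul a c + cmul b c" "cmul a (b + c) = cmul a b + cmul a c"
  "cmul (r *\<^sub>R a) b = r *\<^sub>R cmul a b" "cmul a (r *\<^sub>R b) = r *\<^sub>R cmul a b"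
  by (simp_all add: cmul_eq_lmul lmul_add_left lmul_add_right lmul_scale_left lmul_scale_right)

lemma cmul_sum: "cmul (sum f I) b = (\<Sum>i\<in>I. cmul (f i) b)" "cmul a (sum g I) = (\<Sum>i\<in>I. cmul a (g i))"
  by (simp_all add: cmul_eq_lmul lmul_sum_left lmul_sum_right)

lemma norm_clifford_square: "(norm a)\<^sup>2 = (\<Sum>A\<in>UNIV. (a $ A)\<^sup>2)" for a :: "'n::{finite,linorder} clifford"
  unfolding power2_norm_eq_inner inner_vec_def by (simp add: power2_eq_square)

lemma imag_unit_expand:
  fixes J :: "'n::{finite,linorder} clifford"
  assumes "J \<in> imag_units"
  shows "J = (\<Sum>i\<in>UNIV. (J $ {i}) *\<^sub>R ebasis {i})" "(\<Sum>i\<in>UNIV. (J $ {i})\<^sup>2) = 1"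
proof -
  have J: "J $ A = 0" if "\<nexists>i. A = {i}" for A
  proof (cases "A = {}")
    case False
    then have "card A \<noteq> 0" "card A \<noteq> 1" using that by (auto simp: card_1_singleton_iff)
    then have "2 \<le> card A" by linarith
    then show ?thesis using assms by (simp add: imag_units_def paravectors_def)
  qed (use assms in \<open>simp add: imag_units_def\<close>)
  show "J = (\<Sum>i\<in>UNIV. (J $ {i}) *\<^sub>R ebasis {i})"
    unfolding vec_eq_iff
  proof
    fix A
    show "J $ A = (\<Sum>i\<in>UNIV. (J $ {i}) *\<^sub>R ebasis {i}) $ A"
    proof (cases "\<exists>i. A = {i}")
      case True
      then show ?thesis by (auto simp: ebasis_def axis_def if_distrib cong: if_cong)
    qed (auto simp: J ebasis_def axis_def)
  qed
  have "(\<Sum>A\<in>UNIV. (J $ A)\<^sup>2) = (\<Sum>A\<in>range (\<lambda>i. {i}). (J $ A)\<^sup>2)"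
    by (rule sum.mono_neutral_right) (use J in auto)
  also have "\<dots> = (\<Sum>i\<in>UNIV. (J $ {i})\<^sup>2)"
    by (subst sum.reindex) (auto simp: inj_on_def)
  finally show "(\<Sum>i\<in>UNIV. (J $ {i})\<^sup>2) = 1"
    using assms norm_clifford_square[of J] by (simp add: imag_units_def)
qed

text \<open>J^2 is a double sum over generators. Adding it to its copy with exchanged indices
  removes the mixed terms by anticommutation, and the squares add up to - 2 |J|^2 = - 2.\<close>

lemma imag_unit_square:
  fixes J :: "'n::{finite,linorder} clifford"
  assumes "J \<in> imag_units"
  shows "cmul J J = - ebasis {}"
proof -
  define c where "c i = J $ {i}" for i
  define e :: "'n \<Rightarrow> 'n clifford" where "e i = ebasis {i}" for i
  have J: "J = (\<Sum>i\<in>UNIV. c i *\<^sub>R e i)" using imag_unit_expand(1)[OF assms] by (simp add: c_def e_def)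
  have JJ: "cmul J J = (\<Sum>i\<in>UNIV. \<Sum>j\<in>UNIV. (c i * c j) *\<^sub>R cmul (e i) (e j))"
  proof -
    have l: "cmul J b = (\<Sum>i\<in>UNIV. c i *\<^sub>R cmul (e i) b)" for b
      by (subst J) (simp add: cmul_sum(1) cmul_bilinear(3))
    have r: "cmul b J = (\<Sum>i\<in>UNIV. c i *\<^sub>R cmul b (e i))" for b
      by (subst J) (simp add: cmul_sum(2) cmul_bilinear(4))
    show ?thesis unfolding l unfolding r by (simp add: scaleR_sum_right)
  qed
  also have "\<dots> = (\<Sum>i\<in>UNIV. \<Sum>j\<in>UNIV. (c i * c j) *\<^sub>R cmul (e j) (e i))"
    by (subst sum.swap) (simp add: mult.commute)
  finally have JJ': "cmul J J = (\<Sum>i\<in>UNIV. \<Sum>j\<in>UNIV. (c i * c j) *\<^sub>R cmul (e j) (e i))" .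
  have "cmul J J + cmul J J = (\<Sum>i\<in>UNIV. \<Sum>j\<in>UNIV. (c i * c j) *\<^sub>R (cmul (e i) (e j) + cmul (e j) (e i)))"
    using JJ JJ' by (simp add: scaleR_add_right sum.distrib)
  also have "\<dots> = (\<Sum>i\<in>UNIV. \<Sum>j\<in>UNIV. if j = i then - (2 * (c i)\<^sup>2) *\<^sub>R ebasis {} else 0)"
  proof (intro sum.cong refl)
    fix i j
    show "(c i * c j) *\<^sub>R (cmul (e i) (e j) + cmul (e j) (e i)) = (if j = i then - (2 * (c i)\<^sup>2) *\<^sub>R ebasis {} else 0)"
      using clifford_anticommute[of i j]
      by (simp add: e_def clifford_square power2_eq_square flip: scaleR_2)
  qed
  also have "\<dots> = - (2 *\<^sub>R ebasis {})"
    using imag_unit_expand(2)[OF assms]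
    by (simp add: c_def scaleR_sum_left[symmetric] sum_negf sum_distrib_left[symmetric])
  finally have "2 *\<^sub>R cmul J J = 2 *\<^sub>R (- ebasis {})" by (simp add: scaleR_2)
  then show ?thesis by (simp only: scaleR_cancel_left) simp
qed

lemma imag_units_nonempty: "ebasis {i} \<in> imag_units"
proof -
  have "(norm (ebasis {i} :: 'a clifford))\<^sup>2 = 1"
    by (simp add: norm_clifford_square ebasis_def axis_def if_distrib[of "\<lambda>x. x\<^sup>2"] cong: if_cong)
  then have "norm (ebasis {i} :: 'a clifford) = 1" by (intro power2_eq_imp_eq[of _ 1]) simp_all
  then show ?thesis by (auto simp: imag_units_def paravectors_def ebasis_def axis_def)
qed

text \<open>The embedding of the complex numbers onto the slice of \<open>J\<close>; for
  \<open>J\<close> in \<open>imag_units\<close> it is multiplicative and isometric.\<close>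

definition slc :: "'n::{finite,linorder} clifford \<Rightarrow> complex \<Rightarrow> 'n clifford" where
  "slc J z = creal (Re z) + Im z *\<^sub>R J"

lemma slc_add: "slc J (z + w) = slc J z + slc J w"
  and slc_diff: "slc J (z - w) = slc J z - slc J w"
  and slc_scale: "slc J (complex_of_real r * z) = r *\<^sub>R slc J z"
  and slc_scaleR: "slc J (r *\<^sub>R z) = r *\<^sub>R slc J z"
  and slc_of_real: "slc J (complex_of_real r) = creal r"
  and slc_one: "slc J 1 = ebasis {}"
  and slc_zero: "slc J 0 = 0"
  and slc_ii: "slc J \<i> = J"
  by (simp_all add: slc_def creal_def algebra_simps)

lemma slc_sum: "slc J (sum f I) = (\<Sum>i\<in>I. slc J (f i))"
  by (induction I rule: infinite_finite_induct) (simp_all add: slc_add slc_zero)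

lemma cexp_slc: "cexp J \<phi> = slc J (cis \<phi>)"
  by (simp add: cexp_def slc_def)

context
  fixes J :: "'n::{finite,linorder} clifford"
  assumes J: "J \<in> imag_units"
begin

lemma slc_mult: "cmul (slc J z) (slc J w) = slc J (z * w)"
proof -
  have "cmul (slc J z) (slc J w) = (Re z * Re w) *\<^sub>R ebasis {} + (Re z * Im w) *\<^sub>R J + (Im z * Re w) *\<^sub>R J
      + (Im z * Im w) *\<^sub>R cmul J J"
    by (simp add: slc_def creal_def cmul_bilinear cmul_one algebra_simps)
  then show ?thesis
    by (simp add: imag_unit_square[OF J] slc_def creal_def algebra_simps)
qed

lemma slc_real_part: "slc J z $ {} = Re z"
  using J by (simp add: slc_def creal_def ebasis_def imag_units_def axis_def)

lemma norm_slc: "norm (slc J z) = norm z"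
proof -
  have J0: "J $ {} = 0" and nJ: "J \<bullet> J = 1"
    using J by (auto simp: imag_units_def norm_eq_1)
  have e: "ebasis {} \<bullet> J = 0" "J \<bullet> ebasis {} = 0" "ebasis {} \<bullet> (ebasis {} :: 'n clifford) = 1"
    by (simp_all add: inner_vec_def ebasis_def axis_def if_distrib[of "\<lambda>x. x * _"] if_distrib[of "\<lambda>x. _ * x"] J0 cong: if_cong)
  have "(norm (slc J z))\<^sup>2 = (Re z)\<^sup>2 + (Im z)\<^sup>2"
    unfolding power2_norm_eq_inner slc_def creal_def
    by (simp add: inner_add_left inner_add_right e nJ power2_eq_square)
  then have "(norm (slc J z))\<^sup>2 = (norm z)\<^sup>2" by (simp add: cmod_power2)
  then show ?thesis by (simp add: power2_eq_iff_nonneg)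
qed

lemma slc_eq_iff: "slc J z = slc J w \<longleftrightarrow> z = w"
  using norm_slc[of "z - w"] by (auto simp: slc_diff)

lemma slc_paravector: "slc J z \<in> paravectors"
  using J by (auto simp: slc_def creal_def ebasis_def paravectors_def imag_units_def axis_def)

lemma cconj_slc: "cconj (slc J z) = slc J (cnj z)"
  using J by (auto simp: cconj_def slc_def creal_def ebasis_def imag_units_def vec_eq_iff axis_def)

text \<open>The inverse inside the slice is two-sided in the whole algebra, and associativity makes
  such an inverse unique.\<close>

lemma cinv_slc: "z \<noteq> 0 \<Longrightarrow> cinv (slc J z) = slc J (inverse z)"
  unfolding cinv_def
proof (rule the_equality)
  assume "z \<noteq> 0"
  then show 1: "cmul (slc J z) (slc J (inverse z)) = ebasis {} \<and> cmul (slc J (inverse z)) (slc J z) = ebasis {}"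
    by (simp add: slc_mult slc_one)
  fix b assume b: "cmul (slc J z) b = ebasis {} \<and> cmul b (slc J z) = ebasis {}"
  have "b = cmul (cmul (slc J (inverse z)) (slc J z)) b" using 1 by (simp add: cmul_one)
  also have "\<dots> = slc J (inverse z)" unfolding cmul_assoc using b by (simp add: cmul_one)
  finally show "b = slc J (inverse z)" .
qed

lemma cpow_slc: "cpow (slc J z) k = slc J (z ^ k)"
  by (induction k) (simp_all add: slc_one slc_mult)

lemma cpoly_slc: "cpoly p (slc J z) = slc J (cp p z)"
proof -
  have "degree (map_poly complex_of_real p) = degree p"
    by (rule degree_map_poly) simp
  then show ?thesis
    by (simp add: cpoly_def cpow_slc poly_altdef coeff_map_poly slc_sum slc_scale)
qed

lemma cratio_slc: "cp q z \<noteq> 0 \<Longrightarrow> cratio p q (slc J z) = slc J (cp p z / cp q z)"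
  by (simp add: cratio_def cpoly_slc cinv_slc slc_mult divide_inverse)

lemma lmul_slc: "lmul (slc J z) v = Re z *\<^sub>R v + Im z *\<^sub>R lmul J v"
  by (simp add: slc_def creal_def lmul_add_left lmul_scale_left)

end

section \<open>Bisectorial operators\<close>

lemma angle_sector:
  assumes "0 < \<theta>" "\<theta> < pi / 2" "\<phi> \<in> angles \<theta>"
  shows "\<bar>sin \<phi>\<bar> < tan \<theta> * \<bar>cos \<phi>\<bar>"
proof -
  have *: "\<bar>sin a\<bar> < tan \<theta> * \<bar>cos a\<bar>" if "- \<theta> < a" "a < \<theta>" for a
  proof -
    have "sin \<bar>a\<bar> < tan \<theta> * cos \<bar>a\<bar>" using that assms(1,2) by (intro sin_less_tan_cos) auto
    moreover have "0 \<le> sin \<bar>a\<bar>" using that assms(1,2) by (intro sin_ge_zero) auto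
    moreover have "0 < cos a" using that assms(1,2) by (intro cos_gt_zero_pi) auto
    ultimately show ?thesis by (cases "0 \<le> a") auto
  qed
  show ?thesis
    using assms(3) *[of \<phi>] *[of "\<phi> - pi"] by (auto simp: angles_def sin_diff cos_diff)
qed

text \<open>The point may be given through a unit J' other than J. Real part and norm are
  insensitive to this, and they determine |Im z|.\<close>

lemma dsector_csec:
  assumes J: "J \<in> imag_units" and \<theta>: "0 < \<theta>" "\<theta> < pi / 2" and "slc J z \<in> dsector \<theta>"
  shows "z \<in> csec \<theta>"
proof -
  obtain r J' \<phi> where r: "0 < r" "J' \<in> imag_units" "\<phi> \<in> angles \<theta>" and eq: "slc J z = r *\<^sub>R slc J' (cis \<phi>)"
    using assms(4) by (auto simp: dsector_def cexp_slc)
  have eq': "slc J z = slc J' (r *\<^sub>R cis \<phi>)" using eq by (simp add: slc_scaleR)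
  have Re: "Re z = r * cos \<phi>"
    using arg_cong[OF eq', of "\<lambda>s. s $ {}"] by (simp add: slc_real_part J r)
  have "norm z = r"
    using arg_cong[OF eq', of norm] r by (simp add: norm_slc J)
  then have "(Im z)\<^sup>2 = (r * sin \<phi>)\<^sup>2"
    using cmod_power2[of z] Re by (simp add: power_mult_distrib sin_squared_eq algebra_simps)
  then have "\<bar>Im z\<bar> = r * \<bar>sin \<phi>\<bar>"
    using r by (simp add: power2_eq_iff abs_mult) (metis abs_minus_cancel abs_mult abs_of_pos)
  then show ?thesis
    using angle_sector[OF \<theta> r(3)] r(1) by (simp add: csec_def Re abs_mult mult.left_commute)
qed

lemma csec_dsector:
  assumes J: "J \<in> imag_units" and \<theta>: "0 < \<theta>" "\<theta> < pi / 2" and z: "z \<in> csec \<theta>"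
  shows "slc J z \<in> dsector \<theta>"
proof -
  have right: "\<exists>r>0. \<exists>a. - \<theta> < a \<and> a < \<theta> \<and> z = r *\<^sub>R cis a" if "z \<in> csec \<theta>" "0 < Re z" for z
  proof (intro exI conjI)
    define m where "m = Im z / Re z"
    have m: "\<bar>m\<bar> < tan \<theta>" using that by (simp add: m_def csec_def abs_divide pos_divide_less_eq)
    have at: "arctan (tan \<theta>) = \<theta>" using \<theta> by (simp add: arctan_tan)
    show "arctan m < \<theta>" using m arctan_less_iff[of m "tan \<theta>"] at by auto
    show "- \<theta> < arctan m" using m arctan_less_iff[of "- m" "tan \<theta>"] at by (auto simp: arctan_minus)
    have s: "0 < sqrt (1 + m\<^sup>2)" by (simp add: add_pos_nonneg)
    then show "0 < Re z * sqrt (1 + m\<^sup>2)" using that by simp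
    show "z = (Re z * sqrt (1 + m\<^sup>2)) *\<^sub>R cis (arctan m)"
      using s that by (simp add: complex_eq_iff cos_arctan sin_arctan m_def)
  qed
  show ?thesis
  proof (cases "0 < Re z")
    case True
    from right[OF z this] obtain r a where "0 < r" "- \<theta> < a" "a < \<theta>" "z = r *\<^sub>R cis a" by blast
    then have "slc J z = r *\<^sub>R cexp J a" "a \<in> angles \<theta>"
      by (auto simp: cexp_slc slc_scaleR angles_def)
    then show ?thesis unfolding dsector_def using \<open>0 < r\<close> J by blast
  next
    case False
    then have "0 < Re (- z)" using z by (cases "Re z = 0") (auto simp: csec_def)
    with right[of "- z"] z csec_uminus obtain r a where ra: "0 < r" "- \<theta> < a" "a < \<theta>" "- z = r *\<^sub>R cis a" by blast
    then have "z = - (r *\<^sub>R cis a)" by (simp add: minus_equation_iff[of z])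
    also have "\<dots> = r *\<^sub>R cis (a + pi)" by (simp add: complex_eq_iff)
    finally have "slc J z = r *\<^sub>R cexp J (a + pi)" by (simp add: cexp_slc slc_scaleR)
    moreover have "a + pi \<in> angles \<theta>" using ra by (auto simp: angles_def)
    ultimately show ?thesis unfolding dsector_def using \<open>0 < r\<close> J by blast
  qed
qed

lemma dsector_cases:
  assumes "0 < \<theta>" "\<theta> < pi / 2" "s \<in> dsector \<theta>"
  obtains J z where "J \<in> imag_units" "z \<in> csec \<theta>" "s = slc J z"
proof -
  obtain r J \<phi> where "J \<in> imag_units" and s: "s = r *\<^sub>R cexp J \<phi>"
    using assms(3) by (auto simp: dsector_def)
  then have "s = slc J (r *\<^sub>R cis \<phi>)" by (simp add: cexp_slc slc_scaleR)
  with dsector_csec[OF \<open>J \<in> imag_units\<close> assms(1,2)] assms(3) \<open>J \<in> imag_units\<close> show ?thesis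
    by (intro that[of J "r *\<^sub>R cis \<phi>"]) auto
qed

lemma continuous_slc: "continuous_on A (slc J)"
  unfolding slc_def creal_def by (intro continuous_intros)

text \<open>The origin is approached along the positive axis, every other point by shrinking its
  imaginary part.\<close>

lemma slc_in_closure:
  assumes J: "J \<in> imag_units" and \<theta>: "0 < \<theta>" "\<theta> < pi / 2" and z: "z \<in> csec_closure \<theta>"
  shows "slc J z \<in> closure (dsector \<theta>)"
proof -
  have tan: "0 < tan \<theta>" using \<theta> by (intro tan_gt_zero) auto
  have "z \<in> closure (csec \<theta>)"
  proof (cases "Re z = 0")
    case True
    then have "z = 0" using z by (simp add: csec_closure_def complex_eq_iff)
    have "(\<lambda>n. complex_of_real (inverse (real (Suc n)))) \<longlonglongrightarrow> complex_of_real 0"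
      by (intro tendsto_of_real LIMSEQ_inverse_real_of_nat)
    moreover have "complex_of_real (inverse (real (Suc n))) \<in> csec \<theta>" for n
      using tan by (simp add: csec_def del: of_nat_Suc of_real_inverse)
    ultimately show ?thesis unfolding closure_sequential \<open>z = 0\<close> by (intro exI conjI allI) auto
  next
    case False
    let ?x = "\<lambda>n. Complex (Re z) (Im z * (1 - inverse (real (Suc n))))"
    have "(\<lambda>n. Im z * (1 - inverse (real (Suc n)))) \<longlonglongrightarrow> Im z * (1 - 0)"
      by (intro tendsto_intros LIMSEQ_inverse_real_of_nat)
    then have "?x \<longlonglongrightarrow> z" by (simp add: tendsto_complex_iff)
    moreover have "?x n \<in> csec \<theta>" for n
    proof (cases "Im z = 0")
      case True then show ?thesis using tan False by (simp add: csec_def)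
    next
      case Im: False
      have "0 \<le> 1 - inverse (real (Suc n))" "1 - inverse (real (Suc n)) < 1"
        by (simp_all add: field_simps)
      then have "\<bar>Im z\<bar> * \<bar>1 - inverse (real (Suc n))\<bar> < \<bar>Im z\<bar> * 1"
        using Im by (intro mult_strict_left_mono) auto
      then show ?thesis using z by (simp add: csec_def csec_closure_def abs_mult del: of_nat_Suc)
    qed
    ultimately show ?thesis unfolding closure_sequential by (intro exI[of _ ?x]) simp
  qed
  then have "slc J z \<in> slc J ` closure (csec \<theta>)" by blast
  also have "\<dots> \<subseteq> closure (slc J ` csec \<theta>)"
    by (rule image_closure_subset[OF continuous_slc closed_closure closure_subset])
  also have "\<dots> \<subseteq> closure (dsector \<theta>)"
    using csec_dsector[OF J \<theta>] by (intro closure_mono) auto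
  finally show ?thesis .
qed

text \<open>\<open>P\<close> describes the closed sector by norm and real part alone: a closed
  condition without reference to an imaginary unit.\<close>

lemma closure_dsector:
  assumes J: "J \<in> imag_units" and \<theta>: "0 < \<theta>" "\<theta> < pi / 2" and "slc J z \<in> closure (dsector \<theta>)"
  shows "z \<in> csec_closure \<theta>"
proof -
  have tan: "0 < tan \<theta>" using \<theta> by (intro tan_gt_zero) auto
  define P where "P = (\<lambda>s::'a clifford. (norm s)\<^sup>2 - (s $ {})\<^sup>2 \<le> (tan \<theta> * \<bar>s $ {}\<bar>)\<^sup>2)"
  have P: "P (slc I w) \<longleftrightarrow> w \<in> csec_closure \<theta>" if "I \<in> imag_units" for I w
  proof -
    have "P (slc I w) \<longleftrightarrow> \<bar>Im w\<bar>\<^sup>2 \<le> (tan \<theta> * \<bar>Re w\<bar>)\<^sup>2"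
      by (simp add: P_def norm_slc[OF that] slc_real_part[OF that] cmod_power2)
    also have "\<dots> \<longleftrightarrow> \<bar>Im w\<bar> \<le> tan \<theta> * \<bar>Re w\<bar>"
      using tan by (intro power_mono_iff) auto
    finally show ?thesis by (simp add: csec_closure_def)
  qed
  have "dsector \<theta> \<subseteq> Collect P"
  proof
    fix s :: "'a clifford" assume "s \<in> dsector \<theta>"
    then show "s \<in> Collect P"
      using dsector_cases[OF \<theta>] P csec_subset_closure[of \<theta>] by (metis mem_Collect_eq subsetD)
  qed
  moreover have "closed (Collect P)"
    unfolding P_def by (intro closed_Collect_le continuous_intros)
  ultimately have "closure (dsector \<theta>) \<subseteq> Collect P" by (rule closure_minimal)
  then show ?thesis using assms(4) P[OF J] by blast
qed

locale bisector =
  fixes T :: "('v::banach, 'n::{finite,linorder}) cmodule \<rightharpoonup> ('v, 'n) cmodule" and \<omega> :: real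
  assumes omega: "0 < \<omega>" "\<omega> < pi / 2" and closed: "closed_op T" and bisectorial: "bisectorial \<omega> T"
begin

lemma right_linear_T: "right_linear T"
  using closed by (simp add: closed_op_def)

sublocale linear_partial T
proof
  show "0 \<in> dom T" "\<And>v w. v \<in> dom T \<Longrightarrow> w \<in> dom T \<Longrightarrow> T (v + w) = Some (the (T v) + the (T w))"
    using right_linear_T unfolding right_linear_def by blast+
  show "T (r *\<^sub>R v) = Some (r *\<^sub>R the (T v))" if "v \<in> dom T" for v r
  proof -
    have "T (rmul v (creal r)) = Some (rmul (the (T v)) (creal r))"
      using right_linear_T that unfolding right_linear_def by blast
    then show ?thesis by (simp add: rmul_creal)
  qed
qed

lemma bounded_op_apply:
  assumes "bounded_op (F :: ('v, 'n) cmodule \<rightharpoonup> ('v, 'n) cmodule)"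
  shows "blinfun_apply (to_blinfun F) v = the (F v)"
proof -
  have F: "right_linear F" "dom F = UNIV" using assms by (auto simp: bounded_op_def)
  obtain C where C: "\<And>v. norm (the (F v)) \<le> C * norm v" using assms by (auto simp: bounded_op_def)
  have "bounded_linear (\<lambda>v. the (F v))"
  proof (rule bounded_linear_intro[of _ C])
    show "the (F (v + w)) = the (F v) + the (F w)" for v w
      using F unfolding right_linear_def by auto
    show "the (F (r *\<^sub>R v)) = r *\<^sub>R the (F v)" for r v
    proof -
      have "F (rmul v (creal r)) = Some (rmul (the (F v)) (creal r))"
        using F unfolding right_linear_def by blast
      then show ?thesis by (simp add: rmul_creal)
    qed
  qed (use C in \<open>simp add: mult.commute\<close>)
  then show ?thesis by (simp add: to_blinfun_def bounded_linear_Blinfun_apply)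
qed

definition Z :: "complex set" where "Z = - csec_closure \<omega>"

definition R :: "complex \<Rightarrow> ('v, 'n) cmodule \<Rightarrow>\<^sub>L ('v, 'n) cmodule" where
  "R z = to_blinfun (op_inv (poly_op (qp z) T))"

text \<open>T R z as a bounded operator. \<open>Blinfun\<close> is meaningful here only once
  boundedness is known; that comes from the S-resolvent.\<close>

definition S :: "complex \<Rightarrow> ('v, 'n) cmodule \<Rightarrow>\<^sub>L ('v, 'n) cmodule" where
  "S z = Blinfun (\<lambda>v. A (R z v))"

lemma Q_op_slc: "J \<in> imag_units \<Longrightarrow> Q_op (slc J z) T = poly_op (qp z) T"
  by (simp add: Q_op_def qp_def norm_slc slc_real_part)

lemma bounded_op_R:
  assumes "z \<in> Z"
  shows "bounded_op (op_inv (poly_op (qp z) T))"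
proof -
  \<comment> \<open>Any imaginary unit serves; the index type is nonempty, so there is at least one
    generator.\<close>
  define J :: "'n clifford" where "J = ebasis {undefined}"
  have J: "J \<in> imag_units" unfolding J_def by (rule imag_units_nonempty)
  have "slc J z \<notin> closure (dsector \<omega>)"
    using closure_dsector[OF J omega] assms by (auto simp: Z_def)
  then have "slc J z \<in> S_resolvent_set T"
    using bisectorial slc_paravector[OF J] unfolding bisectorial_def S_spectrum_def by blast
  then show ?thesis by (simp add: S_resolvent_set_def Q_op_slc[OF J])
qed

lemma R_inverts:
  assumes "z \<in> Z"
  shows "inverts (R z) (qp z)"
proof -
  let ?Q = "poly_op (qp z) T"
  have dom: "dom (op_inv ?Q) = UNIV"
    using bounded_op_R[OF assms] by (simp add: bounded_op_def)
  have ex: "\<exists>!v. ?Q v = Some w" for w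
  proof (rule ccontr)
    assume "\<not> ?thesis"
    then have "op_inv ?Q w = None" by (simp add: op_inv_def)
    then show False using dom by (metis UNIV_I domIff)
  qed
  have R: "R z w = (THE v. ?Q v = Some w)" for w
    using ex[of w] by (simp add: R_def bounded_op_apply[OF bounded_op_R[OF assms]] op_inv_def)
  have QR: "?Q (R z w) = Some w" for w
    unfolding R by (rule theI'[OF ex])
  show ?thesis
    unfolding inverts_def
  proof (intro conjI allI ballI)
    fix v
    show "R z v \<in> D (degree (qp z))" "pev (qp z) (R z v) = v"
      using QR[of v] by (auto simp: poly_op_pev split: if_splits)
  next
    fix u assume "u \<in> D (degree (qp z))"
    then have "?Q u = Some (pev (qp z) u)" by (simp add: poly_op_pev)
    then show "R z (pev (qp z) u) = u" using ex QR by blast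
  qed
qed

text \<open>The definition of the S-resolvent is solved for T Q^-1. The right-hand side is bounded,
  so \<open>S z\<close> really is the operator T R z.\<close>

lemma SL_res_slc:
  assumes J: "J \<in> imag_units" and z: "z \<in> Z" and b: "bounded_op (SL_res (slc J z) T)"
  shows "S z = (R z o\<^sub>L lmul_op (slc J (cnj z))) - to_blinfun (SL_res (slc J z) T)"
    and "S z v = A (R z v)"
proof -
  let ?Q = "op_inv (poly_op (qp z) T)"
  have Rd: "R z v \<in> dom T" for v
    using R_inverts[OF z] unfolding inverts_def degree_qp by (auto simp: numeral_2_eq_2 D_Suc)
  have Q: "?Q v = Some (R z v)" for v by (rule op_inv_inverts[OF R_inverts[OF z]])
  have "SL_res (slc J z) T v = Some (R z (lmul (slc J (cnj z)) v) - A (R z v))" for v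
    using Rd[of v] by (auto simp: SL_res_def Q_op_slc[OF J] cconj_slc[OF J] op_minus_def op_rmul_def map_comp_def Q A_def dom_def)
  then have eq: "A (R z v) = blinfun_apply ((R z o\<^sub>L lmul_op (slc J (cnj z))) - to_blinfun (SL_res (slc J z) T)) v" for v
    by (simp add: blinfun.diff_left bounded_op_apply[OF b] lmul_op_apply)
  show 1: "S z = (R z o\<^sub>L lmul_op (slc J (cnj z))) - to_blinfun (SL_res (slc J z) T)"
    unfolding S_def eq by (simp add: blinfun_apply_inverse)
  show "S z v = A (R z v)" unfolding eq 1 ..
qed

lemma outside_dsector:
  assumes J: "J \<in> imag_units" and \<phi>: "\<omega> < \<phi>" "\<phi> < pi / 2" and z: "z \<noteq> 0" "tan \<phi> * \<bar>Re z\<bar> \<le> \<bar>Im z\<bar>"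
  shows "slc J z \<in> paravectors - (dsector \<phi> \<union> {0})" "z \<in> Z"
proof -
  have "slc J z \<notin> dsector \<phi>"
    using dsector_csec[OF J, of \<phi> z] \<phi> omega z(2) by (auto simp: csec_def)
  moreover have "slc J z \<noteq> 0" using slc_eq_iff[OF J, of z 0] z(1) by (simp add: slc_zero)
  ultimately show "slc J z \<in> paravectors - (dsector \<phi> \<union> {0})"
    using slc_paravector[OF J] by simp
  have "tan \<omega> < tan \<phi>" using \<phi> omega by (intro tan_monotone) auto
  show "z \<in> Z"
  proof (cases "Re z = 0")
    case True
    then have "Im z \<noteq> 0" using z(1) by (simp add: complex_eq_iff)
    then show ?thesis using True by (simp add: Z_def csec_closure_def)
  next
    case False
    then have "tan \<omega> * \<bar>Re z\<bar> < tan \<phi> * \<bar>Re z\<bar>" using \<open>tan \<omega> < tan \<phi>\<close> by simp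
    then show ?thesis using z(2) by (simp add: Z_def csec_closure_def)
  qed
qed

lemma SL_bounds:
  assumes "\<omega> < \<phi>" "\<phi> < pi / 2"
  obtains B where "0 \<le> B" "\<And>J z. J \<in> imag_units \<Longrightarrow> z \<noteq> 0 \<Longrightarrow> tan \<phi> * \<bar>Re z\<bar> \<le> \<bar>Im z\<bar> \<Longrightarrow>
    bounded_op (SL_res (slc J z) T) \<and> norm (to_blinfun (SL_res (slc J z) T)) \<le> B / norm z"
proof -
  have "\<phi> \<in> {\<omega><..<pi/2}" using assms by simp
  then obtain B where B: "0 \<le> B" "\<And>s. s \<in> paravectors - (dsector \<phi> \<union> {0}) \<Longrightarrow>
      bounded_op (SL_res s T) \<and> norm (to_blinfun (SL_res s T)) \<le> B / norm s"
    using bisectorial unfolding bisectorial_def by blast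
  show ?thesis
    by (rule that[OF B(1)]) (use B(2)[OF outside_dsector(1)[OF _ assms]] norm_slc in metis)
qed

text \<open>Bisectoriality controls the S-resolvent only outside sectors of angle larger than
  \<omega>; the strict inequality that defines \<open>Z\<close> leaves room for one of them.\<close>

lemma Z_intermediate:
  assumes "z \<in> Z"
  obtains \<phi> where "\<omega> < \<phi>" "\<phi> < pi / 2" "z \<noteq> 0" "tan \<phi> * \<bar>Re z\<bar> \<le> \<bar>Im z\<bar>"
proof -
  have tan: "0 < tan \<omega>" using omega by (intro tan_gt_zero) auto
  have z: "tan \<omega> * \<bar>Re z\<bar> < \<bar>Im z\<bar>" "z \<noteq> 0" using assms by (auto simp: Z_def csec_closure_def)
  have "((\<lambda>\<phi>. tan \<phi> * \<bar>Re z\<bar>) \<longlongrightarrow> tan \<omega> * \<bar>Re z\<bar>) (at_right \<omega>)"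
    using cos_gt_zero_pi[of \<omega>] omega by (intro tendsto_intros) auto
  then have "\<forall>\<^sub>F \<phi> in at_right \<omega>. tan \<phi> * \<bar>Re z\<bar> < \<bar>Im z\<bar>"
    using z(1) by (rule order_tendstoD)
  moreover have "\<forall>\<^sub>F \<phi> in at_right \<omega>. \<phi> \<in> {\<omega><..<pi/2}"
    using omega by (intro eventually_at_right_real)
  ultimately have "\<exists>\<phi>. tan \<phi> * \<bar>Re z\<bar> < \<bar>Im z\<bar> \<and> \<phi> \<in> {\<omega><..<pi/2}"
    by (intro eventually_happens'[OF _ eventually_conj]) auto
  then show ?thesis using that z(2) by fastforce
qed

lemma S_apply: "z \<in> Z \<Longrightarrow> S z v = A (R z v)"
proof -
  assume z: "z \<in> Z"
  from Z_intermediate[OF this] obtain \<phi> where \<phi>: "\<omega> < \<phi>" "\<phi> < pi / 2" "z \<noteq> 0" "tan \<phi> * \<bar>Re z\<bar> \<le> \<bar>Im z\<bar>" .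
  show ?thesis
    by (rule SL_bounds[OF \<phi>(1,2)]) (rule SL_res_slc(2)[OF imag_units_nonempty z], use \<phi> imag_units_nonempty in blast)
qed

sublocale op_resolvent T R S Z
proof
  show "w \<in> Z \<Longrightarrow> inverts (R w) (qp w)" for w by (rule R_inverts)
  show "w \<in> Z \<Longrightarrow> S w v = A (R w v)" for w v by (rule S_apply)
  show RR: "R (cnj w) = R w" for w by (simp add: R_def qp_cnj)
  show "S (cnj w) = S w" for w by (simp add: S_def RR)
qed

end

section \<open>Reduction of the calculus to real form\<close>

lemma has_integral_reflect_UNIV:
  fixes f :: "real \<Rightarrow> 'a::banach"
  assumes "(f has_integral i) UNIV"
  shows "((\<lambda>x. f (- x)) has_integral i) UNIV"
proof (subst has_integral', intro allI impI)
  fix e :: real assume "0 < e"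
  from iffD1[OF has_integral' assms, rule_format, OF this]
  obtain B where "0 < B" and B: "\<And>a b. ball 0 B \<subseteq> cbox a b \<Longrightarrow>
      \<exists>z. (f has_integral z) (cbox a b) \<and> norm (z - i) < e"
    by auto
  show "\<exists>B>0. \<forall>a b. ball 0 B \<subseteq> cbox a b \<longrightarrow>
      (\<exists>z. ((\<lambda>x. if x \<in> UNIV then f (- x) else 0) has_integral z) (cbox a b) \<and> norm (z - i) < e)"
  proof (intro exI[of _ B] conjI allI impI \<open>0 < B\<close>)
    fix a b :: real assume sub: "ball 0 B \<subseteq> cbox a b"
    have "ball 0 B \<subseteq> cbox (- b) (- a)"
    proof
      fix x :: real assume "x \<in> ball 0 B"
      then have "- x \<in> ball 0 B" by (simp add: dist_norm)
      then have "- x \<in> cbox a b" using sub by blast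
      then show "x \<in> cbox (- b) (- a)" by auto
    qed
    from B[OF this] obtain z where z: "(f has_integral z) (cbox (- b) (- a))" "norm (z - i) < e" by auto
    from has_integral_reflect_lemma[OF z(1)] z(2)
    show "\<exists>z. ((\<lambda>x. if x \<in> UNIV then f (- x) else 0) has_integral z) (cbox a b) \<and> norm (z - i) < e" by auto
  qed
qed

text \<open>The paths of the calculus are parametrized over the whole line, one conjugate ray on
  each half; this brings both to the same half-line.\<close>

lemma has_integral_fold:
  fixes f :: "real \<Rightarrow> 'a::banach"
  assumes p: "(f has_integral i) {0..}" and m: "((\<lambda>t. f (- t)) has_integral j) {0..}"
  shows "(f has_integral (i + j)) UNIV"
proof -
  have "((\<lambda>t. if t \<in> {0..} then f (- t) else 0) has_integral j) UNIV"
    using m by (simp only: has_integral_restrict_UNIV)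
  from has_integral_reflect_UNIV[OF this]
  have "((\<lambda>t. if t \<in> {..0} then f t else 0) has_integral j) UNIV" by (simp cong: if_cong)
  then have "(f has_integral j) {..0}" by (simp only: has_integral_restrict_UNIV)
  moreover have "{0..} \<inter> {..0::real} = {0}" "{0..} \<union> {..0::real} = UNIV" by auto
  ultimately show ?thesis
    using has_integral_Un[OF p, of j "{..0}"] by simp
qed

text \<open>The S-resolvents P and P' at s and at its conjugate share the term T Q^-1, so P - P' is
  R z composed with left multiplication by - 2 Im z J. Since J^2 = - 1, this gives 2 Im z R z = (P -
  P') J, and |Im z| is at least sin \<phi> |z| outside the sector. The bound for \<open>S\<close>
  follows by solving for T Q^-1.\<close>

lemma (in bisector) resolvent_bounds:
  assumes \<phi>: "\<omega> < \<phi>" "\<phi> < pi / 2"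
  obtains K where "\<And>z. z \<noteq> 0 \<Longrightarrow> tan \<phi> * \<bar>Re z\<bar> \<le> \<bar>Im z\<bar> \<Longrightarrow>
    norm (R z) \<le> K / (norm z)\<^sup>2 \<and> norm (S z) \<le> K / norm z"
proof -
  define J :: "'n clifford" where "J = ebasis {undefined}"
  have J: "J \<in> imag_units" unfolding J_def by (rule imag_units_nonempty)
  define L where "L = (lmul_op J :: ('v, 'n) cmodule \<Rightarrow>\<^sub>L _)"
  have s0: "0 < sin \<phi>" using \<phi> omega by (intro sin_gt_zero) auto
  have c0: "0 < cos \<phi>" using \<phi> omega by (intro cos_gt_zero_pi) auto
  obtain B where B: "0 \<le> B" "\<And>J z. J \<in> imag_units \<Longrightarrow> z \<noteq> 0 \<Longrightarrow> tan \<phi> * \<bar>Re z\<bar> \<le> \<bar>Im z\<bar> \<Longrightarrow>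
    bounded_op (SL_res (slc J z) T) \<and> norm (to_blinfun (SL_res (slc J z) T)) \<le> B / norm z"
    using SL_bounds[OF \<phi>] by blast
  have LL: "L (L v) = - v" for v
  proof -
    have "L (L v) = lmul (cmul J J) v" by (simp add: L_def lmul_op_apply lmul_assoc)
    also have "\<dots> = lmul ((- 1) *\<^sub>R ebasis {}) v" by (simp add: imag_unit_square[OF J])
    finally show ?thesis by (simp only: lmul_scale_left) simp
  qed
  define K1 where "K1 = B * norm L / sin \<phi>"
  define K where "K = K1 * (1 + norm L) + B + K1"
  have K1: "0 \<le> K1" using B(1) s0 by (simp add: K1_def)
  have "norm (R z) \<le> K / (norm z)\<^sup>2 \<and> norm (S z) \<le> K / norm z"
    if z: "z \<noteq> 0" "tan \<phi> * \<bar>Re z\<bar> \<le> \<bar>Im z\<bar>" for z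
  proof -
    have zZ: "z \<in> Z" and zZ': "cnj z \<in> Z"
      using outside_dsector(2)[OF J \<phi>, of z] outside_dsector(2)[OF J \<phi>, of "cnj z"] z by auto
    define P P' where "P = to_blinfun (SL_res (slc J z) T)" and "P' = to_blinfun (SL_res (slc J (cnj z)) T)"
    have b: "bounded_op (SL_res (slc J z) T)" "norm P \<le> B / norm z"
      and b': "bounded_op (SL_res (slc J (cnj z)) T)" "norm P' \<le> B / norm z"
      using B(2)[OF J, of z] B(2)[OF J, of "cnj z"] z by (auto simp: P_def P'_def)
    have S1: "S z = (R z o\<^sub>L lmul_op (slc J (cnj z))) - P"
      unfolding P_def by (rule SL_res_slc(1)[OF J zZ b(1)])
    have S2: "S z = (R z o\<^sub>L lmul_op (slc J z)) - P'"
      using SL_res_slc(1)[OF J zZ' b'(1)] by (simp add: P'_def R_cnj S_cnj)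
    have "(2 * Im z) *\<^sub>R R z = ((P - P') o\<^sub>L L)"
    proof (rule blinfun_eqI)
      fix v
      have "S z u = R z (lmul (slc J (cnj z)) u) - P u" for u
        by (subst S1) (simp add: blinfun.diff_left lmul_op_apply)
      moreover have "S z u = R z (lmul (slc J z) u) - P' u" for u
        by (subst S2) (simp add: blinfun.diff_left lmul_op_apply)
      ultimately have "R z (lmul (slc J (cnj z)) (L v)) - P (L v) = R z (lmul (slc J z) (L v)) - P' (L v)"
        by metis
      then have "P (L v) - P' (L v) = R z (lmul (slc J (cnj z)) (L v) - lmul (slc J z) (L v))"
        by (simp add: blinfun.diff_right algebra_simps)
      also have "lmul (slc J (cnj z)) (L v) - lmul (slc J z) (L v) = (2 * Im z) *\<^sub>R v"
      proof -
        have "lmul J (L v) = - v" using LL[of v] unfolding L_def lmul_op_apply .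
        then show ?thesis by (simp add: lmul_slc[OF J] flip: scaleR_2)
      qed
      finally show "((2 * Im z) *\<^sub>R R z) v = ((P - P') o\<^sub>L L) v"
        by (simp add: blinfun.bilinear_simps)
    qed
    then have "norm ((2 * Im z) *\<^sub>R R z) \<le> norm (P - P') * norm L"
      using norm_blinfun_compose[of "P - P'" L] by simp
    also have "\<dots> \<le> (B / norm z + B / norm z) * norm L"
      by (intro mult_right_mono order_trans[OF norm_triangle_ineq4] add_mono b b') auto
    finally have "\<bar>Im z\<bar> * norm (R z) \<le> B * norm L / norm z"
      by (simp add: abs_mult)
    moreover have Im: "sin \<phi> * norm z \<le> \<bar>Im z\<bar>"
    proof -
      have "sin \<phi> * \<bar>Re z\<bar> \<le> cos \<phi> * \<bar>Im z\<bar>"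
        using mult_left_mono[OF z(2), of "cos \<phi>"] c0 by (simp add: tan_def)
      then have "(sin \<phi> * \<bar>Re z\<bar>)\<^sup>2 \<le> (cos \<phi> * \<bar>Im z\<bar>)\<^sup>2"
        using s0 by (intro power_mono) auto
      then have "(sin \<phi> * norm z)\<^sup>2 \<le> \<bar>Im z\<bar>\<^sup>2"
        by (simp add: power_mult_distrib cmod_power2 cos_squared_eq algebra_simps)
      then show ?thesis by (rule power2_le_imp_le) simp
    qed
    ultimately have "(sin \<phi> * norm z) * norm (R z) \<le> B * norm L / norm z"
      using mult_right_mono[OF Im norm_ge_zero[of "R z"]] by linarith
    then have R: "norm (R z) \<le> K1 / (norm z)\<^sup>2"
      using z(1) s0 by (simp add: K1_def field_simps power2_eq_square)
    have "norm (lmul_op (slc J (cnj z)) :: ('v, 'n) cmodule \<Rightarrow>\<^sub>L _) \<le> norm z * (1 + norm L)"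
    proof -
      have "lmul_op (slc J (cnj z)) = Re z *\<^sub>R id_blinfun - Im z *\<^sub>R L"
        by (rule blinfun_eqI) (simp add: lmul_op_apply lmul_slc[OF J] L_def blinfun.bilinear_simps)
      then have "norm (lmul_op (slc J (cnj z)) :: ('v, 'n) cmodule \<Rightarrow>\<^sub>L _) \<le> norm (Re z *\<^sub>R (id_blinfun :: ('v, 'n) cmodule \<Rightarrow>\<^sub>L _)) + norm (Im z *\<^sub>R L)"
        by (simp only: norm_triangle_ineq4)
      also have "\<dots> \<le> norm z * 1 + norm z * norm L"
        by (intro add_mono norm_scaleR_le abs_Re_le_cmod abs_Im_le_cmod order_refl)
          (rule norm_blinfun_bound; simp)
      finally show ?thesis by (simp add: algebra_simps)
    qed
    with R have "norm (R z o\<^sub>L lmul_op (slc J (cnj z))) \<le> K1 / (norm z)\<^sup>2 * (norm z * (1 + norm L))"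
      using K1 by (intro order_trans[OF norm_blinfun_compose] mult_mono) auto
    then have "norm (S z) \<le> K1 / (norm z)\<^sup>2 * (norm z * (1 + norm L)) + B / norm z"
      unfolding S1 using b(2) by (intro order_trans[OF norm_triangle_ineq4] add_mono)
    also have "\<dots> = (K1 * (1 + norm L) + B) / norm z"
      using z(1) by (simp add: field_simps power2_eq_square)
    also have "\<dots> \<le> K / norm z"
      using K1 by (intro divide_right_mono) (auto simp: K_def)
    finally have "norm (S z) \<le> K / norm z" .
    moreover have "K1 \<le> K" using K1 B(1) by (simp add: K_def)
    then have "norm (R z) \<le> K / (norm z)\<^sup>2"
      using R by (meson divide_right_mono order_trans zero_le_power2)
    ultimately show ?thesis by blast
  qed
  then show ?thesis using that by blast
qed

lemma (in bisector) sector_op_exists: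
  assumes \<phi>: "\<omega> < \<phi>" "\<phi> < pi / 2"
  shows "\<exists>K. sector_op T R S Z \<phi> K"
proof -
  obtain K where K: "\<And>z. z \<noteq> 0 \<Longrightarrow> tan \<phi> * \<bar>Re z\<bar> \<le> \<bar>Im z\<bar> \<Longrightarrow>
    norm (R z) \<le> K / (norm z)\<^sup>2 \<and> norm (S z) \<le> K / norm z"
    using resolvent_bounds[OF \<phi>] by blast
  have "sector_resolvent R S Z \<phi> K"
  proof
    show "0 < \<phi>" "\<phi> < pi / 2" using \<phi> omega by auto
    show "z \<in> Z" if "z \<noteq> 0" "tan \<phi> * \<bar>Re z\<bar> \<le> \<bar>Im z\<bar>" for z
      using outside_dsector(2)[OF imag_units_nonempty \<phi> that] .
  qed (use K in auto)
  then show ?thesis using op_resolvent_axioms by (auto simp: sector_op_def)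
qed

locale bisector_ray = bisector T \<omega> + sector_op T R S Z \<phi> K
  for T :: "('v::banach, 'n::{finite,linorder}) cmodule \<rightharpoonup> ('v, 'n) cmodule" and \<omega> \<phi> K :: real +
  fixes J :: "'n clifford"
  assumes \<phi>_gt: "\<omega> < \<phi>" and J: "J \<in> imag_units"
begin

definition lm :: "complex \<Rightarrow> ('v, 'n) cmodule \<Rightarrow>\<^sub>L ('v, 'n) cmodule" where
  "lm z = lmul_op (slc J z)"

lemma lm_eq: "lm z = Re z *\<^sub>R id_blinfun + Im z *\<^sub>R lmul_op J"
  unfolding lm_def by (rule blinfun_eqI) (simp add: lmul_op_apply lmul_slc[OF J] blinfun.bilinear_simps)

lemma lm_mult: "(lm z o\<^sub>L lm w) = lm (z * w)"
  unfolding lm_def by (rule blinfun_eqI) (simp add: lmul_op_apply slc_mult[OF J, symmetric] lmul_assoc)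

lemma norm_lm: "norm (lm z) \<le> norm z * (1 + norm (lmul_op J :: ('v, 'n) cmodule \<Rightarrow>\<^sub>L _))"
proof -
  have "norm (lm z) \<le> norm z * 1 + norm z * norm (lmul_op J :: ('v, 'n) cmodule \<Rightarrow>\<^sub>L _)"
    unfolding lm_eq
    by (intro order_trans[OF norm_triangle_ineq] add_mono norm_scaleR_le abs_Re_le_cmod abs_Im_le_cmod order_refl)
      (rule norm_blinfun_bound; simp)
  then show ?thesis by (simp add: algebra_simps)
qed

text \<open>The integrand at t and at - t has this form, with conjugate values of \<open>a\<close>
  and \<open>w\<close>. The order of the factors matters: left multiplication by J need not commute
  with \<open>R\<close> and \<open>S\<close>.\<close>

definition kern :: "real \<Rightarrow> complex \<Rightarrow> complex \<Rightarrow> real \<Rightarrow> ('v, 'n) cmodule \<Rightarrow>\<^sub>L ('v, 'n) cmodule" where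
  "kern sg a w t = (R (pt sg t) o\<^sub>L lm a) - (S (pt sg t) o\<^sub>L lm w)"

lemma kern_integrable:
  assumes sg: "sg = 1 \<or> sg = - 1"
    and a: "continuous_on {0<..} a" and w: "continuous_on {0<..} w"
    and aw: "\<And>t. 0 < t \<Longrightarrow> norm (a t) \<le> t * (B * t / (1 + t\<^sup>2))" "\<And>t. 0 < t \<Longrightarrow> norm (w t) \<le> B * t / (1 + t\<^sup>2)"
  shows "(\<lambda>t. kern sg (a t) (w t) t) integrable_on {0..}"
proof -
  define l where "l = 1 + norm (lmul_op J :: ('v, 'n) cmodule \<Rightarrow>\<^sub>L _)"
  have l: "0 \<le> l" by (simp add: l_def)
  have out: "pt sg ` {0<..} \<subseteq> outer" using pt_outer[OF sg] by auto
  note cR = continuous_on_compose2[OF continuous_on_R continuous_on_pt out]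
    and cS = continuous_on_compose2[OF continuous_on_S continuous_on_pt out]
  have clm: "continuous_on {0<..} (\<lambda>t. lm (f t))" if "continuous_on {0<..} f" for f
    unfolding lm_eq by (intro continuous_intros that)
  show ?thesis
  proof (rule improper_integral(1))
    show "continuous_on {0<..} (\<lambda>t. kern sg (a t) (w t) t)"
      unfolding kern_def
      by (intro continuous_intros bounded_bilinear.continuous_on[OF bounded_bilinear_blinfun_compose] cR cS clm a w)
    fix t :: real assume t: "0 < t"
    have B0: "0 \<le> B * t / (1 + t\<^sup>2)" using order_trans[OF norm_ge_zero aw(2)[OF t]] .
    have n: "norm (pt sg t) = t" by (rule norm_pt[OF sg t])
    have "norm (lm (a t)) \<le> t * (B * t / (1 + t\<^sup>2)) * l" "norm (lm (w t)) \<le> B * t / (1 + t\<^sup>2) * l"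
      using order_trans[OF norm_lm[folded l_def] mult_right_mono[OF aw(1)[OF t] l]]
        order_trans[OF norm_lm[folded l_def] mult_right_mono[OF aw(2)[OF t] l]] by simp_all
    then have "norm (kern sg (a t) (w t) t) \<le> K / t\<^sup>2 * (t * (B * t / (1 + t\<^sup>2)) * l) + K / t * (B * t / (1 + t\<^sup>2) * l)"
      unfolding kern_def
      using R_le[OF pt_outer[OF sg t]] S_le[OF pt_outer[OF sg t]] K_nonneg t n
      by (intro order_trans[OF norm_triangle_ineq4] add_mono order_trans[OF norm_blinfun_compose] mult_mono) auto
    also have "\<dots> = 2 * K * B * l / (1 + t\<^sup>2)"
    proof -
      have "K / t\<^sup>2 * (t * (B * t / c) * l) + K / t * (B * t / c * l) = 2 * K * B * l / c" for c
        using t by (simp add: power2_eq_square)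
      then show ?thesis .
    qed
    finally show "norm (kern sg (a t) (w t) t) \<le> 2 * K * B * l / (1 + t\<^sup>2)" .
  qed
qed

text \<open>Left multiplications by a slice number and by its conjugate add up to a real scalar, so
  J disappears.\<close>

lemma kern_sum: "kern sg a w t + kern sg (cnj a) (cnj w) t = 2 *\<^sub>R (Re a *\<^sub>R R (pt sg t) - Re w *\<^sub>R S (pt sg t))"
  unfolding kern_def lm_eq scaleR_2
  by (rule blinfun_eqI) (simp add: blinfun.bilinear_simps)

lemma SL_res_lm:
  assumes "z \<in> outer"
  shows "to_blinfun (SL_res (slc J z) T) = (R z o\<^sub>L lm (cnj z)) - S z"
proof -
  have z: "z \<noteq> 0" "tan \<phi> * \<bar>Re z\<bar> \<le> \<bar>Im z\<bar>" using assms by (auto simp: outer_def)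
  have "bounded_op (SL_res (slc J z) T)"
    by (rule SL_bounds[OF \<phi>_gt phi(2)]) (use z J in blast)
  from SL_res_slc(1)[OF J outer_Z[OF assms] this] show ?thesis
    by (simp add: lm_def)
qed

lemma cnj_outer: "z \<in> outer \<Longrightarrow> cnj z \<in> outer"
  by (simp add: outer_def)

lemma gamma_path_slc: "gamma_path sg \<phi> J t = slc J (complex_of_real (sg * \<bar>t\<bar>) * cis (- sgn t * \<phi>))"
  by (simp only: gamma_path_def cexp_slc slc_scale)

lemma gamma_path_pos: "0 < t \<Longrightarrow> gamma_path sg \<phi> J t = slc J (cnj (pt sg t))"
  and gamma_path_neg: "0 < t \<Longrightarrow> gamma_path sg \<phi> J (- t) = slc J (pt sg t)"
  by (simp_all add: gamma_path_slc pt_def cis_cnj)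

lemma gamma_derivative:
  assumes "0 < t"
  shows "vector_derivative (gamma_path sg \<phi> J) (at t) = slc J (cnj (dir sg))"
    and "vector_derivative (gamma_path sg \<phi> J) (at (- t)) = slc J (- dir sg)"
proof -
  have lin: "((\<lambda>t. slc J (complex_of_real t * c)) has_vector_derivative slc J c) (at t)" for c t
  proof -
    have "((\<lambda>t. t *\<^sub>R slc J c) has_vector_derivative slc J c) (at t)"
      by (auto intro!: derivative_eq_intros)
    then show ?thesis by (simp add: slc_scale)
  qed
  have "(gamma_path sg \<phi> J has_vector_derivative slc J (cnj (dir sg))) (at t)"
    using lin[of "cnj (dir sg)" t]
    by (rule has_vector_derivative_transform_within_open[of _ _ _ "{0<..}"])
      (use assms in \<open>auto simp: gamma_path_pos pt_dir\<close>)
  then show "vector_derivative (gamma_path sg \<phi> J) (at t) = slc J (cnj (dir sg))"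
    by (rule vector_derivative_at)
  have "(gamma_path sg \<phi> J has_vector_derivative slc J (- dir sg)) (at (- t))"
    using lin[of "- dir sg" "- t"]
    by (rule has_vector_derivative_transform_within_open[of _ _ _ "{..<0}"])
      (use assms gamma_path_neg[of "- s" sg for s] in \<open>auto simp: pt_dir\<close>)
  then show "vector_derivative (gamma_path sg \<phi> J) (at (- t)) = slc J (- dir sg)"
    by (rule vector_derivative_at)
qed

text \<open>For t > 0 the path is at the conjugate of \<open>pt sg t\<close>; at - t it is at
  \<open>pt sg t\<close> itself, run through in the opposite direction. Since F commutes with
  conjugation and all scalars lie in one commutative slice, the two integrands are a conjugate pair
  of \<open>kern\<close>. Their sum is twice \<open>Lam\<close>, and 2 / (2 pi) = 1 / pi.\<close>

lemma omega_calc_ray: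
  assumes \<theta>: "\<phi> < \<theta>" "\<theta> < pi / 2" and F: "hclass \<theta> F" and sym: "\<And>z. F (cnj z) = cnj (F z)"
    and f: "\<And>z. z \<in> csec \<theta> \<Longrightarrow> f (slc J z) = slc J (F z)"
  shows "omega_calc \<phi> J f T = (1 / pi) *\<^sub>R (ray F 1 + ray F (- 1))"
proof -
  define k where "k = (\<lambda>sg t. to_blinfun (SL_res (gamma_path sg \<phi> J t) T)
     o\<^sub>L lmul_op (cmul (vector_derivative (gamma_path sg \<phi> J) (at t)) (cinv J))
     o\<^sub>L lmul_op (f (gamma_path sg \<phi> J t)))"
  have cinvJ: "cinv J = slc J (- \<i>)"
    using cinv_slc[OF J, of \<i>] by (simp add: slc_ii)
  obtain B where B: "\<And>z. z \<in> csec \<theta> \<Longrightarrow> norm (F z) \<le> B * norm z / (1 + (norm z)\<^sup>2)"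
    and cF: "continuous_on (csec \<theta>) F"
    using F unfolding hclass_def by (blast intro: holomorphic_on_imp_continuous_on)
  have "integral UNIV (k sg) = 2 *\<^sub>R ray F sg" if sg: "sg = 1 \<or> sg = - 1" for sg
  proof -
    define g where "g t = F (pt sg t) * dir sg" for t
    \<comment> \<open>The factor - \<i> is the division by J in the line element; the conjugation
      comes from the position of the path for t > 0.\<close>
    define w where "w t = - \<i> * cnj (g t)" for t
    define a where "a t = pt sg t * w t" for t
    have cg: "continuous_on {0<..} g"
      unfolding g_def
      by (intro continuous_intros continuous_on_compose2[OF cF continuous_on_pt]) (use pt_csec[OF sg _ \<theta>] in auto)
    have cw: "continuous_on {0<..} w" unfolding w_def by (intro continuous_intros cg)
    have ca: "continuous_on {0<..} a" unfolding a_def by (intro continuous_intros cw continuous_on_pt)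
    have nw: "norm (w t) \<le> B * t / (1 + t\<^sup>2)" if "0 < t" for t
      using B[OF pt_csec[OF sg that \<theta>]] norm_pt[OF sg that] norm_dir[OF sg] by (simp add: w_def g_def norm_mult)
    have na: "norm (a t) \<le> t * (B * t / (1 + t\<^sup>2))" if "0 < t" for t
      using mult_left_mono[OF nw[OF that], of t] norm_pt[OF sg that] that by (simp add: a_def norm_mult)
    have kp: "k sg t = kern sg (a t) (w t) t" if t: "0 < t" for t
    proof -
      have "k sg t = (((R (pt sg t) o\<^sub>L lm (pt sg t)) - S (pt sg t)) o\<^sub>L lm (cnj (dir sg) * (- \<i>))) o\<^sub>L lm (F (cnj (pt sg t)))"
        unfolding k_def gamma_path_pos[OF t] gamma_derivative(1)[OF t] cinvJ slc_mult[OF J]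
          SL_res_lm[OF cnj_outer[OF pt_outer[OF sg t]]] lm_def
        using f[of "cnj (pt sg t)"] pt_csec[OF sg t \<theta>] by (simp add: csec_cnj R_cnj S_cnj)
      also have "\<dots> = (R (pt sg t) o\<^sub>L ((lm (pt sg t) o\<^sub>L lm (cnj (dir sg) * (- \<i>))) o\<^sub>L lm (F (cnj (pt sg t)))))
        - (S (pt sg t) o\<^sub>L (lm (cnj (dir sg) * (- \<i>)) o\<^sub>L lm (F (cnj (pt sg t)))))"
        by (rule blinfun_eqI) (simp add: blinfun.bilinear_simps)
      finally show ?thesis
        unfolding lm_mult sym by (simp add: kern_def a_def w_def g_def mult_ac)
    qed
    have km: "k sg (- t) = kern sg (cnj (a t)) (cnj (w t)) t" if t: "0 < t" for t
    proof -
      have "k sg (- t) = (((R (pt sg t) o\<^sub>L lm (cnj (pt sg t))) - S (pt sg t)) o\<^sub>L lm (- dir sg * (- \<i>))) o\<^sub>L lm (F (pt sg t))"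
        unfolding k_def gamma_path_neg[OF t] gamma_derivative(2)[OF t] cinvJ slc_mult[OF J]
          SL_res_lm[OF pt_outer[OF sg t]] lm_def
        using f[of "pt sg t"] pt_csec[OF sg t \<theta>] by simp
      also have "\<dots> = (R (pt sg t) o\<^sub>L ((lm (cnj (pt sg t)) o\<^sub>L lm (- dir sg * (- \<i>))) o\<^sub>L lm (F (pt sg t))))
        - (S (pt sg t) o\<^sub>L (lm (- dir sg * (- \<i>)) o\<^sub>L lm (F (pt sg t))))"
        by (rule blinfun_eqI) (simp add: blinfun.bilinear_simps)
      finally show ?thesis
        unfolding lm_mult by (simp add: kern_def a_def w_def g_def mult_ac)
    qed
    have "(\<lambda>t. kern sg (a t) (w t) t) integrable_on {0..}"
      by (rule kern_integrable[OF sg ca cw na nw])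
    then obtain i where i: "((\<lambda>t. kern sg (a t) (w t) t) has_integral i) {0..}" by blast
    have "(\<lambda>t. kern sg (cnj (a t)) (cnj (w t)) t) integrable_on {0..}"
      by (rule kern_integrable[OF sg continuous_on_cnj[OF ca] continuous_on_cnj[OF cw]]) (use na nw in auto)
    then obtain j where j: "((\<lambda>t. kern sg (cnj (a t)) (cnj (w t)) t) has_integral j) {0..}" by blast
    have "(k sg has_integral i) {0..}"
      by (rule has_integral_spike[OF negligible_sing[of 0] _ i]) (use kp in auto)
    moreover have "((\<lambda>t. k sg (- t)) has_integral j) {0..}"
      by (rule has_integral_spike[OF negligible_sing[of 0] _ j]) (use km in auto)
    ultimately have "(k sg has_integral (i + j)) UNIV" by (rule has_integral_fold)
    moreover have "i + j = 2 *\<^sub>R ray F sg"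
    proof (rule has_integral_unique[OF has_integral_add[OF i j]])
      have "((\<lambda>t. 2 *\<^sub>R Lam (pt sg t) (F (pt sg t) * dir sg)) has_integral 2 *\<^sub>R ray F sg) {0..}"
        by (rule has_integral_cmul[OF hclass_ray(1)[OF \<theta> sg F]])
      moreover have "2 *\<^sub>R Lam (pt sg t) (F (pt sg t) * dir sg) = kern sg (a t) (w t) t + kern sg (cnj (a t)) (cnj (w t)) t" for t
      proof -
        have "Re (a t) = - Im (g t * cnj (pt sg t))" "Re (w t) = - Im (g t)"
          by (simp_all add: a_def w_def)
        then have "Lam (pt sg t) (g t) = Re (a t) *\<^sub>R R (pt sg t) - Re (w t) *\<^sub>R S (pt sg t)"
          by (simp only: Lam_def scaleR_minus_left) simp
        then show ?thesis unfolding kern_sum g_def by simp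
      qed
      ultimately show "((\<lambda>t. kern sg (a t) (w t) t + kern sg (cnj (a t)) (cnj (w t)) t) has_integral 2 *\<^sub>R ray F sg) {0..}"
        by simp
    qed
    ultimately show ?thesis by (simp add: integral_unique)
  qed
  from this[of 1] this[of "- 1"] show ?thesis
    unfolding omega_calc_def k_def by (simp add: scaleR_add_right)
qed

end

section \<open>The extended calculus\<close>

lemma integrable_pos: "f integrable_on {0..} \<Longrightarrow> f integrable_on {0<..}" for f :: "real \<Rightarrow> 'a::banach"
  by (rule integrable_spike_set) (auto intro: negligible_subset[OF negligible_sing[of 0]])

lemma hclass_bounded:
  assumes "hclass \<theta> F"
  obtains B where "0 \<le> B" "\<And>z. z \<in> csec \<theta> \<Longrightarrow> norm (F z) \<le> B"
    "\<And>z. z \<in> csec \<theta> \<Longrightarrow> norm (F z) \<le> B * norm z / (1 + (norm z)\<^sup>2)"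
proof -
  obtain B where B: "\<And>z. z \<in> csec \<theta> \<Longrightarrow> norm (F z) \<le> B * norm z / (1 + (norm z)\<^sup>2)"
    using assms unfolding hclass_def by blast
  have le: "norm (F z) \<le> \<bar>B\<bar> * norm z / (1 + (norm z)\<^sup>2)" if "z \<in> csec \<theta>" for z
    by (rule order_trans[OF B[OF that]]) (intro divide_right_mono mult_right_mono, auto)
  have "norm (F z) \<le> \<bar>B\<bar>" if "z \<in> csec \<theta>" for z
  proof -
    have "x \<le> 1 + x\<^sup>2" for x :: real
      using zero_le_power2[of "x - 1/2"] by (simp add: power2_eq_square algebra_simps)
    then have "norm z / (1 + (norm z)\<^sup>2) \<le> 1"
      by (simp add: divide_le_eq add_pos_nonneg)
    then have "\<bar>B\<bar> * (norm z / (1 + (norm z)\<^sup>2)) \<le> \<bar>B\<bar> * 1" by (intro mult_left_mono) auto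
    then show ?thesis using le[OF that] by simp
  qed
  with le show ?thesis by (intro that[of "\<bar>B\<bar>"]) auto
qed

text \<open>The components are the real and imaginary parts of the stem function F, and the required
  differential equations are its Cauchy-Riemann equations, read off from the complex
  derivative.\<close>

lemma slice_components_hclass:
  fixes f :: "'n::{finite,linorder} clifford \<Rightarrow> 'n clifford"
  assumes \<theta>: "0 < \<theta>" "\<theta> < pi / 2" and F: "F holomorphic_on csec \<theta>" and sym: "\<And>z. F (cnj z) = cnj (F z)"
    and f: "\<And>J z. J \<in> imag_units \<Longrightarrow> z \<in> csec \<theta> \<Longrightarrow> f (slc J z) = slc J (F z)"
  shows "slice_components (dsector \<theta>) f (\<lambda>(x, y). creal (Re (F (Complex x y)))) (\<lambda>(x, y). creal (Im (F (Complex x y))))"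
proof -
  define E :: "'n clifford" where "E = ebasis {}"
  define W where "W = slice_dom (dsector \<theta> :: 'n clifford set)"
  have W: "Complex x y \<in> csec \<theta>" if "(x, y) \<in> W" for x y
  proof -
    have "slc J (Complex x y) \<in> dsector \<theta>" if "J \<in> imag_units" for J :: "'n clifford"
      using \<open>(x, y) \<in> W\<close> that by (simp add: W_def slice_dom_def slc_def)
    from dsector_csec[OF imag_units_nonempty \<theta> this[OF imag_units_nonempty]] show ?thesis .
  qed
  define c where "c p = Complex (fst p) (snd p)" for p
  have c: "c p \<in> csec \<theta>" if "p \<in> W" for p
    using W[of "fst p" "snd p"] that by (simp add: c_def)
  have lin: "bounded_linear c"
    unfolding c_def Complex_eq
    by (intro bounded_linear_add bounded_linear_const_mult bounded_linear_compose[OF bounded_linear_of_real] bounded_linear_fst bounded_linear_snd)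
  define X Y :: "(real \<times> real) \<Rightarrow>\<^sub>L 'n clifford" where "X = Blinfun (\<lambda>p. fst p *\<^sub>R E)" and "Y = Blinfun (\<lambda>p. snd p *\<^sub>R E)"
  have XY: "blinfun_apply X p = fst p *\<^sub>R E" "blinfun_apply Y p = snd p *\<^sub>R E" for p
    unfolding X_def Y_def
    by (simp_all add: bounded_linear_Blinfun_apply bounded_linear_scaleR_const bounded_linear_fst bounded_linear_snd)
  define G where "G p = deriv F (c p)" for p
  have contG: "continuous_on W G"
    unfolding G_def
    by (rule continuous_on_compose2[OF holomorphic_on_imp_continuous_on[OF holomorphic_deriv[OF F open_csec]]
        linear_continuous_on[OF lin]]) (use c in auto)
  define D0 D1 where "D0 p = Re (G p) *\<^sub>R X - Im (G p) *\<^sub>R Y" and "D1 p = Im (G p) *\<^sub>R X + Re (G p) *\<^sub>R Y" for p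
  have dF: "((\<lambda>p. F (c p)) has_derivative (\<lambda>h. G p * c h)) (at p)" if "p \<in> W" for p
  proof -
    have "(F has_field_derivative G p) (at (c p))"
      unfolding G_def using holomorphic_derivI[OF F open_csec c[OF that]] .
    then have "(F has_derivative (\<lambda>h. G p * h)) (at (c p))" by (simp add: has_field_derivative_def)
    from has_derivative_compose[OF bounded_linear_imp_has_derivative[OF lin] this] show ?thesis .
  qed
  have "C1_on W (\<lambda>(x, y). creal (Re (F (Complex x y)))) D0"
    unfolding C1_on_def
  proof (intro conjI ballI)
    fix p assume p: "p \<in> W"
    have "((\<lambda>p. Re (F (c p)) *\<^sub>R E) has_derivative (\<lambda>h. Re (G p * c h) *\<^sub>R E)) (at p)"
      by (intro has_derivative_scaleR_left bounded_linear.has_derivative[OF bounded_linear_Re] dF p)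
    moreover have "(\<lambda>h. Re (G p * c h) *\<^sub>R E) = blinfun_apply (D0 p)"
      by (auto simp: D0_def blinfun.bilinear_simps XY c_def algebra_simps)
    ultimately show "((\<lambda>(x, y). creal (Re (F (Complex x y)))) has_derivative blinfun_apply (D0 p)) (at p)"
      by (simp add: c_def creal_def E_def case_prod_unfold)
  qed (unfold D0_def, intro continuous_intros contG)
  moreover have "C1_on W (\<lambda>(x, y). creal (Im (F (Complex x y)))) D1"
    unfolding C1_on_def
  proof (intro conjI ballI)
    fix p assume p: "p \<in> W"
    have "((\<lambda>p. Im (F (c p)) *\<^sub>R E) has_derivative (\<lambda>h. Im (G p * c h) *\<^sub>R E)) (at p)"
      by (intro has_derivative_scaleR_left bounded_linear.has_derivative[OF bounded_linear_Im] dF p)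
    moreover have "(\<lambda>h. Im (G p * c h) *\<^sub>R E) = blinfun_apply (D1 p)"
      by (auto simp: D1_def blinfun.bilinear_simps XY c_def algebra_simps)
    ultimately show "((\<lambda>(x, y). creal (Im (F (Complex x y)))) has_derivative blinfun_apply (D1 p)) (at p)"
      by (simp add: c_def creal_def E_def case_prod_unfold)
  qed (unfold D1_def, intro continuous_intros contG)
  moreover have "blinfun_apply (D0 p) (1, 0) = blinfun_apply (D1 p) (0, 1)"
    "blinfun_apply (D0 p) (0, 1) = - blinfun_apply (D1 p) (1, 0)" for p
    by (simp_all add: D0_def D1_def blinfun.bilinear_simps XY)
  moreover have "f (creal x + y *\<^sub>R J) = creal (Re (F (Complex x y))) + cmul J (creal (Im (F (Complex x y))))"
    if "(x, y) \<in> W" "J \<in> imag_units" for x y J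
    using f[OF that(2) W[OF that(1)]] by (simp add: slc_def creal_def cmul_bilinear cmul_one)
  moreover have "F (Complex x (- y)) = cnj (F (Complex x y))" for x y
  proof -
    have "Complex x (- y) = cnj (Complex x y)" by (simp add: complex_eq_iff)
    then show ?thesis by (simp only: sym)
  qed
  ultimately show ?thesis
    unfolding slice_components_def W_def[symmetric]
    by (intro conjI exI[of _ D0] exI[of _ D1]) (auto simp: creal_def)
qed

text \<open>The decay of the class gives the integrability condition: on every ray the integrand is
  at most B / (1 + t^2).\<close>

lemma N0_hclass:
  fixes f :: "'n::{finite,linorder} clifford \<Rightarrow> 'n clifford"
  assumes \<theta>: "0 < \<theta>" "\<theta> < pi / 2" and F: "hclass \<theta> F" and sym: "\<And>z. F (cnj z) = cnj (F z)"
    and f: "\<And>J z. J \<in> imag_units \<Longrightarrow> z \<in> csec \<theta> \<Longrightarrow> f (slc J z) = slc J (F z)"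
  shows "f \<in> N0 \<theta>"
proof -
  have hol: "F holomorphic_on csec \<theta>" using F by (simp add: hclass_def)
  note sc = slice_components_hclass[OF \<theta> hol sym f]
  obtain B where B: "0 \<le> B" "\<And>z. z \<in> csec \<theta> \<Longrightarrow> norm (F z) \<le> B"
    "\<And>z. z \<in> csec \<theta> \<Longrightarrow> norm (F z) \<le> B * norm z / (1 + (norm z)\<^sup>2)"
    using hclass_bounded[OF F] by blast
  have "norm (f s) \<le> B" if "s \<in> dsector \<theta>" for s
  proof -
    from dsector_cases[OF \<theta> that] obtain J z where "J \<in> imag_units" "z \<in> csec \<theta>" "s = slc J z" .
    then show ?thesis using B(2) by (simp add: f norm_slc)
  qed
  then have "bounded (f ` dsector \<theta>)" by (auto simp: bounded_iff)
  moreover have "(\<lambda>t. norm (f (t *\<^sub>R cexp J \<psi>)) / t) integrable_on {0<..}"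
    if J: "J \<in> imag_units" and \<psi>: "\<psi> \<in> angles \<theta>" for J \<psi>
  proof -
    have z: "complex_of_real t * cis \<psi> \<in> csec \<theta>" if "0 < t" for t
    proof (rule dsector_csec[OF J \<theta>])
      have "slc J (complex_of_real t * cis \<psi>) = t *\<^sub>R cexp J \<psi>" by (simp only: slc_scale cexp_slc)
      then show "slc J (complex_of_real t * cis \<psi>) \<in> dsector \<theta>"
        unfolding dsector_def using that J \<psi> by blast
    qed
    have eq: "norm (f (t *\<^sub>R cexp J \<psi>)) = norm (F (complex_of_real t * cis \<psi>))" if "0 < t" for t
      using f[OF J z[OF that]] by (simp add: slc_scale cexp_slc norm_slc[OF J])
    have "(\<lambda>t. norm (F (complex_of_real t * cis \<psi>)) / t) integrable_on {0..}"
    proof (rule improper_integral(1))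
      show "continuous_on {0<..} (\<lambda>t. norm (F (complex_of_real t * cis \<psi>)) / t)"
        by (intro continuous_intros continuous_on_compose2[OF holomorphic_on_imp_continuous_on[OF hol]]) (use z in auto)
      show "norm (norm (F (complex_of_real t * cis \<psi>)) / t) \<le> B / (1 + t\<^sup>2)" if "0 < t" for t
        using divide_right_mono[OF B(3)[OF z[OF that]], of t] that by (simp add: norm_mult)
    qed
    from integrable_pos[OF this] show ?thesis
      by (rule integrable_eq) (simp add: eq)
  qed
  moreover have "f \<in> SHL (dsector \<theta>)" unfolding SHL_def using sc by blast
  moreover have "f \<in> intrinsic (dsector \<theta>)"
    unfolding intrinsic_def using sc by (intro CollectI exI conjI) auto
  ultimately show ?thesis by (simp add: N0_def SHL0_def)
qed

section \<open>Uniqueness of the components\<close>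

lemma log_integral_bound:
  fixes \<kappa> x y :: real
  assumes u: "u integrable_on {0<..}" "\<And>t. 0 < t \<Longrightarrow> 0 \<le> u t"
    and xy: "0 < x" "x \<le> y" and le: "\<And>t. x \<le> t \<Longrightarrow> t \<le> y \<Longrightarrow> \<kappa> / t \<le> u t"
  shows "\<kappa> * (ln y - ln x) \<le> integral {0<..} u"
proof -
  have sub: "{x..y} \<subseteq> {0<..}" using xy by auto
  then have iu: "u integrable_on {x..y}" using u(1) by (rule integrable_on_subinterval[rotated])
  have "((\<lambda>t. \<kappa> / t) has_integral (\<kappa> * ln y - \<kappa> * ln x)) {x..y}"
    by (rule fundamental_theorem_of_calculus[OF xy(2)])
      (use xy in \<open>auto intro!: derivative_eq_intros simp: has_real_derivative_iff_has_vector_derivative[symmetric]\<close>)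
  then have "\<kappa> * ln y - \<kappa> * ln x \<le> integral {x..y} u"
    by (rule has_integral_le[OF _ integrable_integral[OF iu]]) (use le in auto)
  also have "\<dots> \<le> integral {0<..} u"
    by (rule integral_subset_le[OF sub iu u(1)]) (use u(2) in auto)
  finally show ?thesis by (simp add: right_diff_distrib)
qed

text \<open>A nonzero c makes the lower bound of order 1/t at infinity; once c = 0, a nonzero d does
  so at 0. In both cases a logarithm outgrows the integral of u.\<close>

lemma log_not_integrable:
  fixes c d :: real
  assumes u: "u integrable_on {0<..}" "\<And>t. 0 < t \<Longrightarrow> \<bar>c + d / (1 + t\<^sup>2)\<bar> / t \<le> u t"
  shows "c = 0" "d = 0"
proof -
  define I where "I = integral {0<..} u"
  have u0: "0 \<le> u t" if "0 < t" for t
    using order_trans[OF _ u(2)[OF that], of 0] that by simp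
  show c: "c = 0"
  proof (rule ccontr)
    assume "c \<noteq> 0"
    define \<kappa> where "\<kappa> = \<bar>c\<bar> / 2"
    have "((\<lambda>t. \<bar>c + d / (1 + t\<^sup>2)\<bar>) \<longlongrightarrow> \<bar>c\<bar>) at_top"
    proof -
      have "((\<lambda>t::real. d / (1 + t\<^sup>2)) \<longlongrightarrow> 0) at_top" by real_asymp
      then have "((\<lambda>t. c + d / (1 + t\<^sup>2)) \<longlongrightarrow> c + 0) at_top" by (intro tendsto_intros)
      then show ?thesis by (intro tendsto_rabs) simp
    qed
    moreover have "\<kappa> < \<bar>c\<bar>" "0 < \<kappa>" using \<open>c \<noteq> 0\<close> by (auto simp: \<kappa>_def)
    ultimately have "\<forall>\<^sub>F t in at_top. \<kappa> < \<bar>c + d / (1 + t\<^sup>2)\<bar>" by (intro order_tendstoD)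
    then obtain b0 where b0: "\<And>t. b0 \<le> t \<Longrightarrow> \<kappa> < \<bar>c + d / (1 + t\<^sup>2)\<bar>" by (auto simp: eventually_at_top_linorder)
    define b where "b = max b0 1"
    \<comment> \<open>Chosen so that \<kappa> (ln y - ln b) = |I| + \<kappa>, which exceeds
      \<open>I\<close>.\<close>
    define y where "y = b * exp (\<bar>I\<bar> / \<kappa> + 1)"
    have "1 * b \<le> exp (\<bar>I\<bar> / \<kappa> + 1) * b"
      using \<open>0 < \<kappa>\<close> by (intro mult_right_mono) (auto simp: b_def)
    then have yb: "0 < b" "b \<le> y" by (auto simp: b_def y_def mult.commute)
    have "\<kappa> * (ln y - ln b) \<le> I"
      unfolding I_def
    proof (rule log_integral_bound[OF u(1) u0 yb])
      fix t assume "b \<le> t"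
      then have "0 < t" "b0 \<le> t" by (auto simp: b_def)
      then show "\<kappa> / t \<le> u t"
        using divide_right_mono[OF less_imp_le[OF b0[of t]], of t] u(2)[of t] by simp
    qed
    moreover have "\<kappa> * (ln y - ln b) = \<bar>I\<bar> + \<kappa>"
      using yb \<open>0 < \<kappa>\<close> by (simp add: y_def ln_mult algebra_simps)
    ultimately show False using \<open>0 < \<kappa>\<close> by linarith
  qed
  show "d = 0"
  proof (rule ccontr)
    assume "d \<noteq> 0"
    define \<kappa> where "\<kappa> = \<bar>d\<bar> / 2"
    have "0 < \<kappa>" using \<open>d \<noteq> 0\<close> by (auto simp: \<kappa>_def)
    have ge: "\<kappa> \<le> \<bar>c + d / (1 + t\<^sup>2)\<bar>" if "0 < t" "t \<le> 1" for t
    proof -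
      have "t\<^sup>2 \<le> 1" using that by (simp add: power_le_one)
      then have "\<bar>d\<bar> / 2 \<le> \<bar>d\<bar> / (1 + t\<^sup>2)" by (intro divide_left_mono) (auto intro!: mult_pos_pos add_pos_nonneg)
      then show ?thesis by (simp add: \<kappa>_def c abs_divide)
    qed
    \<comment> \<open>The counterpart near 0: - \<kappa> ln x = |I| + \<kappa>.\<close>
    define x where "x = exp (- (\<bar>I\<bar> / \<kappa> + 1))"
    have "0 \<le> \<bar>I\<bar> / \<kappa>" using \<open>0 < \<kappa>\<close> by simp
    then have x: "0 < x" "x \<le> 1" unfolding x_def exp_le_one_iff by simp_all
    have "\<kappa> * (ln 1 - ln x) \<le> I"
      unfolding I_def
    proof (rule log_integral_bound[OF u(1) u0 x])
      fix t assume "x \<le> t" "t \<le> 1"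
      then have "0 < t" using x by linarith
      then show "\<kappa> / t \<le> u t"
        using divide_right_mono[OF ge[of t], of t] u(2)[of t] \<open>t \<le> 1\<close> by simp
    qed
    moreover have "\<kappa> * (ln 1 - ln x) = \<bar>I\<bar> + \<kappa>"
      using \<open>0 < \<kappa>\<close> by (simp add: x_def algebra_simps)
    ultimately show False using \<open>0 < \<kappa>\<close> by linarith
  qed
qed

text \<open>\<open>ext_calc\<close> selects components by choice, so two selections must agree. On
  the positive axis the third components differ by the real number c + d / (1 + t^2), and
  integrability with respect to dt/t forces c = d = 0.\<close>

lemma bnd_components_unique:
  fixes g :: "'n::{finite,linorder} clifford \<Rightarrow> 'n clifford"
  assumes \<theta>: "0 < \<theta>" "\<theta> < pi / 2"
    and "bnd_components \<theta> g g0 ginf gt" "bnd_components \<theta> g g0' ginf' gt'"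
  shows "g0' = g0" "ginf' = ginf"
proof -
  define J :: "'n clifford" where "J = ebasis {undefined}"
  have J: "J \<in> imag_units" unfolding J_def by (rule imag_units_nonempty)
  define c d where "c = ginf' - ginf" and "d = (g0' - ginf') - (g0 - ginf)"
  have 0: "0 \<in> angles \<theta>" using \<theta> by (simp add: angles_def)
  have cexp0: "t *\<^sub>R cexp J 0 = creal t" for t by (simp add: cexp_slc slc_one creal_def)
  have int: "(\<lambda>t. norm (h (t *\<^sub>R cexp J 0)) / t) integrable_on {0<..}" if "h \<in> N0 \<theta>" for h
    using that J 0 by (auto simp: N0_def SHL0_def)
  have "(\<lambda>t. norm (gt' (t *\<^sub>R cexp J 0)) / t + norm (gt (t *\<^sub>R cexp J 0)) / t) integrable_on {0<..}"
    using assms(3,4) by (intro integrable_add int) (auto simp: bnd_components_def)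
  moreover have "\<bar>c + d / (1 + t\<^sup>2)\<bar> / t \<le> norm (gt' (t *\<^sub>R cexp J 0)) / t + norm (gt (t *\<^sub>R cexp J 0)) / t"
    if t: "0 < t" for t
  proof -
    have "t *\<^sub>R cexp J 0 \<in> dsector \<theta>" unfolding dsector_def using t J 0 by blast
    then have s: "creal t \<in> (dsector \<theta> :: 'n clifford set)" by (simp add: cexp0)
    define k where "k = inverse (1 + t\<^sup>2)"
    have "1 + t\<^sup>2 \<noteq> 0" using zero_le_power2[of t] by linarith
    then have "cinv (slc J (complex_of_real (1 + t\<^sup>2))) = slc J (complex_of_real k)"
      using cinv_slc[OF J, of "complex_of_real (1 + t\<^sup>2)"] by (simp only: of_real_eq_0_iff k_def of_real_inverse simp_thms)
    moreover have "slc J (complex_of_real (1 + t\<^sup>2)) = creal 1 + cpow (creal t) 2"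
    proof -
      have "slc J (complex_of_real (1 + t\<^sup>2)) = slc J (complex_of_real 1) + slc J (complex_of_real t ^ 2)"
        by (simp only: slc_add[symmetric]) simp
      then show ?thesis using cpow_slc[OF J, of "complex_of_real t" 2] by (simp only: slc_of_real)
    qed
    ultimately have inv: "cinv (creal 1 + cpow (creal t) 2) = (creal k :: 'n clifford)"
      by (simp only: slc_of_real)
    have "creal ginf + (g0 - ginf) *\<^sub>R creal k + gt (creal t)
      = creal ginf' + (g0' - ginf') *\<^sub>R creal k + gt' (creal t)"
      using assms(3,4) s unfolding bnd_components_def inv[symmetric] by metis
    then have "gt (creal t) - gt' (creal t) = (creal (c + d * k) :: 'n clifford)"
      by (simp add: creal_def c_def d_def algebra_simps)
    moreover have "norm (creal r :: 'n clifford) = \<bar>r\<bar>" for r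
      using norm_slc[OF J, of "complex_of_real r"] by (simp add: slc_of_real)
    ultimately have "\<bar>c + d * k\<bar> \<le> norm (gt' (creal t)) + norm (gt (creal t))"
      using norm_triangle_ineq4[of "gt (creal t)" "gt' (creal t)"] by (simp add: add.commute)
    from divide_right_mono[OF this, of t] t show ?thesis
      by (simp add: cexp0 add_divide_distrib k_def divide_inverse[of d])
  qed
  ultimately have "c = 0 \<and> d = 0" using log_not_integrable by blast
  then show "g0' = g0" "ginf' = ginf" by (auto simp: c_def d_def)
qed

section \<open>Choice of the sector and of the numerator\<close>

text \<open>There are finitely many zeros, and by continuity of tan each of them stays outside
  slightly larger sectors.\<close>

lemma separating_angle:
  assumes q: "q \<noteq> 0" and \<omega>: "0 < \<omega>" "\<omega> < pi / 2" and roots: "\<And>z. cp q z = 0 \<Longrightarrow> z \<notin> csec_closure \<omega>"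
  obtains \<theta> where "\<omega> < \<theta>" "\<theta> < pi / 2" "\<And>z. cp q z = 0 \<Longrightarrow> z \<notin> csec_closure \<theta>"
proof -
  have "map_poly complex_of_real q \<noteq> 0" using q by (simp add: map_poly_eq_0_iff)
  then have fin: "finite {z. cp q z = 0}" by (rule poly_roots_finite)
  have "\<forall>\<^sub>F \<theta> in at_right \<omega>. z \<notin> csec_closure \<theta>" if "cp q z = 0" for z
  proof -
    have "((\<lambda>\<theta>. tan \<theta> * \<bar>Re z\<bar>) \<longlongrightarrow> tan \<omega> * \<bar>Re z\<bar>) (at_right \<omega>)"
      using cos_gt_zero_pi[of \<omega>] \<omega> by (intro tendsto_intros) auto
    moreover have "tan \<omega> * \<bar>Re z\<bar> < \<bar>Im z\<bar>" using roots[OF that] by (simp add: csec_closure_def)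
    ultimately have "\<forall>\<^sub>F \<theta> in at_right \<omega>. tan \<theta> * \<bar>Re z\<bar> < \<bar>Im z\<bar>" by (rule order_tendstoD)
    then show ?thesis by eventually_elim (simp add: csec_closure_def)
  qed
  then have "\<forall>\<^sub>F \<theta> in at_right \<omega>. \<forall>z\<in>{z. cp q z = 0}. z \<notin> csec_closure \<theta>"
    by (intro eventually_ball_finite fin) simp
  moreover have "\<forall>\<^sub>F \<theta> in at_right \<omega>. \<theta> \<in> {\<omega><..<pi/2}"
    using \<omega> by (intro eventually_at_right_real)
  ultimately have "\<exists>\<theta>. (\<forall>z\<in>{z. cp q z = 0}. z \<notin> csec_closure \<theta>) \<and> \<theta> \<in> {\<omega><..<pi/2}"
    by (intro eventually_happens'[OF _ eventually_conj]) auto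
  then show ?thesis using that by auto
qed

text \<open>\<open>g0\<close> and \<open>ginf\<close> are the values of p/q at 0 and at infinity.
  Subtracting \<open>ginf\<close> lowers the numerator below the degree of q; after multiplication
  by 1 + z^2 the second subtraction removes the constant coefficient. Hence z splits off and leaves
  degree at most that of q.\<close>

lemma numerator_split:
  fixes p q :: "real poly"
  assumes "degree p \<le> degree q" and q0: "coeff q 0 \<noteq> 0"
  defines "g0 \<equiv> coeff p 0 / coeff q 0" and "ginf \<equiv> coeff p (degree q) / lead_coeff q"
  obtains a where "degree a \<le> degree q"
    "p * [:1, 0, 1:] = smult ginf (q * [:1, 0, 1:]) + smult (g0 - ginf) q + pCons 0 a"
proof -
  define c where "c = p - smult ginf q"
  define N where "N = c * [:1, 0, 1:] - smult (g0 - ginf) q"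
  have N: "N = c + pCons 0 (pCons 0 c) - smult (g0 - ginf) q"
    by (simp add: N_def)
  obtain n a where Na: "N = pCons n a" by (rule pCons_cases)
  have "q \<noteq> 0" using q0 by auto
  have "n = coeff N 0" by (simp add: Na)
  also have "\<dots> = 0" using q0 by (simp add: N c_def g0_def left_diff_distrib)
  finally have n: "n = 0" .
  have c0: "coeff c k = 0" if "degree q \<le> k" for k
    using that assms(1) \<open>q \<noteq> 0\<close>
    by (cases "k = degree q") (auto simp: c_def ginf_def coeff_eq_0)
  have "degree a \<le> degree q"
  proof (rule degree_le, intro allI impI)
    fix i assume i: "degree q < i"
    then obtain j where j: "i = Suc j" "degree q \<le> j" by (cases i) auto
    have "coeff a i = coeff N (Suc i)" by (simp add: Na)
    also have "\<dots> = 0" using c0 i j by (simp add: N coeff_eq_0)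
    finally show "coeff a i = 0" .
  qed
  moreover have "p * [:1, 0, 1:] = smult ginf (q * [:1, 0, 1:]) + smult (g0 - ginf) q + pCons 0 a"
  proof -
    have "p * [:1, 0, 1:] - smult ginf (q * [:1, 0, 1:]) - smult (g0 - ginf) q = N"
      unfolding N_def c_def by (simp only: left_diff_distrib mult_smult_left)
    then show ?thesis unfolding Na n by (simp add: algebra_simps)
  qed
  ultimately show ?thesis using that by blast
qed

lemma qp_ii: "qp \<i> = [:1, 0, 1:]"
  by (simp add: qp_def)

context bisector
begin

lemma bisector_ray_exists:
  assumes "\<omega> < \<phi>" "\<phi> < pi / 2" "J \<in> imag_units"
  shows "\<exists>K. bisector_ray T \<omega> \<phi> K J"
  using sector_op_exists[OF assms(1,2)] bisector_axioms assms
  by (auto simp: bisector_ray_def bisector_ray_axioms_def)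

end

section \<open>The value of the extended calculus at a rational function\<close>

context bisector_ray
begin

text \<open>With w = (1 + T^2)^-1 q[T]^-1 v, every term is a polynomial of T applied to w, so the
  splitting of the numerator applies. The vector w lies in the domain of T^(deg q + 2), which covers
  all degrees involved.\<close>

lemma rational_operator:
  fixes B X :: "('v, 'n) cmodule \<Rightarrow>\<^sub>L ('v, 'n) cmodule"
  assumes B: "inverts (blinfun_apply B) q" and X: "\<And>v. blinfun_apply X v = pev a (B v)"
    and deg: "degree p \<le> degree q" "degree a \<le> degree q"
    and split: "p * [:1, 0, 1:] = smult c (q * [:1, 0, 1:]) + smult d q + pCons 0 a"
  shows "c *\<^sub>R v + d *\<^sub>R R \<i> v + S \<i> (X v) = pev p (B v)"
proof -
  define w where "w = R \<i> (B v)"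
  have Bv: "B v \<in> D (degree q)" and qB: "pev q (B v) = v" using B by (auto simp: inverts_def)
  have w: "w \<in> D (degree q + 2)" using R_D[OF iZ Bv] by (simp add: w_def)
  have Qw: "pev [:1, 0, 1:] w = B v" using pev_qp_R[OF iZ] by (simp add: w_def qp_ii)
  have sub: "w \<in> D n" if "n \<le> degree q + 2" for n using D_antimono[OF that] w by blast
  have Ba: "B v \<in> D (degree a)" using D_antimono[OF deg(2)] Bv by blast
  have "S \<i> (X v) = A (pev a w)"
    using R_pev[OF iZ Ba] by (simp add: S_apply[OF iZ] X w_def)
  also have "\<dots> = pev (pCons 0 a) w"
    using A_pev[OF sub[of "Suc (degree a)"]] deg(2) by (simp add: pev_pCons)
  finally have N: "S \<i> (X v) = pev (pCons 0 a) w" .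
  have M: "R \<i> v = pev q w"
    using R_pev[OF iZ Bv] qB by (simp add: w_def)
  have deg2: "degree [:1, 0, 1 :: real:] = 2" by simp
  have "pev p (B v) = pev (p * [:1, 0, 1:]) w"
    unfolding Qw[symmetric] by (rule pev_mult[symmetric]) (use sub deg(1) deg2 in simp)
  also have "\<dots> = c *\<^sub>R pev (q * [:1, 0, 1:]) w + d *\<^sub>R pev q w + pev (pCons 0 a) w"
    unfolding split pev_add pev_smult ..
  also have "pev (q * [:1, 0, 1:]) w = v"
    using pev_mult[of w q "[:1, 0, 1:]"] w deg2 by (simp add: Qw qB)
  finally show ?thesis by (simp add: N M)
qed

text \<open>By uniqueness the selected third component agrees with \<open>gt\<close> on the sector.
  The ray values of z / (1 + z^2) sum to pi times \<open>S \<i>\<close>, so the calculus of this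
  component is \<open>S \<i>\<close> composed with X.\<close>

lemma ext_calc_rational:
  assumes \<theta>: "\<phi> < \<theta>" "\<theta> < pi / 2"
    and comp: "bnd_components \<theta> g g0 ginf gt"
    and gt: "\<And>J z. J \<in> imag_units \<Longrightarrow> z \<in> csec \<theta> \<Longrightarrow> gt (slc J z) = slc J (z / (1 + z\<^sup>2) * (cp a z / cp q z))"
    and B: "inverts (blinfun_apply B) q" and X: "\<And>v. blinfun_apply X v = pev a (B v)"
    and h: "hclass \<theta> (\<lambda>z. z / (1 + z\<^sup>2) * (cp a z / cp q z))"
    and ray: "\<And>sg. sg \<in> {1, - 1} \<Longrightarrow> ray (\<lambda>z. z / (1 + z\<^sup>2) * (cp a z / cp q z)) sg = (ray (\<lambda>z. z / (1 + z\<^sup>2)) sg o\<^sub>L X)"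
    and deg: "degree p \<le> degree q" "degree a \<le> degree q"
    and split: "p * [:1, 0, 1:] = smult ginf (q * [:1, 0, 1:]) + smult (g0 - ginf) q + pCons 0 a"
  shows "blinfun_apply (ext_calc \<theta> \<phi> J g T) v = pev p (B v)"
proof -
  let ?F = "\<lambda>z. z / (1 + z\<^sup>2) * (cp a z / cp q z)"
  obtain g0' ginf' gt' where some: "(SOME (g0, ginf, gt). bnd_components \<theta> g g0 ginf gt) = (g0', ginf', gt')"
    by (metis prod_cases3)
  have "case (g0', ginf', gt') of (g0, ginf, gt) \<Rightarrow> bnd_components \<theta> g g0 ginf gt"
    unfolding some[symmetric] by (rule someI[of _ "(g0, ginf, gt)"]) (use comp in simp)
  then have comp': "bnd_components \<theta> g g0' ginf' gt'" by simp
  have \<theta>0: "0 < \<theta>" using \<theta> phi by simp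
  note eq = bnd_components_unique[OF \<theta>0 \<theta>(2) comp comp']
  have "gt' (slc J z) = slc J (?F z)" if z: "z \<in> csec \<theta>" for z
  proof -
    have "slc J z \<in> dsector \<theta>" by (rule csec_dsector[OF J \<theta>0 \<theta>(2) z])
    then have "gt' (slc J z) = gt (slc J z)"
      using comp comp' unfolding bnd_components_def eq by (metis add_left_cancel)
    then show ?thesis using gt[OF J z] by simp
  qed
  then have "omega_calc \<phi> J gt' T = (1 / pi) *\<^sub>R (ray ?F 1 + ray ?F (- 1))"
    by (intro omega_calc_ray[OF \<theta> h]) (simp_all add: cp_cnj)
  also have "\<dots> = (1 / pi) *\<^sub>R ((ray (\<lambda>z. z / (1 + z\<^sup>2)) 1 + ray (\<lambda>z. z / (1 + z\<^sup>2)) (- 1)) o\<^sub>L X)"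
    using ray[of 1] ray[of "- 1"] by (intro blinfun_eqI) (simp add: blinfun.bilinear_simps)
  also have "\<dots> = (S \<i> o\<^sub>L X)"
    unfolding ray_base by (rule blinfun_eqI) (simp add: blinfun.bilinear_simps)
  finally have "ext_calc \<theta> \<phi> J g T = ginf *\<^sub>R id_blinfun + (g0 - ginf) *\<^sub>R R \<i> + (S \<i> o\<^sub>L X)"
    unfolding ext_calc_def some by (simp add: eq R_def qp_ii)
  then show ?thesis
    using rational_operator[OF B X deg split, of v] by (simp add: blinfun.bilinear_simps)
qed

end

text \<open>The last conjunct is an equality of partial functions: it includes that the inverse of
  q[T] is total and that its values lie in the domain of p[T].\<close>

theorem theorem4p10:
  fixes T :: "('v::banach, 'n::{finite,linorder}) cmodule \<rightharpoonup> ('v, 'n) cmodule"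
    and \<omega> :: real and p q :: "real poly"
  assumes "0 < \<omega>" and "\<omega> < pi / 2"
    and "closed_op T" and "bisectorial \<omega> T"
    and "p \<noteq> 0" and "q \<noteq> 0"
    and "degree p \<le> degree q"
    and "\<forall>s\<in>closure (dsector \<omega> :: 'n clifford set). cpoly q s \<noteq> 0"
  shows "bij_betw (\<lambda>v. the (poly_op q T v)) (dom (poly_op q T)) UNIV \<and>
    (\<exists>\<theta>\<in>{\<omega><..<pi/2}. (cratio p q :: 'n clifford \<Rightarrow> 'n clifford) \<in> Nbnd \<theta> \<and>
      (\<forall>\<phi>\<in>{\<omega><..<\<theta>}. \<forall>J\<in>imag_units.
         (\<lambda>v. Some (blinfun_apply (ext_calc \<theta> \<phi> J (cratio p q) T) v))
           = poly_op p T \<circ>\<^sub>m op_inv (poly_op q T)))"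
proof -
  interpret bisector T \<omega> by standard (fact assms)+
  define J0 :: "'n clifford" where "J0 = ebasis {undefined}"
  have J0: "J0 \<in> imag_units" unfolding J0_def by (rule imag_units_nonempty)
  have "z \<notin> csec_closure \<omega>" if "cp q z = 0" for z
  proof
    assume "z \<in> csec_closure \<omega>"
    then have "cpoly q (slc J0 z) \<noteq> 0" using assms(8) slc_in_closure[OF J0 assms(1,2)] by blast
    then show False using that by (simp add: cpoly_slc[OF J0] slc_zero)
  qed
  from separating_angle[OF assms(6,1,2) this]
  obtain \<theta> where \<theta>: "\<omega> < \<theta>" "\<theta> < pi / 2" and roots: "\<And>z. cp q z = 0 \<Longrightarrow> z \<notin> csec_closure \<theta>" by blast
  have \<theta>0: "0 < \<theta>" using \<theta> assms(1) by simp
  have roots': "cp q z = 0 \<Longrightarrow> z \<in> Z \<and> z \<notin> csec_closure \<theta>" for z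
  proof -
    assume "cp q z = 0"
    then have "z \<notin> csec_closure \<theta>" by (rule roots)
    moreover have "csec_closure \<omega> \<subseteq> csec_closure \<theta>"
    proof -
      have "tan \<omega> \<le> tan \<theta>" using tan_mono_le[of \<omega> \<theta>] \<theta> assms(1) by simp
      then show ?thesis
        by (auto simp: csec_closure_def intro: order_trans[OF _ mult_right_mono])
    qed
    ultimately show ?thesis by (auto simp: Z_def)
  qed
  \<comment> \<open>0 belongs to every closed sector, hence is no zero of q, and p/q has a value
    there.\<close>
  have q0: "coeff q 0 \<noteq> 0"
    using roots[of 0] by (auto simp: csec_closure_def poly_0_coeff_0 coeff_map_poly)
  define g0 ginf where "g0 = coeff p 0 / coeff q 0" and "ginf = coeff p (degree q) / lead_coeff q"
  from numerator_split[OF assms(7) q0] obtain a where a: "degree a \<le> degree q"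
    and split: "p * [:1, 0, 1:] = smult ginf (q * [:1, 0, 1:]) + smult (g0 - ginf) q + pCons 0 a"
    unfolding g0_def ginf_def by blast
  let ?F = "\<lambda>z. z / (1 + z\<^sup>2) * (cp a z / cp q z)"
  \<comment> \<open>\<open>inverts (blinfun_apply B) q\<close> and membership of \<open>?F\<close>
    in the class do not mention the path, yet they are obtained inside an interpretation for some
    angle and unit. The existential form exports them from an auxiliary path and the ray values from
    every admissible one.\<close>
  have calc: "\<exists>K (B :: ('v, 'n) cmodule \<Rightarrow>\<^sub>L ('v, 'n) cmodule) X. bisector_ray T \<omega> \<phi> K J \<and> inverts (blinfun_apply B) q \<and>
      (\<forall>v. blinfun_apply X v = pev a (blinfun_apply B v)) \<and> hclass \<theta> ?F \<and>
      (\<forall>sg\<in>{1, - 1}. sector_resolvent.ray R S \<phi> ?F sg = (sector_resolvent.ray R S \<phi> (\<lambda>z. z / (1 + z\<^sup>2)) sg o\<^sub>L X))"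
    if \<phi>: "\<omega> < \<phi>" "\<phi> < \<theta>" and J: "J \<in> imag_units" for \<phi> and J :: "'n clifford"
  proof -
    obtain K where "bisector_ray T \<omega> \<phi> K J" using bisector_ray_exists[OF \<phi>(1) _ J] \<phi> \<theta> by auto
    then interpret r: bisector_ray T \<omega> \<phi> K J .
    from r.rational_calculus[OF \<phi>(2) \<theta>(2) assms(6) roots'] obtain B :: "('v, 'n) cmodule \<Rightarrow>\<^sub>L ('v, 'n) cmodule" where
      B: "inverts (blinfun_apply B) q" and ex: "\<exists>X :: ('v, 'n) cmodule \<Rightarrow>\<^sub>L ('v, 'n) cmodule.
        (\<forall>v. blinfun_apply X v = pev a (blinfun_apply B v)) \<and> r.multiplier \<theta> (\<lambda>z. cp a z / cp q z) X"
      using a by blast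
    from ex obtain X :: "('v, 'n) cmodule \<Rightarrow>\<^sub>L ('v, 'n) cmodule" where X: "\<forall>v. blinfun_apply X v = pev a (blinfun_apply B v)"
      and h: "\<And>h. hclass \<theta> h \<Longrightarrow> hclass \<theta> (\<lambda>z. h z * (cp a z / cp q z)) \<and>
        (\<forall>sg\<in>{1, - 1}. r.ray (\<lambda>z. h z * (cp a z / cp q z)) sg = (r.ray h sg o\<^sub>L X))"
      unfolding r.multiplier_def by blast
    show ?thesis using \<open>bisector_ray T \<omega> \<phi> K J\<close> B X h[OF hclass_base] by blast
  qed
  have mid: "\<omega> < (\<omega> + \<theta>) / 2" "(\<omega> + \<theta>) / 2 < \<theta>" using \<theta> by (auto simp: field_simps)
  from calc[OF mid J0] obtain B0 :: "('v, 'n) cmodule \<Rightarrow>\<^sub>L ('v, 'n) cmodule"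
    where B0: "inverts (blinfun_apply B0) q" and F: "hclass \<theta> ?F" by blast
  \<comment> \<open>Defined as the remainder, so the required decomposition holds by construction
    and only \<open>gt \<in> N0 \<theta>\<close> is left to show.\<close>
  define gt :: "'n clifford \<Rightarrow> 'n clifford" where
    "gt s = cratio p q s - (creal ginf + (g0 - ginf) *\<^sub>R cinv (creal 1 + cpow s 2))" for s
  have gt: "gt (slc J z) = slc J (?F z)" if J: "J \<in> imag_units" and z: "z \<in> csec \<theta>" for J z
  proof -
    have zc: "z \<in> csec_closure \<theta>" using z csec_subset_closure by blast
    then have q: "cp q z \<noteq> 0" using roots by blast
    have 1: "1 + z\<^sup>2 \<noteq> 0" by (rule one_plus_square_bound[of \<theta>]) (use zc in blast)
    have E: "creal 1 + cpow (slc J z) 2 = slc J (1 + z\<^sup>2)"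
      by (simp add: cpow_slc[OF J] slc_add slc_one creal_def)
    have "gt (slc J z) = slc J (cp p z / cp q z - (complex_of_real ginf + complex_of_real (g0 - ginf) * inverse (1 + z\<^sup>2)))"
      unfolding gt_def E cratio_slc[OF J q] cinv_slc[OF J 1] by (simp only: slc_diff slc_add slc_scale slc_of_real)
    moreover have "cp p z * (1 + z\<^sup>2) = complex_of_real ginf * (cp q z * (1 + z\<^sup>2)) + complex_of_real (g0 - ginf) * cp q z + z * cp a z"
    proof -
      have "cp [:1, 0, 1:] z = 1 + z\<^sup>2" by (simp add: cp_pCons power2_eq_square)
      then show ?thesis using arg_cong[OF split, of "\<lambda>p. cp p z"]
        by (simp only: cp_mult cp_add cp_smult cp_pCons of_real_0 add_0)
    qed
    then have "cp p z / cp q z - (complex_of_real ginf + complex_of_real (g0 - ginf) * inverse (1 + z\<^sup>2)) = ?F z"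
      using q 1 by (simp add: divide_simps) (simp add: algebra_simps)
    ultimately show ?thesis by simp
  qed
  have "gt \<in> N0 \<theta>"
    by (rule N0_hclass[OF \<theta>0 \<theta>(2) F _ gt]) (simp_all add: cp_cnj)
  then have comp: "bnd_components \<theta> (cratio p q) g0 ginf gt"
    by (simp add: bnd_components_def gt_def)
  have "(\<lambda>v. Some (blinfun_apply (ext_calc \<theta> \<phi> J (cratio p q) T) v)) = poly_op p T \<circ>\<^sub>m op_inv (poly_op q T)"
    if \<phi>: "\<phi> \<in> {\<omega><..<\<theta>}" and J: "J \<in> imag_units" for \<phi> J
  proof
    fix v
    from \<phi> have \<phi>': "\<omega> < \<phi>" "\<phi> < \<theta>" by auto
    from calc[OF \<phi>' J] obtain K and B X :: "('v, 'n) cmodule \<Rightarrow>\<^sub>L ('v, 'n) cmodule" where br: "bisector_ray T \<omega> \<phi> K J"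
      and B: "inverts (blinfun_apply B) q" and X: "\<And>v. blinfun_apply X v = pev a (blinfun_apply B v)"
      and ray: "\<And>sg. sg \<in> {1, - 1} \<Longrightarrow> sector_resolvent.ray R S \<phi> ?F sg = (sector_resolvent.ray R S \<phi> (\<lambda>z. z / (1 + z\<^sup>2)) sg o\<^sub>L X)"
      by blast
    from br interpret r: bisector_ray T \<omega> \<phi> K J .
    have "blinfun_apply (ext_calc \<theta> \<phi> J (cratio p q) T) v = pev p (B v)"
      by (rule r.ext_calc_rational[OF \<phi>'(2) \<theta>(2) comp gt B X F ray assms(7) a split])
    moreover have "B v \<in> D (degree p)"
      using B D_antimono[OF assms(7)] by (auto simp: inverts_def)
    ultimately show "Some (blinfun_apply (ext_calc \<theta> \<phi> J (cratio p q) T) v) = (poly_op p T \<circ>\<^sub>m op_inv (poly_op q T)) v"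
      by (simp add: map_comp_def op_inv_inverts[OF B] poly_op_pev)
  qed
  moreover have "cratio p q \<in> (Nbnd \<theta> :: ('n clifford \<Rightarrow> 'n clifford) set)"
    unfolding Nbnd_def using comp by blast
  ultimately show ?thesis
    using bij_inverts[OF B0] \<theta> by auto
qed

end
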